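(* Let $r\ge 1$ be an integer, and put $n=\frac{r(r+1)}{2}$ and $m=\frac{(r+1)(r+2)}{2}$. Let $Z\in\mathbb{P}^{2[n]}$, and let $Z'\in\mathbb{P}^{2[m]}$ be residual to $Z$ by a complete intersection of two curves of degree $r+1$ in $\mathbb{P}^2$. Then $Z\in D_{r-1}$ if and only if $Z'\in D_{r}$, where $$D_{r-1}=\{W\in\mathbb{P}^{2[n]} : h^0(\mathbb{P}^2,\mathscr{I}_W(r-1))=1\},\qquad D_{r}=\{W\in\mathbb{P}^{2[m]} : h^0(\mathbb{P}^2,\mathscr{I}_W(r))=1\}.$$
   Context: $\mathbb{P}^2$ is the complex projective plane, and $\mathbb{P}^{2[n]}$ is the Hilbert scheme of zero-dimensional subschemes of length $n$ in $\mathbb{P}^2$; $\mathscr{I}_W$ is the ideal sheaf of $W$. Residual: $Z'$ is residual to $Z$ by a complete intersection of two curves of degree $r+1$ if there are plane curves $X,Y$ of degree $r+1$ without common component such that $X\cap Y=Z\cup Z'$, where $Z'$ is what remains of $X\cap Y$ after removing $Z$. For possibly non-reduced or non-disjoint schemes this is understood in the sense of liaison: $Z\subset X\cap Y$ and $\mathscr{I}_{Z'}=(\mathscr{I}_{X\cap Y}:\mathscr{I}_Z)$. *)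

theory Defs
  imports
    "HOL-Analysis.Analysis"
    "HOL-Library.Poly_Mapping"
    "HOL-Library.Numeral_Type"
    "HOL-Computational_Algebra.Fraction_Field"
    "HOL-Computational_Algebra.Factorial_Ring"
begin

section \<open>The homogeneous coordinate ring and its fraction field\<close>

text \<open>Monomials in three variables are exponent vectors, and \<open>cpoly\<close> is the polynomial ring
  in three variables over the complex numbers (multiplication is convolution).\<close>

type_synonym cpoly = "(3 \<Rightarrow>\<^sub>0 nat) \<Rightarrow>\<^sub>0 complex"

definition eval_poly :: "cpoly \<Rightarrow> complex ^ 3 \<Rightarrow> complex" where
  "eval_poly F v = (\<Sum>m \<in> Poly_Mapping.keys F.
     Poly_Mapping.lookup F m * (\<Prod>i\<in>UNIV. (v $ i) ^ Poly_Mapping.lookup m i))"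

text \<open>As usual, the zero polynomial is a form of every degree.\<close>

definition form :: "nat \<Rightarrow> cpoly \<Rightarrow> bool" where
  "form d F \<longleftrightarrow> (\<forall>m \<in> Poly_Mapping.keys F. (\<Sum>i\<in>UNIV. Poly_Mapping.lookup m i) = d)"

definition const_poly :: "complex \<Rightarrow> cpoly" where
  "const_poly c = Poly_Mapping.single 0 c"

definition scale_fract :: "complex \<Rightarrow> cpoly fract \<Rightarrow> cpoly fract" where
  "scale_fract c s = Fract (const_poly c) 1 * s"

global_interpretation fract_vs: vector_space scale_fract
proof
  show "scale_fract a (x + y) = scale_fract a x + scale_fract a y" for a x y
    by (simp add: scale_fract_def algebra_simps)
  show "scale_fract (a + b) x = scale_fract a x + scale_fract b x" for a b x
    by (simp add: scale_fract_def const_poly_def single_add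
        flip: distrib_right)
  show "scale_fract a (scale_fract b x) = scale_fract (a * b) x" for a b x
    by (simp add: scale_fract_def const_poly_def mult_single flip: mult.assoc)
  show "scale_fract 1 x = x" for x
    by (simp add: scale_fract_def const_poly_def flip: One_fract_def)
qed

text \<open>\<open>B\<close> represents a basis of the quotient space \<open>V / U\<close>.\<close>

definition quotient_basis :: "cpoly fract set \<Rightarrow> cpoly fract set \<Rightarrow> cpoly fract set \<Rightarrow> bool" where
  "quotient_basis V U B \<longleftrightarrow>
     finite B \<and> B \<subseteq> V \<and> fract_vs.span (U \<union> B) = V \<and>
     (\<forall>c. (\<Sum>b\<in>B. scale_fract (c b) b) \<in> U \<longrightarrow> (\<forall>b\<in>B. c b = 0))"

definition quotient_dim :: "cpoly fract set \<Rightarrow> cpoly fract set \<Rightarrow> nat" where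
  "quotient_dim V U = (THE k. \<exists>B. quotient_basis V U B \<and> card B = k)"


section \<open>The projective plane\<close>

text \<open>The closed points are the lines through the origin of \<open>complex ^ 3\<close>.\<close>

typedef plane = "{vec.span {v} | v :: complex ^ 3. v \<noteq> 0}"
  by (rule exI[of _ "vec.span {1}"]) force

definition nonvanishing_at :: "cpoly \<Rightarrow> plane \<Rightarrow> bool" where
  "nonvanishing_at F p \<longleftrightarrow> (\<forall>v \<in> Rep_plane p. v \<noteq> 0 \<longrightarrow> eval_poly F v \<noteq> 0)"

text \<open>The stalk at \<open>p\<close> of the line bundle \<open>O(d)\<close>, as a subset of the fraction field of the
  homogeneous coordinate ring: fractions of forms, of degree \<open>d\<close>, whose denominator does not
  vanish at \<open>p\<close>.\<close>

definition stalk :: "int \<Rightarrow> plane \<Rightarrow> cpoly fract set" where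
  "stalk d p = {Fract A B | A B a b.
     form a A \<and> form b B \<and> int a - int b = d \<and> nonvanishing_at B p}"

abbreviation local_ring :: "plane \<Rightarrow> cpoly fract set" where
  "local_ring p \<equiv> stalk 0 p"

definition local_ideal :: "plane \<Rightarrow> cpoly fract set \<Rightarrow> bool" where
  "local_ideal p J \<longleftrightarrow>
     J \<subseteq> local_ring p \<and> 0 \<in> J \<and> (\<forall>a\<in>J. \<forall>b\<in>J. a + b \<in> J) \<and>
     (\<forall>c\<in>local_ring p. \<forall>a\<in>J. c * a \<in> J)"


section \<open>Zero-dimensional subschemes\<close>

text \<open>A subscheme \<open>W\<close> is given by the stalks \<open>W p\<close> of its ideal sheaf \<open>I\<^sub>W\<close> at the closed
  points. A coherent ideal sheaf is determined by these stalks, and a family of ideals of the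
  local rings comes from a zero-dimensional subscheme iff it has finite support and all
  quotients \<open>O\<^sub>p / W p\<close> are finite-dimensional; the sections of \<open>I\<^sub>W\<close> over an open set are the
  regular functions there whose germ at each point \<open>p\<close> lies in \<open>W p\<close>.\<close>

type_synonym ideal_stalks = "plane \<Rightarrow> cpoly fract set"

definition support :: "ideal_stalks \<Rightarrow> plane set" where
  "support W = {p. W p \<noteq> local_ring p}"

definition zero_dim_subscheme :: "ideal_stalks \<Rightarrow> bool" where
  "zero_dim_subscheme W \<longleftrightarrow>
     (\<forall>p. local_ideal p (W p)) \<and> finite (support W) \<and>
     (\<forall>p. \<exists>B. quotient_basis (local_ring p) (W p) B)"

definition scheme_length :: "ideal_stalks \<Rightarrow> nat" where
  "scheme_length W = (\<Sum>p \<in> support W. quotient_dim (local_ring p) (W p))"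

definition Hilb :: "nat \<Rightarrow> ideal_stalks set" where
  "Hilb n = {W. zero_dim_subscheme W \<and> scheme_length W = n}"

text \<open>The stalk of \<open>I\<^sub>W(d)\<close>. Since \<open>O(d)\<close> is locally free of rank one, all elements of the
  product of the ideal with the stalk of \<open>O(d)\<close> are of the form below.\<close>

definition twisted_stalk :: "ideal_stalks \<Rightarrow> int \<Rightarrow> plane \<Rightarrow> cpoly fract set" where
  "twisted_stalk W d p = {a * s | a s. a \<in> W p \<and> s \<in> stalk d p}"

text \<open>Global sections of \<open>I\<^sub>W(d)\<close>; all stalks lie in one field, with injective restriction maps,
  so a global section is an element lying in every stalk.\<close>

definition global_sections :: "ideal_stalks \<Rightarrow> int \<Rightarrow> cpoly fract set" where
  "global_sections W d = (\<Inter>p. twisted_stalk W d p)"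

definition h0 :: "ideal_stalks \<Rightarrow> int \<Rightarrow> nat" where
  "h0 W d = fract_vs.dim (global_sections W d)"

definition D :: "nat \<Rightarrow> int \<Rightarrow> ideal_stalks set" where
  "D n d = {W \<in> Hilb n. h0 W d = 1}"


section \<open>Residual subschemes\<close>

definition plane_curve :: "nat \<Rightarrow> cpoly \<Rightarrow> bool" where
  "plane_curve d F \<longleftrightarrow> form d F \<and> F \<noteq> 0"

definition no_common_component :: "cpoly \<Rightarrow> cpoly \<Rightarrow> bool" where
  "no_common_component F G \<longleftrightarrow> \<not> (\<exists>H. irreducible H \<and> H dvd F \<and> H dvd G)"

text \<open>The ideal sheaf of the curve \<open>F = 0\<close> of degree \<open>d\<close> is the image of multiplication by \<open>F\<close>
  from \<open>O(-d)\<close> to \<open>O\<close>.\<close>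

definition curve_ideal :: "nat \<Rightarrow> cpoly \<Rightarrow> ideal_stalks" where
  "curve_ideal d F p = {Fract F 1 * s | s. s \<in> stalk (- int d) p}"

definition intersection_ideal :: "ideal_stalks \<Rightarrow> ideal_stalks \<Rightarrow> ideal_stalks" where
  "intersection_ideal I J p = {a + b | a b. a \<in> I p \<and> b \<in> J p}"

definition colon_ideal :: "ideal_stalks \<Rightarrow> ideal_stalks \<Rightarrow> ideal_stalks" where
  "colon_ideal I J p = {a \<in> local_ring p. \<forall>b \<in> J p. a * b \<in> I p}"

definition residual_by_curves :: "nat \<Rightarrow> ideal_stalks \<Rightarrow> ideal_stalks \<Rightarrow> bool" where
  "residual_by_curves d Z Z' \<longleftrightarrow>
     (\<exists>F G. plane_curve d F \<and> plane_curve d G \<and> no_common_component F G \<and>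
        (let XY = intersection_ideal (curve_ideal d F) (curve_ideal d G)
         in (\<forall>p. XY p \<subseteq> Z p) \<and> Z' = colon_ideal XY Z))"

end

theory Submission
  imports Defs
    "HOL-Computational_Algebra.Polynomial_Factorial"
    "HOL-Computational_Algebra.Fundamental_Theorem_Algebra"
    "HOL-Computational_Algebra.Field_as_Ring"
begin

text \<open>Choose a line \<open>l = 0\<close> missing the supports of \<open>Z\<close> and \<open>Z'\<close>, hence all common zeros of the
  two curves \<open>F\<close>, \<open>G\<close> of degree \<open>d = r + 1\<close>. The coordinate ring \<open>R\<close> of its complement is filtered by
  \<open>P k\<close>, the fractions \<open>H / l ^ k\<close> with \<open>H\<close> a form of degree \<open>k\<close>, and restriction to the line identifies
  the graded pieces with univariate polynomials of degree at most \<open>k\<close>. There \<open>F\<close> and \<open>G\<close> become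
  coprime polynomials, so \<open>R / (f, g)\<close> has dimension \<open>d\<^sup>2\<close> and the image of \<open>P (2 * d - 3)\<close> is a
  hyperplane containing no nonzero ideal. The functional \<open>\<phi>\<close> with this kernel makes
  \<open>(a, b) \<mapsto> \<phi> (a * b)\<close> a perfect pairing on \<open>R / (f, g)\<close>, for which the ideals of \<open>Z\<close> and \<open>Z'\<close> are
  orthogonal complements of each other, and so are \<open>P (r - 1)\<close> and \<open>P r\<close>. Comparing dimensions gives
  \<open>h0 Z (r - 1) = h0 Z' r\<close>.\<close>

section \<open>Linear algebra modulo a subspace\<close>

text \<open>The graded ring of \<open>R / (f, g)\<close> is the quotient of the binary forms by the
  coprime leading forms of \<open>f\<close> and \<open>g\<close>, a Gorenstein ring of dimension
  \<open>d ^ 2\<close> whose socle is a line in degree \<open>2 * d - 2\<close>. Hence the kernel of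
  the functional sits in degree \<open>2 * d - 3\<close>, and \<open>P (d - 2)\<close> and
  \<open>P (d - 1)\<close> annihilate each other: their degrees add up to \<open>2 * d - 3\<close>,
  their dimensions \<open>d * (d - 1) / 2\<close> and \<open>d * (d + 1) / 2\<close> to
  \<open>d ^ 2\<close>. The lengths of \<open>Z\<close> and \<open>Z'\<close> are these same two
  numbers, so all other terms cancel when the pairing of the ideal of \<open>Z\<close> with
  \<open>P (d - 1)\<close> is counted from both sides.

  \<open>R\<close> and its ideals are infinite-dimensional, so the counts are made in
  \<open>P (2 * d - 2)\<close>, which maps onto \<open>R / (f, g)\<close>; its intersection with
  \<open>(f, g)\<close> is the radical of the pairing and is carried along explicitly. The local
  data enter through lengths and colon ideals, both of which have to be transported from the local
  rings to \<open>R\<close>.\<close>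

locale linear_space = vector_space scale
  for scale :: "'a::field \<Rightarrow> 'b::ab_group_add \<Rightarrow> 'b"
begin

text \<open>\<open>dim\<close> is the cardinality of a basis and hence 0 on an infinite-dimensional
  space, so dimension counts have to carry this condition.\<close>

definition finite_dim :: "'b set \<Rightarrow> bool" where
  "finite_dim V \<longleftrightarrow> (\<exists>B. finite B \<and> V \<subseteq> span B)"

text \<open>The family \<open>e\<close> represents a basis of \<open>V / U\<close>. It is indexed
  rather than a set so that representatives can be replaced by congruent ones without touching the
  index set whose cardinality is counted.\<close>

definition basis_mod :: "'b set \<Rightarrow> 'b set \<Rightarrow> 'i set \<Rightarrow> ('i \<Rightarrow> 'b) \<Rightarrow> bool" where
  "basis_mod V U I e \<longleftrightarrow> finite I \<and> e ` I \<subseteq> V \<and>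
     (\<forall>v\<in>V. \<exists>c. v - (\<Sum>i\<in>I. scale (c i) (e i)) \<in> U) \<and>
     (\<forall>c. (\<Sum>i\<in>I. scale (c i) (e i)) \<in> U \<longrightarrow> (\<forall>i\<in>I. c i = 0))"

text \<open>Relative to two subspaces, because the functional behind the pairing is controlled only
  on \<open>R\<close>, not on the whole surrounding ring.\<close>

definition bilinear_on :: "'b set \<Rightarrow> 'b set \<Rightarrow> ('b \<Rightarrow> 'b \<Rightarrow> 'a) \<Rightarrow> bool" where
  "bilinear_on V W \<beta> \<longleftrightarrow>
     (\<forall>x\<in>V. \<forall>y\<in>V. \<forall>z\<in>W. \<beta> (x + y) z = \<beta> x z + \<beta> y z) \<and>
     (\<forall>x\<in>V. \<forall>y\<in>W. \<forall>z\<in>W. \<beta> x (y + z) = \<beta> x y + \<beta> x z) \<and>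
     (\<forall>c. \<forall>x\<in>V. \<forall>y\<in>W. \<beta> (scale c x) y = c * \<beta> x y \<and> \<beta> x (scale c y) = c * \<beta> x y)"

lemma finite_dim_mono: "V \<subseteq> W \<Longrightarrow> finite_dim W \<Longrightarrow> finite_dim V"
  unfolding finite_dim_def by blast

lemma dim_zero: "finite_dim {0}" "dim {0} = 0"
proof -
  show "finite_dim {0}" unfolding finite_dim_def by (intro exI[of _ "{}"]) simp
  have "\<not> dependent {}" by (simp add: dependent_finite)
  then show "dim {0} = 0" using dim_unique[of "{}" "{0}" 0] by simp
qed

lemma finite_dim_basis:
  assumes "finite_dim V" "subspace V"
  obtains B where "finite B" "B \<subseteq> V" "\<not> dependent B" "span B = V" "card B = dim V"
proof -
  obtain B where B: "B \<subseteq> V" "\<not> dependent B" "V \<subseteq> span B" "card B = dim V"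
    using basis_exists by blast
  obtain C where "finite C" "V \<subseteq> span C"
    using assms(1) unfolding finite_dim_def by blast
  then have "finite B"
    using independent_span_bound[of C B] B by blast
  moreover have "span B = V"
    using B assms(2) by (simp add: span_subspace)
  ultimately show ?thesis using that B by blast
qed

lemma basis_modI:
  assumes "finite I" "\<And>i. i \<in> I \<Longrightarrow> e i \<in> V"
    and "\<And>v. v \<in> V \<Longrightarrow> \<exists>c. v - (\<Sum>i\<in>I. scale (c i) (e i)) \<in> U"
    and "\<And>c i. (\<Sum>i\<in>I. scale (c i) (e i)) \<in> U \<Longrightarrow> i \<in> I \<Longrightarrow> c i = 0"
  shows "basis_mod V U I e"
  using assms by (auto simp: basis_mod_def)

lemma basis_mod_expand:
  assumes "basis_mod V U I e" "v \<in> V"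
  obtains c where "v - (\<Sum>i\<in>I. scale (c i) (e i)) \<in> U"
  using assms by (auto simp: basis_mod_def)

lemma basis_mod_zero:
  assumes "basis_mod V U I e" "(\<Sum>i\<in>I. scale (c i) (e i)) \<in> U" "i \<in> I"
  shows "c i = 0"
  using assms by (auto simp: basis_mod_def)

lemma basis_mod_inj:
  assumes "basis_mod V U I e" "subspace U"
  shows "inj_on e I"
proof (rule inj_onI, rule ccontr)
  fix i j assume ij: "i \<in> I" "j \<in> I" "e i = e j" "i \<noteq> j"
  let ?c = "\<lambda>k. if k = i then 1::'a else if k = j then -1 else 0"
  have fin: "finite I" using assms(1) by (simp add: basis_mod_def)
  have "(\<Sum>k\<in>I. scale (?c k) (e k)) = (\<Sum>k\<in>{i,j}. scale (?c k) (e k))"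
    using ij fin by (intro sum.mono_neutral_right) auto
  also have "\<dots> = 0" using ij by simp
  finally have "?c i = 0"
    using basis_mod_zero[OF assms(1) _ ij(1), of ?c] subspace_0[OF assms(2)] by simp
  then show False by simp
qed

lemma basis_mod_notin:
  assumes "basis_mod V U I e" "subspace U" "i \<in> I"
  shows "e i \<notin> U"
proof
  assume i: "e i \<in> U"
  let ?c = "\<lambda>k. if k = i then 1::'a else 0"
  have fin: "finite I" using assms(1) by (simp add: basis_mod_def)
  have "(\<Sum>k\<in>I. scale (?c k) (e k)) = (\<Sum>k\<in>{i}. scale (?c k) (e k))"
    using assms(3) fin by (intro sum.mono_neutral_right) auto
  then have "(\<Sum>k\<in>I. scale (?c k) (e k)) \<in> U" using i by simp
  then have "?c i = 0" by (rule basis_mod_zero[OF assms(1) _ assms(3), of ?c])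
  then show False by simp
qed

text \<open>A basis of \<open>U\<close> and representatives of a basis of \<open>V / U\<close>
  together form a basis of \<open>V\<close>. The representatives lie outside \<open>U\<close> and
  are distinct, so the cardinalities add.\<close>

lemma dim_basis_mod:
  assumes "subspace U" "subspace V" "U \<subseteq> V" "basis_mod V U I e" "finite_dim U"
  shows "finite_dim V" "dim V = dim U + card I"
proof -
  obtain B where B: "finite B" "B \<subseteq> U" "\<not> dependent B" "span B = U" "card B = dim U"
    using finite_dim_basis assms(1,5) by blast
  have fin: "finite I" using assms(4) by (simp add: basis_mod_def)
  have inj: "inj_on e I" by (rule basis_mod_inj[OF assms(4,1)])
  have disj: "B \<inter> e ` I = {}"
    using basis_mod_notin[OF assms(4,1)] B(2) by auto
  have indep: "\<not> dependent (B \<union> e ` I)"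
  proof
    assume "dependent (B \<union> e ` I)"
    then obtain u where u: "\<exists>v\<in>B \<union> e ` I. u v \<noteq> 0" "(\<Sum>v\<in>B \<union> e ` I. scale (u v) v) = 0"
      using fin B(1) dependent_finite[of "B \<union> e ` I"] by auto
    have s: "(\<Sum>v\<in>B. scale (u v) v) + (\<Sum>i\<in>I. scale (u (e i)) (e i)) = 0"
      using u(2) sum.union_disjoint[OF B(1) finite_imageI[OF fin] disj, of "\<lambda>v. scale (u v) v"]
      by (simp add: sum.reindex[OF inj] o_def)
    have "(\<Sum>v\<in>B. scale (u v) v) \<in> U"
      using B(2) assms(1) by (intro subspace_sum subspace_scale) auto
    moreover have "(\<Sum>i\<in>I. scale (u (e i)) (e i)) = - (\<Sum>v\<in>B. scale (u v) v)"
      using s by (simp add: eq_neg_iff_add_eq_0 add.commute)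
    ultimately have "(\<Sum>i\<in>I. scale (u (e i)) (e i)) \<in> U"
      using subspace_neg[OF assms(1)] by simp
    then have z: "\<forall>i\<in>I. u (e i) = 0"
      using basis_mod_zero[OF assms(4), of "\<lambda>i. u (e i)"] by blast
    then have "(\<Sum>v\<in>B. scale (u v) v) = 0" using s by simp
    then have "\<forall>v\<in>B. u v = 0"
      using B(1,3) dependent_finite by blast
    with z u(1) show False by auto
  qed
  have sp: "V \<subseteq> span (B \<union> e ` I)"
  proof
    fix v assume "v \<in> V"
    then obtain c where c: "v - (\<Sum>i\<in>I. scale (c i) (e i)) \<in> U"
      using basis_mod_expand[OF assms(4)] by blast
    then have "v - (\<Sum>i\<in>I. scale (c i) (e i)) \<in> span (B \<union> e ` I)"
      using B(4) span_mono[of B "B \<union> e ` I"] by auto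
    moreover have "(\<Sum>i\<in>I. scale (c i) (e i)) \<in> span (B \<union> e ` I)"
      by (intro span_sum span_scale span_base) auto
    ultimately have "(v - (\<Sum>i\<in>I. scale (c i) (e i))) + (\<Sum>i\<in>I. scale (c i) (e i)) \<in> span (B \<union> e ` I)"
      by (rule span_add)
    then show "v \<in> span (B \<union> e ` I)" by (simp only: diff_add_cancel)
  qed
  show "finite_dim V"
    unfolding finite_dim_def using sp B(1) fin by (intro exI[of _ "B \<union> e ` I"]) simp
  have sub: "B \<union> e ` I \<subseteq> V"
    using B(2) assms(3,4) by (auto simp: basis_mod_def)
  have "dim V = card (B \<union> e ` I)"
    using dim_unique[OF sub sp indep] by simp
  also have "\<dots> = dim U + card I"
    using card_Un_disjoint[OF B(1) finite_imageI[OF fin] disj] B(5) card_image[OF inj] by simp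
  finally show "dim V = dim U + card I" .
qed

lemma dim_subspace_le:
  assumes "subspace U" "subspace V" "U \<subseteq> V" "finite_dim V"
  shows "dim U \<le> dim V" "dim U = dim V \<Longrightarrow> U = V"
proof -
  obtain B where B: "finite B" "B \<subseteq> U" "\<not> dependent B" "span B = U" "card B = dim U"
    using finite_dim_basis assms(1) finite_dim_mono[OF assms(3,4)] by blast
  obtain C where C: "B \<subseteq> C" "C \<subseteq> V" "\<not> dependent C" "V \<subseteq> span C"
    using maximal_independent_subset_extend[of B V] B assms(3) by blast
  obtain D where D: "finite D" "V \<subseteq> span D"
    using assms(4) unfolding finite_dim_def by blast
  have fC: "finite C"
    using independent_span_bound[OF D(1) C(3)] C(2) D(2) by blast
  have cC: "card C = dim V"
    using dim_unique[OF C(2,4,3)] by simp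
  show "dim U \<le> dim V"
    using card_mono[OF fC C(1)] B(5) cC by simp
  show "U = V" if "dim U = dim V"
  proof -
    have "B = C" using card_subset_eq[OF fC C(1)] that B(5) cC by simp
    then show ?thesis using B(4) C(4) assms(3) by auto
  qed
qed

lemma dim_kernel_functional:
  assumes "subspace V" "finite_dim V"
    and "\<And>x y. x \<in> V \<Longrightarrow> y \<in> V \<Longrightarrow> h (x + y) = h x + h y"
    and "\<And>c x. x \<in> V \<Longrightarrow> h (scale c x) = c * h x"
    and "v \<in> V" "h v = 1"
  shows "subspace {x \<in> V. h x = 0}" "dim V = dim {x \<in> V. h x = 0} + 1"
proof -
  have h0: "h 0 = 0"
    using assms(4)[of v 0] assms(5) by simp
  show sub: "subspace {x \<in> V. h x = 0}"
    using assms(1,3,4) h0 by (intro subspaceI) (auto simp: subspace_0 subspace_add subspace_scale)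
  have 1: "x - scale (h x) v \<in> {x \<in> V. h x = 0}" if "x \<in> V" for x
  proof -
    have "h (x + scale (- h x) v) = 0"
      using that assms subspace_scale[OF assms(1)] by (subst assms(3)) (auto simp del: scale_minus_left)
    then show ?thesis using that assms(1,5) subspace_diff subspace_scale by (auto simp: scale_minus_left)
  qed
  have "scale c v \<in> {x \<in> V. h x = 0} \<Longrightarrow> c = 0" for c
    using assms(4)[OF assms(5), of c] assms(6) by simp
  then have "basis_mod V {x \<in> V. h x = 0} {()} (\<lambda>_. v)"
    using assms(5)
  proof (intro basis_modI, goal_cases)
    case (3 x)
    show ?case
      using 1[OF 3(3)] by (intro exI[of _ "\<lambda>_. h x"]) (simp only: sum.insert finite.emptyI sum.empty empty_iff not_False_eq_True add_0_right)
  qed auto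
  from dim_basis_mod(2)[OF sub assms(1) _ this]
  show "dim V = dim {x \<in> V. h x = 0} + 1"
    using finite_dim_mono[OF _ assms(2)] by simp
qed

text \<open>The rank of a pairing is the same from either side. Induction on the dimension splits
  off a pair \<open>v\<close>, \<open>w\<close> with \<open>\<beta> v w = 1\<close>: passing to the
  kernels of \<open>\<beta> _ w\<close> and \<open>\<beta> v _\<close> lowers both dimensions by one
  and leaves both annihilators unchanged.\<close>

lemma dim_pairing:
  assumes "subspace V" "finite_dim V" "subspace W" "finite_dim W" "bilinear_on V W \<beta>"
  shows "dim V + dim {w \<in> W. \<forall>v\<in>V. \<beta> v w = 0} = dim W + dim {v \<in> V. \<forall>w\<in>W. \<beta> v w = 0}"
  using assms
proof (induction "dim V" arbitrary: V W rule: less_induct)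
  case less
  show ?case
  proof (cases "\<exists>v\<in>V. \<exists>w\<in>W. \<beta> v w \<noteq> 0")
    case False
    then have "{w \<in> W. \<forall>v\<in>V. \<beta> v w = 0} = W" "{v \<in> V. \<forall>w\<in>W. \<beta> v w = 0} = V" by auto
    then show ?thesis by simp
  next
    case True
    then obtain v' w where vw: "v' \<in> V" "w \<in> W" "\<beta> v' w \<noteq> 0" by blast
    define v where "v = scale (inverse (\<beta> v' w)) v'"
    have v: "v \<in> V" "\<beta> v w = 1"
      using vw less.prems unfolding v_def bilinear_on_def by (auto simp: subspace_scale)
    let ?V = "{x \<in> V. \<beta> x w = 0}" and ?W = "{y \<in> W. \<beta> v y = 0}"
    have V: "subspace ?V" "dim V = dim ?V + 1"
      using dim_kernel_functional[of V "\<lambda>x. \<beta> x w" v] less.prems v vw(2)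
      unfolding bilinear_on_def by blast+
    have W: "subspace ?W" "dim W = dim ?W + 1"
      using dim_kernel_functional[of W "\<lambda>y. \<beta> v y" w] less.prems v vw(2)
      unfolding bilinear_on_def by blast+
    have bl: "bilinear_on ?V ?W \<beta>"
      using less.prems(5) unfolding bilinear_on_def by blast
    have IH: "dim ?V + dim {w \<in> ?W. \<forall>v\<in>?V. \<beta> v w = 0} = dim ?W + dim {v \<in> ?V. \<forall>w\<in>?W. \<beta> v w = 0}"
      using V W less.prems finite_dim_mono[of ?V V] finite_dim_mono[of ?W W] bl
      by (intro less.hyps) auto
    have dl: "\<beta> (x + scale c y) z = \<beta> x z + c * \<beta> y z" if "x \<in> V" "y \<in> V" "z \<in> W" for x y z c
      using less.prems(5) that subspace_scale[OF less.prems(1)] unfolding bilinear_on_def by simp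
    have dr: "\<beta> x (y + scale c z) = \<beta> x y + c * \<beta> x z" if "x \<in> V" "y \<in> W" "z \<in> W" for x y z c
      using less.prems(5) that subspace_scale[OF less.prems(3)] unfolding bilinear_on_def by simp
    have 1: "{y \<in> ?W. \<forall>x\<in>?V. \<beta> x y = 0} = {y \<in> W. \<forall>x\<in>V. \<beta> x y = 0}"
    proof safe
      fix x y assume y: "y \<in> W" "\<forall>x\<in>?V. \<beta> x y = 0" "\<beta> v y = 0" and x: "x \<in> V"
      \<comment> \<open>This projects \<open>x\<close> along \<open>v\<close> into
        \<open>?V\<close>; the correction is invisible to \<open>y\<close> because
        \<open>\<beta> v y = 0\<close>.\<close>
      have "x + scale (- \<beta> x w) v \<in> ?V"
        using x v dl[OF x v(1) vw(2), of "- \<beta> x w"] less.prems(1) by (auto intro!: subspace_add subspace_scale simp del: scale_minus_left)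
      then have "\<beta> (x + scale (- \<beta> x w) v) y = 0" using y(2) by blast
      then show "\<beta> x y = 0" using dl[OF x v(1) y(1), of "- \<beta> x w"] y(3) by simp
    qed (use v in auto)
    have 2: "{x \<in> ?V. \<forall>y\<in>?W. \<beta> x y = 0} = {x \<in> V. \<forall>y\<in>W. \<beta> x y = 0}"
    proof safe
      fix x y assume x: "x \<in> V" "\<forall>y\<in>?W. \<beta> x y = 0" "\<beta> x w = 0" and y: "y \<in> W"
      have "y + scale (- \<beta> v y) w \<in> ?W"
        using y v dr[OF v(1) y vw(2), of "- \<beta> v y"] vw(2) less.prems(3) by (auto intro!: subspace_add subspace_scale simp del: scale_minus_left)
      then have "\<beta> x (y + scale (- \<beta> v y) w) = 0" using x(2) by blast
      then show "\<beta> x y = 0" using dr[OF x(1) y vw(2), of "- \<beta> v y"] x(3) by simp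
    qed (use vw in auto)
    from IH V W show ?thesis unfolding 1 2 by simp
  qed
qed

text \<open>\<open>U\<close> and \<open>V\<close> may be infinite-dimensional, so \<open>dim\<close>
  cannot be applied to them. Inside the finite-dimensional span \<open>?V\<close> of both families,
  \<open>e\<close> shows that \<open>U \<inter> ?V\<close> has codimension \<open>card I\<close>,
  while in the subspace \<open>?S\<close> of \<open>?V\<close> its codimension is
  \<open>card J\<close>.\<close>

lemma independent_mod_card:
  assumes "subspace U" "subspace V" "U \<subseteq> V" "basis_mod V U I e"
    and "finite J" "\<And>j. j \<in> J \<Longrightarrow> v j \<in> V"
    and indep: "\<And>c j. (\<Sum>j\<in>J. scale (c j) (v j)) \<in> U \<Longrightarrow> j \<in> J \<Longrightarrow> c j = 0"
  shows "card J \<le> card I"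
proof -
  have fin: "finite I" and eV: "e ` I \<subseteq> V" using assms(4) by (auto simp: basis_mod_def)
  let ?V = "span (v ` J \<union> e ` I)"
  let ?U = "U \<inter> ?V"
  let ?S = "{x + y | x y. x \<in> span (v ` J) \<and> y \<in> ?U}"
  have VV: "?V \<subseteq> V" using assms(6) eV by (intro span_minimal assms(2)) auto
  have U: "subspace ?U" using assms(1) subspace_span by (rule subspace_inter)
  have fV: "finite_dim ?V" unfolding finite_dim_def using assms(5) fin
    by (intro exI[of _ "v ` J \<union> e ` I"]) simp
  have fU: "finite_dim ?U" using finite_dim_mono[OF Int_lower2 fV] .
  have "basis_mod ?V ?U I e"
  proof (rule basis_modI)
    fix x assume x: "x \<in> ?V"
    then obtain c where c: "x - (\<Sum>i\<in>I. scale (c i) (e i)) \<in> U"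
      using basis_mod_expand[OF assms(4)] VV by blast
    have "x - (\<Sum>i\<in>I. scale (c i) (e i)) \<in> ?V"
      by (intro span_diff[OF x] span_sum span_scale, intro span_base) auto
    then show "\<exists>c. x - (\<Sum>i\<in>I. scale (c i) (e i)) \<in> ?U" using c by (intro exI[of _ c]) blast
  next
    fix c i assume "(\<Sum>i\<in>I. scale (c i) (e i)) \<in> ?U" "i \<in> I"
    then show "c i = 0" using basis_mod_zero[OF assms(4), of c i] by blast
  next
    show "e i \<in> ?V" if "i \<in> I" for i using that by (intro span_base) blast
  qed (rule fin)
  then have 1: "dim ?V = dim ?U + card I"
    using dim_basis_mod(2)[OF U subspace_span Int_lower2 _ fU] by blast
  have S: "subspace ?S" using subspace_sums[OF subspace_span U] .
  have "basis_mod ?S ?U J v"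
  proof (rule basis_modI)
    fix j assume "j \<in> J"
    then have "v j + 0 \<in> ?S" using span_base[of "v j" "v ` J"] subspace_0[OF U] by blast
    then show "v j \<in> ?S" by simp
  next
    fix w assume "w \<in> ?S"
    then obtain x y where xy: "w = x + y" "x \<in> span (v ` J)" "y \<in> ?U" by blast
    have "x \<in> span (v ` J) \<Longrightarrow> \<exists>c. x = (\<Sum>j\<in>J. scale (c j) (v j))" for x
    proof (induction x rule: span_induct_alt)
      case base
      show ?case by (intro exI[of _ "\<lambda>_. 0"]) simp
    next
      case (step a z y)
      then obtain j c where jc: "j \<in> J" "z = v j" "y = (\<Sum>j\<in>J. scale (c j) (v j))" by auto
      have "scale a z + y = (\<Sum>i\<in>J. scale (if i = j then a else 0) (v i)) + (\<Sum>j\<in>J. scale (c j) (v j))"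
        using jc assms(5) by (simp add: if_distrib[of "\<lambda>a. scale a _"] sum.delta cong: if_cong)
      also have "\<dots> = (\<Sum>i\<in>J. scale ((if i = j then a else 0) + c i) (v i))"
        by (simp only: scale_left_distrib sum.distrib)
      finally show ?case by (rule exI[of _ "\<lambda>i. (if i = j then a else 0) + c i"])
    qed
    then obtain c where "x = (\<Sum>j\<in>J. scale (c j) (v j))" using xy(2) by blast
    then have "w - (\<Sum>j\<in>J. scale (c j) (v j)) \<in> ?U" using xy(1,3) by simp
    then show "\<exists>c. w - (\<Sum>j\<in>J. scale (c j) (v j)) \<in> ?U" by (rule exI[of _ c])
  next
    fix c j assume "(\<Sum>j\<in>J. scale (c j) (v j)) \<in> ?U" "j \<in> J"
    then show "c j = 0" using indep[of c j] by blast
  qed (rule assms(5))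
  moreover have "?U \<subseteq> ?S" using span_zero[of "v ` J"] by force
  ultimately have 2: "dim ?S = dim ?U + card J"
    using dim_basis_mod(2)[OF U S _ _ fU] by blast
  have "?S \<subseteq> ?V"
  proof
    fix w assume "w \<in> ?S"
    then obtain x y where xy: "w = x + y" "x \<in> span (v ` J)" "y \<in> ?V" by blast
    then show "w \<in> ?V" using span_mono[of "v ` J" "v ` J \<union> e ` I"] span_add by blast
  qed
  from dim_subspace_le(1)[OF S subspace_span this fV] 1 2 show ?thesis by simp
qed

text \<open>Meant for multiplication by \<open>Fract (l ^ n) 1\<close>, which turns functions on the
  chart into sections of degree \<open>n\<close>.\<close>

lemma dim_injective_image:
  assumes "subspace V" "finite_dim V"
    and "\<And>x y. h (x + y) = h x + h y" "\<And>c x. h (scale c x) = scale c (h x)"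
    and "\<And>x. h x = 0 \<Longrightarrow> x = 0"
  shows "dim (h ` V) = dim V"
proof -
  obtain B where B: "finite B" "B \<subseteq> V" "\<not> dependent B" "span B = V" "card B = dim V"
    using finite_dim_basis[OF assms(2,1)] by blast
  have h0: "h 0 = 0" using assms(4)[of 0 0] by simp
  have hs: "h (\<Sum>b\<in>S. scale (c b) b) = (\<Sum>b\<in>S. scale (c b) (h b))" for c S
    by (induction S rule: infinite_finite_induct) (simp_all add: h0 assms(3,4))
  have V: "subspace (h ` V)"
  proof (rule subspaceI)
    show "0 \<in> h ` V" using h0 subspace_0[OF assms(1)] by force
    show "x + y \<in> h ` V" if "x \<in> h ` V" "y \<in> h ` V" for x y
      using that assms(3) subspace_add[OF assms(1)] by (metis (no_types, lifting) image_iff)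
    show "scale c x \<in> h ` V" if "x \<in> h ` V" for c x
      using that assms(4) subspace_scale[OF assms(1)] by (metis (no_types, lifting) image_iff)
  qed
  have "basis_mod (h ` V) {0} B h"
  proof (rule basis_modI)
    fix y assume "y \<in> h ` V"
    then obtain c where "y = h (\<Sum>b\<in>B. scale (c b) b)"
      using B(4) unfolding span_finite[OF B(1)] by blast
    then show "\<exists>c. y - (\<Sum>b\<in>B. scale (c b) (h b)) \<in> {0}" using hs by (intro exI[of _ c]) simp
  next
    fix c b assume "(\<Sum>b\<in>B. scale (c b) (h b)) \<in> {0}" "b \<in> B"
    then have "(\<Sum>b\<in>B. scale (c b) b) = 0" using hs[of c B] assms(5) by simp
    then show "c b = 0" using B(1,3) \<open>b \<in> B\<close> dependent_finite by blast
  qed (use B in auto)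
  then show ?thesis
    using dim_basis_mod(2)[of "{0}" "h ` V" B h] V dim_zero subspace_0[OF V] B(5) by simp
qed

end

section \<open>Filtered complete intersections\<close>

text \<open>\<open>P k / P (k - 1)\<close> is the space of binary forms of degree \<open>k\<close>,
  dehomogenized to one variable by \<open>lead k\<close>. The indices are integers so that degrees
  can be subtracted freely; the guards on zero polynomials are there because
  \<open>degree 0 = 0\<close> exceeds a negative \<open>k\<close>.\<close>

locale lead_filtration = linear_space scale
  for scale :: "complex \<Rightarrow> 'b::idom \<Rightarrow> 'b" +
  fixes P :: "int \<Rightarrow> 'b set" and lead :: "int \<Rightarrow> 'b \<Rightarrow> complex poly"
  assumes scale_mult_left: "scale c a * b = scale c (a * b)"
    and subspace_P: "subspace (P k)"
    and P_neg: "k < 0 \<Longrightarrow> P k = {0}"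
    and P_mult: "a \<in> P j \<Longrightarrow> b \<in> P k \<Longrightarrow> a * b \<in> P (j + k)"
    and P_pred: "P (k - 1) \<subseteq> P k"
    and lead_mult: "a \<in> P j \<Longrightarrow> b \<in> P k \<Longrightarrow> lead (j + k) (a * b) = lead j a * lead k b"
    and lead_add: "a \<in> P k \<Longrightarrow> b \<in> P k \<Longrightarrow> lead k (a + b) = lead k a + lead k b"
    and lead_scale: "a \<in> P k \<Longrightarrow> lead k (scale c a) = smult c (lead k a)"
    and lead_eq_0: "a \<in> P k \<Longrightarrow> lead k a = 0 \<longleftrightarrow> a \<in> P (k - 1)"
    and degree_lead: "a \<in> P k \<Longrightarrow> lead k a \<noteq> 0 \<Longrightarrow> int (degree (lead k a)) \<le> k"
    and lead_surj: "(u \<noteq> 0 \<Longrightarrow> int (degree u) \<le> k) \<Longrightarrow> \<exists>a\<in>P k. lead k a = u"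
begin

lemma scale_mult_right: "a * scale c b = scale c (a * b)"
  using scale_mult_left[of c b a] by (simp add: mult.commute)

lemma P_mono: "j \<le> k \<Longrightarrow> P j \<subseteq> P k"
proof (induction "nat (k - j)" arbitrary: k)
  case 0
  then show ?case by simp
next
  case (Suc n)
  then have "P j \<subseteq> P (k - 1)" by (intro Suc.hyps(1)) auto
  then show ?case using P_pred by blast
qed

lemmas P_0 = subspace_0[OF subspace_P]
lemmas P_add = subspace_add[OF subspace_P]
lemmas P_diff = subspace_diff[OF subspace_P]
lemmas P_scale = subspace_scale[OF subspace_P]
lemmas P_sum = subspace_sum[OF subspace_P]

lemma P_mult_eq: "a \<in> P j \<Longrightarrow> b \<in> P k \<Longrightarrow> i = j + k \<Longrightarrow> a * b \<in> P i"
  using P_mult by blast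

lemma lead_diff: "a \<in> P k \<Longrightarrow> b \<in> P k \<Longrightarrow> lead k (a - b) = lead k a - lead k b"
  using lead_add[of a k "scale (-1) b"] lead_scale[of b k "-1"] P_scale[of b k "-1"] by simp

lemma lead_sum:
  assumes "\<And>i. i \<in> I \<Longrightarrow> e i \<in> P k"
  shows "lead k (\<Sum>i\<in>I. scale (c i) (e i)) = (\<Sum>i\<in>I. smult (c i) (lead k (e i)))"
proof -
  have z: "lead k 0 = 0" using lead_eq_0[of 0 k] P_0 by blast
  show ?thesis
    using assms
  proof (induction I rule: infinite_finite_induct)
    case (insert i I)
    then have "lead k (scale (c i) (e i) + (\<Sum>i\<in>I. scale (c i) (e i))) =
        lead k (scale (c i) (e i)) + lead k (\<Sum>i\<in>I. scale (c i) (e i))"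
      by (intro lead_add P_scale P_sum) auto
    then show ?case using insert by (simp add: lead_scale)
  qed (simp_all add: z)
qed

definition R :: "'b set" where "R = (\<Union>k. P k)"

lemma P_subset_R: "P k \<subseteq> R" unfolding R_def by blast

lemma R_two:
  assumes "a \<in> R" "b \<in> R"
  obtains k where "a \<in> P k" "b \<in> P k"
proof -
  obtain i j where "a \<in> P i" "b \<in> P j" using assms unfolding R_def by blast
  then have "a \<in> P (max i j)" "b \<in> P (max i j)"
    using P_mono[of i "max i j"] P_mono[of j "max i j"] by auto
  then show ?thesis by (rule that)
qed

lemma subspace_R: "subspace R"
proof (rule subspaceI)
  show "0 \<in> R" using P_0 P_subset_R by blast
  show "a + b \<in> R" if "a \<in> R" "b \<in> R" for a b
    using R_two[OF that] P_add P_subset_R by (metis subsetD)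
  show "scale c a \<in> R" if "a \<in> R" for c a
    using that P_scale unfolding R_def by blast
qed

lemma R_mult: "a \<in> R \<Longrightarrow> b \<in> R \<Longrightarrow> a * b \<in> R"
  using P_mult unfolding R_def by blast

lemmas R_0 = subspace_0[OF subspace_R]
lemmas R_add = subspace_add[OF subspace_R]
lemmas R_diff = subspace_diff[OF subspace_R]
lemmas R_scale = subspace_scale[OF subspace_R]

lemma basis_mod_P:
  assumes "\<And>i. i \<le> n \<Longrightarrow> e i \<in> P (int n) \<and> lead (int n) (e i) = monom 1 i"
  shows "basis_mod (P (int n)) (P (int n - 1)) {..n} e"
proof (rule basis_modI)
  have ls: "lead (int n) (\<Sum>i\<le>n. scale (c i) (e i)) = (\<Sum>i\<le>n. monom (c i) i)" for c
    using assms by (subst lead_sum) (auto simp: smult_monom intro!: sum.cong)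
  have mem: "(\<Sum>i\<le>n. scale (c i) (e i)) \<in> P (int n)" for c
    using assms by (intro P_sum P_scale) auto
  fix v assume v: "v \<in> P (int n)"
  define c where "c = coeff (lead (int n) v)"
  have "degree (lead (int n) v) \<le> n"
    using degree_lead[OF v] by (cases "lead (int n) v = 0") auto
  then have "lead (int n) v = (\<Sum>i\<le>n. monom (c i) i)"
    unfolding c_def by (simp add: poly_as_sum_of_monoms')
  then have "lead (int n) (v - (\<Sum>i\<le>n. scale (c i) (e i))) = 0"
    using lead_diff[OF v mem] ls by simp
  then show "\<exists>c. v - (\<Sum>i\<le>n. scale (c i) (e i)) \<in> P (int n - 1)"
    using lead_eq_0 P_diff[OF v mem] by blast
next
  fix c i assume a: "(\<Sum>i\<le>n. scale (c i) (e i)) \<in> P (int n - 1)" and i: "i \<in> {..n}"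
  have mem: "(\<Sum>i\<le>n. scale (c i) (e i)) \<in> P (int n)"
    using assms by (intro P_sum P_scale) auto
  have "(\<Sum>i\<le>n. monom (c i) i) = lead (int n) (\<Sum>i\<le>n. scale (c i) (e i))"
    using assms by (subst lead_sum) (auto simp: smult_monom intro!: sum.cong)
  also have "\<dots> = 0" using a lead_eq_0[OF mem] by simp
  finally have "coeff (\<Sum>i\<le>n. monom (c i) i) i = 0" by simp
  then show "c i = 0" using i by (simp add: coeff_sum)
qed (use assms in auto)

text \<open>Each graded piece adds \<open>n + 1\<close> dimensions. For \<open>k < -2\<close> the
  right side is positive although \<open>P k\<close> is zero; \<open>k = -1\<close> has to be
  covered because \<open>d - 2\<close> takes this value for \<open>d = 1\<close>.\<close>

lemma dim_P:
  shows "finite_dim (P k)" and "k \<ge> -1 \<Longrightarrow> 2 * int (dim (P k)) = (k + 1) * (k + 2)"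
proof -
  have *: "finite_dim (P (int n - 1)) \<and> 2 * dim (P (int n - 1)) = n * (n + 1)" for n
  proof (induction n)
    case 0
    then show ?case by (simp add: P_neg dim_zero)
  next
    case (Suc n)
    have "\<exists>e. \<forall>i. i \<le> n \<longrightarrow> e i \<in> P (int n) \<and> lead (int n) (e i) = monom 1 i"
      using lead_surj[of "monom 1 i" "int n" for i] by (intro choice) (auto simp: degree_monom_eq)
    then obtain e where "\<And>i. i \<le> n \<Longrightarrow> e i \<in> P (int n) \<and> lead (int n) (e i) = monom 1 i" by blast
    from dim_basis_mod[OF subspace_P subspace_P P_pred basis_mod_P[OF this]] Suc
    have "finite_dim (P (int n))" "dim (P (int n)) = dim (P (int n - 1)) + (n + 1)" by auto
    then show ?case using Suc by simp
  qed
  show "finite_dim (P k)"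
    using *[of "nat (k + 1)"] finite_dim_mono[OF P_mono[of k "int (nat (k + 1)) - 1"]] by auto
  show "2 * int (dim (P k)) = (k + 1) * (k + 2)" if "k \<ge> -1"
  proof -
    have "int (2 * dim (P (int (nat (k + 1)) - 1))) = int (nat (k + 1) * (nat (k + 1) + 1))"
      using * by presburger
    then show ?thesis using that by (simp add: algebra_simps)
  qed
qed

end

text \<open>Coprimality excludes common zeros on the line at infinity at finite parameters. A
  polynomial in one variable does not see the remaining point of that line; there \<open>f\<close>
  is nonzero because its leading polynomial has the full degree \<open>d\<close>.\<close>

locale complete_intersection = lead_filtration scale P lead
  for scale :: "complex \<Rightarrow> 'b::idom \<Rightarrow> 'b" and P lead +
  fixes d :: int and f g :: 'b
  assumes d_pos: "d \<ge> 1" and f_in: "f \<in> P d" and g_in: "g \<in> P d"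
    and degree_lead_f: "int (degree (lead d f)) = d"
    and coprime_lead: "coprime (lead d f) (lead d g)"
begin

section \<open>Relations between \<open>f\<close> and \<open>g\<close>, and strictness of the
  filtration\<close>

lemma lead_f_nz: "lead d f \<noteq> 0"
  using degree_lead_f d_pos by auto

text \<open>If the top part of \<open>a * f + b * g\<close> cancels, the leading polynomials satisfy
  a relation. By coprimality it is a multiple of the Koszul relation \<open>(g, - f)\<close>, which
  lifts to \<open>R\<close> and can be subtracted.\<close>

lemma syzygy:
  assumes "a \<in> P j" "b \<in> P j" "a * f + b * g \<in> P (j + d - 1)"
  obtains c where "c \<in> P (j - d)" "a - c * g \<in> P (j - 1)" "b + c * f \<in> P (j - 1)"
proof -
  have af: "a * f \<in> P (j + d)" and bg: "b * g \<in> P (j + d)"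
    using P_mult assms f_in g_in by auto
  have "lead (j + d) (a * f + b * g) = 0"
    using assms(3) lead_eq_0 P_add[OF af bg] by simp
  then have eq: "lead j a * lead d f + lead j b * lead d g = 0"
    using lead_add[OF af bg] lead_mult assms(1,2) f_in g_in by simp
  then have eq': "lead j b * lead d g = - lead j a * lead d f"
    by (simp add: eq_neg_iff_add_eq_0 add.commute)
  then have "lead d f dvd lead j b * lead d g" by simp
  then have "lead d f dvd lead j b"
    using coprime_lead coprime_dvd_mult_left_iff by blast
  then obtain q where q: "lead j b = lead d f * - q" by (metis dvdE minus_minus)
  have "(lead j a - q * lead d g) * lead d f = 0"
    using eq unfolding q by (simp add: algebra_simps)
  then have qa: "lead j a = q * lead d g" using lead_f_nz by simp
  \<comment> \<open>The exact degree of \<open>lead d f\<close> bounds \<open>q\<close>, so that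
    \<open>q\<close> is the leading polynomial of an element of \<open>P (j - d)\<close>.\<close>
  have "int (degree q) \<le> j - d" if "q \<noteq> 0"
  proof -
    have "lead j b \<noteq> 0" using q that lead_f_nz by simp
    then have "int (degree (lead j b)) \<le> j" using degree_lead assms(2) by blast
    then show ?thesis using q that lead_f_nz degree_lead_f by (simp add: degree_mult_eq)
  qed
  then obtain c where c: "c \<in> P (j - d)" "lead (j - d) c = q" using lead_surj by blast
  have cf: "c * f \<in> P j" "lead j (c * f) = q * lead d f"
    and cg: "c * g \<in> P j" "lead j (c * g) = q * lead d g"
    using P_mult[OF c(1) f_in] P_mult[OF c(1) g_in] lead_mult[OF c(1) f_in] lead_mult[OF c(1) g_in] c(2)
    by simp_all
  have "a - c * g \<in> P (j - 1)"
    using lead_eq_0[OF P_diff[OF assms(1) cg(1)]] lead_diff[OF assms(1) cg(1)] qa cg(2) by simp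
  moreover have "b + c * f \<in> P (j - 1)"
    using lead_eq_0[OF P_add[OF assms(2) cf(1)]] lead_add[OF assms(2) cf(1)] q cf(2) by simp
  ultimately show ?thesis using that c(1) by blast
qed

text \<open>Subtracting Koszul relations lowers the degree of the coefficients without changing the
  value, until no cancellation is left. So the ideal meets \<open>P k\<close> only in the
  combinations of the expected degree.\<close>

lemma strict:
  assumes "a \<in> P j" "b \<in> P j" "a * f + b * g \<in> P k"
  shows "\<exists>a'\<in>P (k - d). \<exists>b'\<in>P (k - d). a * f + b * g = a' * f + b' * g"
  using assms
proof (induction "nat (j - (k - d))" arbitrary: a b j)
  case 0
  then show ?case using P_mono[of j "k - d"] by auto
next
  case (Suc n)
  then have "a * f + b * g \<in> P (j + d - 1)"
    using subsetD[OF P_mono[of k "j + d - 1"]] by simp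
  then obtain c where c: "a - c * g \<in> P (j - 1)" "b + c * f \<in> P (j - 1)"
    using syzygy Suc.prems by blast
  have e: "(a - c * g) * f + (b + c * f) * g = a * f + b * g" by (simp add: algebra_simps)
  have "\<exists>a'\<in>P (k - d). \<exists>b'\<in>P (k - d). (a - c * g) * f + (b + c * f) * g = a' * f + b' * g"
    using Suc.hyps(2) Suc.prems(3) c by (intro Suc.hyps(1)[of "j - 1"]) (auto simp: e)
  then show ?case unfolding e .
qed

text \<open>Below degree \<open>d\<close> the Koszul multiplier lies in
  \<open>P (j - d) = {0}\<close>, so \<open>a\<close> and \<open>b\<close> themselves drop in degree
  until they vanish.\<close>

lemma syzygy_trivial:
  assumes "a \<in> P j" "b \<in> P j" "j < d" "a * f + b * g = 0"
  shows "a = 0 \<and> b = 0"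
  using assms
proof (induction "nat (j + 1)" arbitrary: j)
  case 0
  then show ?case using P_neg[of j] by auto
next
  case (Suc n)
  then obtain c where c: "c \<in> P (j - d)" "a - c * g \<in> P (j - 1)" "b + c * f \<in> P (j - 1)"
    using syzygy[of a j b] P_0 by auto
  then have "c = 0" using P_neg[of "j - d"] Suc.prems by auto
  then show ?case using Suc.hyps(2) Suc.prems c by (intro Suc.hyps(1)[of "j - 1"]) auto
qed

definition FF :: "'b set" where "FF = {a * f + b * g | a b. a \<in> R \<and> b \<in> R}"

lemma FFI: "a \<in> R \<Longrightarrow> b \<in> R \<Longrightarrow> a * f + b * g \<in> FF"
  unfolding FF_def by blast

lemma FF_subset_R: "FF \<subseteq> R"
  using f_in g_in P_subset_R unfolding FF_def by (auto intro!: R_add R_mult)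

lemma subspace_FF: "subspace FF"
proof (rule subspaceI)
  show "0 \<in> FF" using FFI[OF R_0 R_0] by simp
  show "x + y \<in> FF" if "x \<in> FF" "y \<in> FF" for x y
  proof -
    from that obtain a b a' b' where *: "x = a * f + b * g" "y = a' * f + b' * g"
      "a \<in> R" "b \<in> R" "a' \<in> R" "b' \<in> R" unfolding FF_def by blast
    then have "x + y = (a + a') * f + (b + b') * g" by (simp add: algebra_simps)
    then show ?thesis using FFI[of "a + a'" "b + b'"] * R_add by simp
  qed
  show "scale c x \<in> FF" if "x \<in> FF" for c x
  proof -
    from that obtain a b where *: "x = a * f + b * g" "a \<in> R" "b \<in> R" unfolding FF_def by blast
    then have "scale c x = scale c a * f + scale c b * g" by (simp add: scale_mult_left scale_right_distrib)
    then show ?thesis using FFI[of "scale c a" "scale c b"] * R_scale by simp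
  qed
qed

lemma FF_mult: "x \<in> R \<Longrightarrow> y \<in> FF \<Longrightarrow> x * y \<in> FF"
proof -
  assume x: "x \<in> R" and "y \<in> FF"
  then obtain a b where *: "y = a * f + b * g" "a \<in> R" "b \<in> R" unfolding FF_def by blast
  then have "x * y = (x * a) * f + (x * b) * g" by (simp add: algebra_simps)
  then show ?thesis using FFI[of "x * a" "x * b"] * x R_mult by simp
qed

lemmas FF_0 = subspace_0[OF subspace_FF]
lemmas FF_add = subspace_add[OF subspace_FF]
lemmas FF_scale = subspace_scale[OF subspace_FF]

lemma FF_P:
  assumes "x \<in> FF" "x \<in> P k"
  obtains a b where "a \<in> P (k - d)" "b \<in> P (k - d)" "x = a * f + b * g"
proof -
  obtain a b where *: "x = a * f + b * g" "a \<in> R" "b \<in> R" using assms(1) unfolding FF_def by blast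
  obtain j where "a \<in> P j" "b \<in> P j" using R_two * by blast
  with strict[of a j b k] * assms(2) that show ?thesis by blast
qed

lemma FF_P_zero: "x \<in> FF \<Longrightarrow> x \<in> P k \<Longrightarrow> k < d \<Longrightarrow> x = 0"
  using FF_P[of x k] P_neg[of "k - d"] by auto

text \<open>The map from pairs in \<open>P (d - 2)\<close> to \<open>a * f + b * g\<close> is onto
  by strictness and injective since \<open>d - 2 < d\<close>. Together with \<open>dim_P\<close>
  this gives codimension \<open>d ^ 2\<close>, the number predicted by Bezout.\<close>

lemma dim_FF_P:
  "dim (FF \<inter> P (2 * d - 2)) = 2 * dim (P (d - 2))"
proof -
  let ?V = "FF \<inter> P (2 * d - 2)"
  obtain B where B: "finite B" "B \<subseteq> P (d - 2)" "\<not> dependent B" "span B = P (d - 2)" "card B = dim (P (d - 2))"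
    using finite_dim_basis[OF dim_P(1) subspace_P] by blast
  let ?e = "\<lambda>x. fst x * (if snd x then f else g)"
  have sum_e: "(\<Sum>x\<in>B \<times> UNIV. scale (c x) (?e x)) =
      (\<Sum>b\<in>B. scale (c (b, True)) b) * f + (\<Sum>b\<in>B. scale (c (b, False)) b) * g" for c
  proof -
    have "(\<Sum>x\<in>B \<times> UNIV. scale (c x) (?e x)) = (\<Sum>b\<in>B. \<Sum>t\<in>UNIV. scale (c (b, t)) (?e (b, t)))"
      by (simp only: sum.cartesian_product case_prod_unfold prod.collapse)
    also have "\<dots> = (\<Sum>b\<in>B. scale (c (b, True)) b * f + scale (c (b, False)) b * g)"
      by (simp add: UNIV_bool scale_mult_left add.commute)
    finally show ?thesis by (simp add: sum.distrib sum_distrib_right)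
  qed
  have "basis_mod ?V {0} (B \<times> (UNIV :: bool set)) ?e"
  proof (rule basis_modI)
    show "finite (B \<times> (UNIV :: bool set))" using B(1) by simp
    fix i :: "'b \<times> bool" assume "i \<in> B \<times> UNIV"
    then have i: "fst i \<in> P (d - 2)" "fst i \<in> R" using B(2) P_subset_R[of "d - 2"] by auto
    have "fst i * f \<in> FF" "fst i * g \<in> FF"
      using FFI[OF i(2) R_0] FFI[OF R_0 i(2)] by auto
    then show "?e i \<in> ?V"
      using P_mult_eq[OF i(1) f_in] P_mult_eq[OF i(1) g_in] by auto
  next
    fix v assume "v \<in> ?V"
    then have v: "v \<in> FF" "v \<in> P (2 * d - 2)" by auto
    obtain a b where ab: "a \<in> P (2 * d - 2 - d)" "b \<in> P (2 * d - 2 - d)" "v = a * f + b * g"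
      by (rule FF_P[OF v])
    have "2 * d - 2 - d = d - 2" by simp
    then have "a \<in> span B" "b \<in> span B" using ab B(4) by auto
    then obtain s t where st: "a = (\<Sum>b\<in>B. scale (s b) b)" "b = (\<Sum>b\<in>B. scale (t b) b)"
      unfolding span_finite[OF B(1)] by blast
    define c where "c = (\<lambda>x. if snd x then s (fst x) else t (fst x))"
    have "v - (\<Sum>x\<in>B \<times> UNIV. scale (c x) (?e x)) \<in> {0}"
      unfolding sum_e using ab(3) st by (simp add: c_def)
    then show "\<exists>c. v - (\<Sum>x\<in>B \<times> UNIV. scale (c x) (?e x)) \<in> {0}" by blast
  next
    fix c :: "'b \<times> bool \<Rightarrow> complex" and i :: "'b \<times> bool" assume z: "(\<Sum>x\<in>B \<times> UNIV. scale (c x) (?e x)) \<in> {0}" and i: "i \<in> B \<times> UNIV"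
    have "(\<Sum>b\<in>B. scale (c (b, True)) b) = 0 \<and> (\<Sum>b\<in>B. scale (c (b, False)) b) = 0"
    proof (rule syzygy_trivial[of _ "d - 2"])
      show "(\<Sum>b\<in>B. scale (c (b, True)) b) * f + (\<Sum>b\<in>B. scale (c (b, False)) b) * g = 0"
        using z sum_e[of c] by simp
    qed (use B(2) in \<open>auto intro!: P_sum P_scale\<close>)
    then have "\<forall>b\<in>B. c (b, True) = 0" "\<forall>b\<in>B. c (b, False) = 0"
      using B(3) dependent_finite[OF B(1)] by (simp_all) metis+
    then show "c i = 0" using i by (cases i; cases "snd i") auto
  qed
  moreover have "subspace ?V" using subspace_FF subspace_P by (rule subspace_inter)
  ultimately have "dim ?V = card (B \<times> (UNIV :: bool set))"
    using dim_basis_mod(2)[of "{0}" ?V "B \<times> UNIV" ?e] subspace_0[of ?V] dim_zero by simp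
  then show ?thesis using B(5) by (simp add: card_cartesian_product)
qed

section \<open>Reduction modulo \<open>f\<close> and \<open>g\<close>\<close>

text \<open>\<open>s\<close> is an inverse of \<open>lead d g\<close> modulo
  \<open>lead d f\<close>. Hence every \<open>u\<close> is a combination of the two in which the
  coefficient of \<open>lead d g\<close> is a remainder modulo \<open>lead d f\<close>.\<close>

lemma univariate_decomposition:
  obtains s where "\<And>u. lead d f dvd u - (u * s mod lead d f) * lead d g"
proof -
  obtain s t where st: "s * lead d g + t * lead d f = 1"
    using coprime_lead bezout_coefficients_fst_snd[of "lead d g" "lead d f"]
    by (metis coprime_commute coprime_iff_gcd_eq_1)
  have "lead d f dvd u - (u * s mod lead d f) * lead d g" for u
  proof -
    have "u - (u * s mod lead d f) * lead d g =
        u * (s * lead d g + t * lead d f) - (u * s - u * s div lead d f * lead d f) * lead d g"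
      by (simp add: st minus_div_mult_eq_mod)
    also have "\<dots> = lead d f * (u * t + u * s div lead d f * lead d g)"
      by (simp add: algebra_simps)
    finally show ?thesis by simp
  qed
  then show ?thesis by (rule that)
qed

text \<open>A degree bound on \<open>v\<close> alone suffices: the cofactor \<open>u\<close> of
  \<open>lead d f\<close> then satisfies the same bound because \<open>lead d f\<close> has degree
  exactly \<open>d\<close>. Both lift, and the lifted combination cancels the top part of
  \<open>a\<close>.\<close>

lemma lead_bounded_decomposition:
  assumes "a \<in> P k" "lead d f dvd lead k a - v * lead d g"
    and "v \<noteq> 0 \<Longrightarrow> int (degree v) \<le> k - d"
  shows "\<exists>x\<in>FF. a - x \<in> P (k - 1)"
proof -
  obtain u where u: "lead k a - v * lead d g = lead d f * u" using assms(2) by blast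
  have "int (degree u) \<le> k - d" if "u \<noteq> 0"
  proof -
    have nz: "lead d f * u \<noteq> 0" using that lead_f_nz by simp
    have d1: "int (degree (lead k a)) \<le> k" if "lead k a \<noteq> 0"
      using degree_lead assms(1) that by blast
    have d2: "int (degree (v * lead d g)) \<le> k" if "v * lead d g \<noteq> 0"
      using assms(3) degree_lead[OF g_in] that by (simp add: degree_mult_eq)
    have "int (degree (lead k a - v * lead d g)) \<le> k"
    proof (cases "lead k a = 0 \<or> v * lead d g = 0")
      case True
      then show ?thesis using d1 d2 nz u by (metis diff_zero degree_minus diff_0)
    next
      case False
      then show ?thesis using d1 d2 degree_diff_le_max[of "lead k a" "v * lead d g"] by simp
    qed
    then show ?thesis using u that lead_f_nz degree_lead_f by (simp add: degree_mult_eq)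
  qed
  then obtain a' where a': "a' \<in> P (k - d)" "lead (k - d) a' = u" using lead_surj by blast
  obtain b' where b': "b' \<in> P (k - d)" "lead (k - d) b' = v" using lead_surj assms(3) by blast
  have 1: "a' * f \<in> P k" "b' * g \<in> P k"
    using P_mult[OF a'(1) f_in] P_mult[OF b'(1) g_in] by simp_all
  have "lead k (a' * f + b' * g) = lead k a"
    using lead_add[OF 1] lead_mult[OF a'(1) f_in] lead_mult[OF b'(1) g_in] a' b' u
    by (simp add: algebra_simps)
  then have "a - (a' * f + b' * g) \<in> P (k - 1)"
    using lead_eq_0[of "a - (a' * f + b' * g)" k] assms(1) P_add[OF 1] P_diff lead_diff by simp
  moreover have "a' * f + b' * g \<in> FF" using a' b' P_subset_R by (intro FFI) auto
  ultimately show ?thesis by blast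
qed

text \<open>A remainder modulo \<open>lead d f\<close> has degree at most \<open>d - 1\<close>,
  which is within the bound \<open>k - d\<close> as soon as \<open>k \<ge> 2 * d - 1\<close>. The
  reduction therefore runs exactly down to \<open>2 * d - 2\<close>.\<close>

lemma reduce_mod_FF:
  assumes "a \<in> R"
  obtains x where "x \<in> FF" "a - x \<in> P (2 * d - 2)"
proof -
  obtain s where s: "\<And>u. lead d f dvd u - (u * s mod lead d f) * lead d g"
    using univariate_decomposition by blast
  obtain k where "a \<in> P k" using assms unfolding R_def by blast
  then have "\<exists>x\<in>FF. a - x \<in> P (2 * d - 2)"
  proof (induction "nat (k - (2 * d - 2))" arbitrary: a k)
    case 0
    then show ?case using P_mono[of k "2 * d - 2"] FF_0 by (intro bexI[of _ 0]) auto
  next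
    case (Suc n)
    let ?v = "lead k a * s mod lead d f"
    have deg: "int (degree ?v) \<le> k - d" if "?v \<noteq> 0"
      using degree_mod_less[of "lead d f" "lead k a * s"] lead_f_nz that degree_lead_f Suc.hyps(2) by auto
    then obtain x where x: "x \<in> FF" "a - x \<in> P (k - 1)"
      using lead_bounded_decomposition[OF Suc.prems s deg] by blast
    have "n = nat (k - 1 - (2 * d - 2))" using Suc.hyps(2) by simp
    then obtain y where "y \<in> FF" "a - x - y \<in> P (2 * d - 2)" using Suc.hyps(1)[OF _ x(2)] by blast
    then show ?case using FF_add[OF x(1)] by (intro bexI[of _ "x + y"]) (auto simp: diff_diff_eq)
  qed
  then show ?thesis using that by blast
qed

text \<open>The preimage in \<open>R\<close> of the image of \<open>P i\<close> in
  \<open>R / (f, g)\<close>; it replaces the induced filtration of the quotient.\<close>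

definition L :: "int \<Rightarrow> 'b set" where "L i = {p + x | p x. p \<in> P i \<and> x \<in> FF}"

lemma LI: "p \<in> P i \<Longrightarrow> x \<in> FF \<Longrightarrow> p + x \<in> L i"
  unfolding L_def by blast

lemma subspace_L: "subspace (L i)"
  unfolding L_def using subspace_sums[OF subspace_P subspace_FF] .

lemma FF_subset_L: "FF \<subseteq> L i"
  using LI[OF P_0] by force

lemmas L_add = subspace_add[OF subspace_L]
lemmas L_diff = subspace_diff[OF subspace_L]
lemmas L_scale = subspace_scale[OF subspace_L]

lemma top_mod_L:
  obtains w where "w \<in> P (2 * d - 2)" "\<And>a. a \<in> P (2 * d - 2) \<Longrightarrow> \<exists>c. a - scale c w \<in> L (2 * d - 3)"
proof -
  let ?k = "2 * d - 2"
  obtain s where s: "\<And>u. lead d f dvd u - (u * s mod lead d f) * lead d g"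
    using univariate_decomposition by blast
  \<comment> \<open>In degree \<open>2 * d - 2\<close> only remainders of degree at most
    \<open>d - 2\<close> can be lifted, one less than division guarantees. The coefficient at
    \<open>d - 1\<close> is thus the only obstruction, and the top piece is at most a line.\<close>
  define h where "h a = coeff (lead ?k a * s mod lead d f) (nat (d - 1))" for a
  have zero: "a \<in> L (2 * d - 3)" if a: "a \<in> P ?k" "h a = 0" for a
  proof -
    let ?v = "lead ?k a * s mod lead d f"
    have deg: "int (degree ?v) \<le> ?k - d" if "?v \<noteq> 0"
    proof -
      have "degree ?v < degree (lead d f)"
        using degree_mod_less[of "lead d f" "lead ?k a * s"] lead_f_nz that by auto
      moreover have "degree ?v \<noteq> nat (d - 1)"
        using a(2) that unfolding h_def by (metis leading_coeff_0_iff)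
      ultimately show ?thesis using degree_lead_f by linarith
    qed
    then obtain x where x: "x \<in> FF" "a - x \<in> P (?k - 1)"
      using lead_bounded_decomposition[OF a(1) s deg] by blast
    have "?k - 1 = 2 * d - 3" by simp
    then show ?thesis using LI[OF x(2,1)] by simp
  qed
  have h_diff: "h (a - scale c b) = h a - c * h b" if "a \<in> P ?k" "b \<in> P ?k" for a b c
    using that unfolding h_def
    by (simp add: lead_diff P_scale lead_scale left_diff_distrib poly_mod_diff_left mod_smult_left)
  show ?thesis
  proof (cases "\<exists>w\<in>P ?k. h w \<noteq> 0")
    \<comment> \<open>The choice \<open>w = 0\<close> is permitted at this stage; that the top piece
      is nonzero is shown in \<open>residue_functional\<close>.\<close>
    case False
    then show ?thesis using that[of 0] zero P_0 by auto
  next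
    case True
    then obtain w where w: "w \<in> P ?k" "h w \<noteq> 0" by blast
    have "a - scale (h a / h w) w \<in> L (2 * d - 3)" if "a \<in> P ?k" for a
      using that w by (intro zero) (auto simp: h_diff P_diff P_scale)
    then show ?thesis using that[OF w(1)] by blast
  qed
qed

section \<open>The socle of the quotient\<close>

text \<open>An element of \<open>P 0\<close> with leading polynomial 1 is idempotent, as the
  difference from its square lies in \<open>P (-1) = {0}\<close>. In a domain a nonzero idempotent
  is 1.\<close>

lemma one_in_P: "1 \<in> P 0"
proof -
  obtain u where u: "u \<in> P 0" "lead 0 u = 1" using lead_surj[of 1 0] by auto
  have "u * u \<in> P 0" using P_mult[OF u(1) u(1)] by simp
  moreover have "lead 0 (u * u - u) = 0"
    using lead_mult[OF u(1) u(1)] u lead_diff[of "u * u" 0 u] calculation by simp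
  ultimately have "u * u - u \<in> P (-1)" using lead_eq_0[of "u * u - u" 0] P_diff u(1) by simp
  then have "u * u = u" using P_neg by simp
  moreover have "u \<noteq> 0" using u lead_eq_0[of u 0] P_neg[of "-1"] by auto
  ultimately show ?thesis using u(1) by simp
qed

text \<open>\<open>x\<close> and \<open>y\<close> lift the two coordinates on the line. The loss of
  degree forces \<open>lead j a = [:0, 1:] * lead j a'\<close>; as the left side has degree at most
  \<open>j\<close>, the form of \<open>a'\<close> is divisible by the second coordinate, and
  \<open>e\<close> lifts the quotient.\<close>

lemma lift_common_factor:
  assumes "x \<in> P 1" "lead 1 x = [:0, 1:]" "y \<in> P 1" "lead 1 y = 1"
    and "a \<in> P j" "a' \<in> P j" "y * a - x * a' \<in> P j"
  obtains e where "e \<in> P (j - 1)" "a - x * e \<in> P (j - 1)"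
proof -
  have m: "y * a \<in> P (j + 1)" "x * a' \<in> P (j + 1)"
    using P_mult_eq[OF assms(3,5), of "j + 1"] P_mult_eq[OF assms(1,6), of "j + 1"] by auto
  have l: "lead (j + 1) (y * a) = lead j a" "lead (j + 1) (x * a') = [:0, 1:] * lead j a'"
    using lead_mult[OF assms(3,5)] lead_mult[OF assms(1,6)] assms(2,4) by (simp_all add: add.commute)
  have "lead (j + 1) (y * a - x * a') = 0"
    using assms(7) lead_eq_0[of "y * a - x * a'" "j + 1"] P_diff[OF m] by simp
  then have eq: "lead j a = [:0, 1:] * lead j a'"
    using lead_diff[OF m] l by simp
  have "int (degree (lead j a')) \<le> j - 1" if "lead j a' \<noteq> 0"
  proof -
    have nz: "lead j a \<noteq> 0" using that unfolding eq by simp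
    have "degree (lead j a) = 1 + degree (lead j a')" using that unfolding eq by (simp add: degree_mult_eq)
    then show ?thesis using degree_lead[OF assms(5) nz] by simp
  qed
  then obtain e where e: "e \<in> P (j - 1)" "lead (j - 1) e = lead j a'" using lead_surj by blast
  have xe: "x * e \<in> P j" "lead j (x * e) = lead j a"
    using P_mult[OF assms(1) e(1)] lead_mult[OF assms(1) e(1)] assms(2) e(2) eq by simp_all
  have "a - x * e \<in> P (j - 1)"
    using lead_eq_0[of "a - x * e" j] P_diff[OF assms(5) xe(1)] lead_diff[OF assms(5) xe(1)] xe(2) by simp
  then show ?thesis using that e(1) by blast
qed

text \<open>The leading forms define a quotient whose socle lives in degree \<open>2 * d - 2\<close>
  only: in a lower degree, nothing nonzero is killed by both coordinates. The proof expresses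
  \<open>y * (x * h) = x * (y * h)\<close> as a relation between the coefficients of
  \<open>f\<close> and \<open>g\<close>.\<close>

lemma socle:
  assumes x: "x \<in> P 1" "lead 1 x = [:0, 1:]" and y: "y \<in> P 1" "lead 1 y = 1"
    and h: "h \<in> P i" "i \<le> 2 * d - 3" "x * h \<in> L i" "y * h \<in> L i"
  shows "h \<in> L (i - 1)"
proof -
  obtain p u where pu: "x * h = p + u" "p \<in> P i" "u \<in> FF" using h(3) unfolding L_def by blast
  obtain p' u' where pu': "y * h = p' + u'" "p' \<in> P i" "u' \<in> FF" using h(4) unfolding L_def by blast
  have up: "p \<in> P (i + 1)" "p' \<in> P (i + 1)" using pu(2) pu'(2) P_mono[of i "i + 1"] by auto
  have "x * h \<in> P (i + 1)" "y * h \<in> P (i + 1)" using P_mult_eq[OF x(1) h(1), of "i + 1"] P_mult_eq[OF y(1) h(1), of "i + 1"] by auto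
  then have "x * h - p \<in> P (i + 1)" "y * h - p' \<in> P (i + 1)" using up P_diff by auto
  then have uP: "u \<in> P (i + 1)" "u' \<in> P (i + 1)" using pu(1) pu'(1) by simp_all
  define j where "j = i + 1 - d"
  obtain a b where ab: "a \<in> P j" "b \<in> P j" "u = a * f + b * g"
    using FF_P[OF pu(3) uP(1)] unfolding j_def by blast
  obtain a' b' where ab': "a' \<in> P j" "b' \<in> P j" "u' = a' * f + b' * g"
    using FF_P[OF pu'(3) uP(2)] unfolding j_def by blast
  \<comment> \<open>The terms in \<open>h\<close> cancel, so this combination has degree one less
    than its coefficients suggest, and \<open>syzygy\<close> applies.\<close>
  have "(y * a - x * a') * f + (y * b - x * b') * g = y * u - x * u'"
    unfolding ab(3) ab'(3) by (simp add: algebra_simps)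
  also have "\<dots> = y * (x * h - p) - x * (y * h - p')" using pu(1) pu'(1) by simp
  also have "\<dots> = x * p' - y * p" by (simp add: algebra_simps)
  also have "\<dots> \<in> P (i + 1)"
    using P_mult_eq[OF x(1) pu'(2), of "i + 1"] P_mult_eq[OF y(1) pu(2), of "i + 1"] by (intro P_diff) auto
  finally have 1: "(y * a - x * a') * f + (y * b - x * b') * g \<in> P (j + 1 + d - 1)"
    unfolding j_def by (simp add: add.commute)
  have 2: "y * a - x * a' \<in> P (j + 1)" "y * b - x * b' \<in> P (j + 1)"
    using P_mult_eq[OF x(1), of _ j "j + 1"] P_mult_eq[OF y(1), of _ j "j + 1"] ab ab' by (auto intro!: P_diff)
  obtain c where c: "c \<in> P (j + 1 - d)" "y * a - x * a' - c * g \<in> P (j + 1 - 1)"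
      "y * b - x * b' + c * f \<in> P (j + 1 - 1)"
    using syzygy[OF 2 1] by blast
  \<comment> \<open>The index of \<open>c\<close> is \<open>i + 2 - 2 * d\<close>, which is negative
    precisely by the bound on \<open>i\<close>.\<close>
  have "c = 0" using c(1) P_neg[of "j + 1 - d"] h(2) unfolding j_def by auto
  then have 3: "y * a - x * a' \<in> P j" "y * b - x * b' \<in> P j" using c by simp_all
  obtain e where e: "e \<in> P (j - 1)" "a - x * e \<in> P (j - 1)"
    using lift_common_factor[OF x y ab(1) ab'(1) 3(1)] by blast
  obtain e' where e': "e' \<in> P (j - 1)" "b - x * e' \<in> P (j - 1)"
    using lift_common_factor[OF x y ab(2) ab'(2) 3(2)] by blast
  \<comment> \<open>\<open>h'\<close> is congruent to \<open>h\<close> modulo the ideal, and the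
    choice of \<open>e\<close> and \<open>e'\<close> brings \<open>x * h'\<close> down to
    \<open>P i\<close>. As \<open>x\<close> has a nonzero leading polynomial, that of
    \<open>h'\<close> must vanish.\<close>
  define h' where "h' = h - (e * f + e' * g)"
  have ij: "i = j - 1 + d" unfolding j_def by simp
  have h'P: "h' \<in> P i"
    unfolding h'_def using P_mult_eq[OF e(1) f_in ij] P_mult_eq[OF e'(1) g_in ij] h(1)
    by (intro P_diff P_add)
  have "x * h' = p + ((a - x * e) * f + (b - x * e') * g)"
    using pu(1) ab(3) unfolding h'_def by (simp add: algebra_simps)
  also have "\<dots> \<in> P i"
    using P_mult_eq[OF e(2) f_in ij] P_mult_eq[OF e'(2) g_in ij] pu(2) by (intro P_add)
  finally have "x * h' \<in> P i" .
  then have "lead (1 + i) (x * h') = 0"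
    using lead_eq_0[of "x * h'" "1 + i"] P_mult[OF x(1) h'P] by simp
  then have "lead i h' = 0" using lead_mult[OF x(1) h'P] x(2) by simp
  then have "h' \<in> P (i - 1)" using lead_eq_0[OF h'P] by simp
  moreover have "e * f + e' * g \<in> FF" using e(1) e'(1) P_subset_R by (intro FFI) auto
  ultimately have "h' + (e * f + e' * g) \<in> L (i - 1)" by (rule LI)
  then show ?thesis unfolding h'_def by simp
qed

text \<open>The hypothesis passes from \<open>a\<close> to \<open>x * a\<close> and
  \<open>y * a\<close>. If all three lie in \<open>L i\<close>, \<open>socle\<close> pushes
  \<open>a\<close> one step down; the descent ends in \<open>L (-1)\<close>, which is the ideal
  itself.\<close>

lemma ideal_in_L:
  assumes "a \<in> R" "\<And>b. b \<in> R \<Longrightarrow> a * b \<in> L (2 * d - 3)"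
  shows "a \<in> FF"
proof -
  obtain x where x: "x \<in> P 1" "lead 1 x = [:0, 1:]" using lead_surj[of "[:0, 1:]" 1] by auto
  obtain y where y: "y \<in> P 1" "lead 1 y = 1" using lead_surj[of 1 1] by auto
  have xyR: "x \<in> R" "y \<in> R" using x y P_subset_R by auto
  have oneR: "1 \<in> R" using one_in_P P_subset_R by auto
  have "a \<in> L (2 * d - 3 - int n)" for n
    using assms
  proof (induction n arbitrary: a)
    case 0
    then show ?case using oneR by (metis mult.right_neutral diff_zero of_nat_0)
  next
    case (Suc n)
    let ?i = "2 * d - 3 - int n"
    have xa: "x * a \<in> L ?i" "y * a \<in> L ?i"
    proof -
      have "x * a * b \<in> L (2 * d - 3)" "y * a * b \<in> L (2 * d - 3)" if "b \<in> R" for b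
        using Suc.prems(2)[of "x * b"] Suc.prems(2)[of "y * b"] R_mult xyR that
        by (simp_all add: ac_simps)
      then show "x * a \<in> L ?i" "y * a \<in> L ?i"
        using Suc.IH R_mult xyR Suc.prems(1) by blast+
    qed
    obtain h z where hz: "a = h + z" "h \<in> P ?i" "z \<in> FF"
      using Suc.IH[OF Suc.prems] unfolding L_def by blast
    have "x * z \<in> L ?i" "y * z \<in> L ?i" using FF_mult xyR hz(3) FF_subset_L by blast+
    then have "x * a - x * z \<in> L ?i" "y * a - y * z \<in> L ?i" using xa L_diff by auto
    then have "x * h \<in> L ?i" "y * h \<in> L ?i" using hz(1) by (simp_all add: algebra_simps)
    then have "h \<in> L (?i - 1)" using socle[OF x y hz(2)] by simp
    then have "h + z \<in> L (?i - 1)" using hz(3) FF_subset_L L_add by blast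
    then show ?case using hz(1) by (simp add: diff_diff_eq add.commute)
  qed
  \<comment> \<open>After \<open>2 * d - 2\<close> steps the index \<open>2 * d - 3\<close> has
    become \<open>-1\<close>.\<close>
  from this[of "nat (2 * d - 2)"] have "a \<in> L (-1)" using d_pos by simp
  then show ?thesis unfolding L_def using P_neg[of "-1"] by auto
qed

section \<open>The residue pairing and linkage\<close>

text \<open>\<open>\<phi> a\<close> is the coefficient of the top element \<open>w\<close> in
  \<open>a\<close> modulo \<open>L (2 * d - 3)\<close>, an algebraic form of the residue. It exists
  by \<open>reduce_mod_FF\<close> and \<open>top_mod_L\<close>, and is unique once \<open>w\<close>
  is known to lie outside \<open>L (2 * d - 3)\<close>.\<close>

lemma residue_functional:
  obtains \<phi> where "\<And>a b. a \<in> R \<Longrightarrow> b \<in> R \<Longrightarrow> \<phi> (a + b) = \<phi> a + \<phi> b"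
    "\<And>c a. a \<in> R \<Longrightarrow> \<phi> (scale c a) = c * \<phi> a"
    "\<And>a. a \<in> R \<Longrightarrow> \<phi> a = (0 :: complex) \<longleftrightarrow> a \<in> L (2 * d - 3)"
proof -
  let ?K = "L (2 * d - 3)"
  obtain w where w: "w \<in> P (2 * d - 2)" "\<And>a. a \<in> P (2 * d - 2) \<Longrightarrow> \<exists>c. a - scale c w \<in> ?K"
    using top_mod_L by blast
  have ex: "\<exists>c. a - scale c w \<in> ?K" if a: "a \<in> R" for a
  proof -
    obtain x where x: "x \<in> FF" "a - x \<in> P (2 * d - 2)" using reduce_mod_FF a by blast
    obtain c where "a - x - scale c w \<in> ?K" using w(2) x(2) by blast
    then have "(a - x - scale c w) + x \<in> ?K" using x(1) FF_subset_L L_add by blast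
    then show ?thesis by (auto simp: algebra_simps)
  qed
  \<comment> \<open>Otherwise \<open>L (2 * d - 3)\<close> would be all of \<open>R\<close>, and
    \<open>ideal_in_L\<close> would put 1 into the ideal, which has no nonzero element of degree
    below \<open>d\<close>.\<close>
  have wK: "w \<notin> ?K"
  proof
    assume "w \<in> ?K"
    have "a \<in> ?K" if a: "a \<in> R" for a
    proof -
      obtain c where "a - scale c w \<in> ?K" using ex[OF a] by blast
      then have "(a - scale c w) + scale c w \<in> ?K" using \<open>w \<in> ?K\<close> by (intro L_add L_scale)
      then show ?thesis by simp
    qed
    then have "1 \<in> FF" using one_in_P P_subset_R R_mult by (intro ideal_in_L) auto
    then show False using FF_P_zero[OF _ one_in_P] d_pos by simp
  qed
  have uniq: "c = c'" if "a - scale c w \<in> ?K" "a - scale c' w \<in> ?K" for a c c'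
  proof (rule ccontr)
    assume "c \<noteq> c'"
    have "(a - scale c w) - (a - scale c' w) \<in> ?K" using that by (rule L_diff)
    then have "scale (c' - c) w \<in> ?K" by (simp add: scale_left_diff_distrib)
    then have "scale (inverse (c' - c)) (scale (c' - c) w) \<in> ?K" by (rule L_scale)
    then show False using \<open>c \<noteq> c'\<close> wK by simp
  qed
  define \<phi> where "\<phi> a = (THE c. a - scale c w \<in> ?K)" for a
  have \<phi>I: "\<phi> a = c" if "a - scale c w \<in> ?K" for a c
    unfolding \<phi>_def by (rule the_equality) (use that uniq in blast)+
  have \<phi>: "a - scale (\<phi> a) w \<in> ?K" if "a \<in> R" for a
    using ex[OF that] \<phi>I by metis
  show ?thesis
  proof (rule that[of \<phi>])
    fix a b assume "a \<in> R" "b \<in> R"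
    then have "(a - scale (\<phi> a) w) + (b - scale (\<phi> b) w) \<in> ?K" using \<phi> by (intro L_add)
    then show "\<phi> (a + b) = \<phi> a + \<phi> b" by (intro \<phi>I) (simp add: algebra_simps)
  next
    fix c a assume "a \<in> R"
    then have "scale c (a - scale (\<phi> a) w) \<in> ?K" using \<phi> by (intro L_scale)
    then show "\<phi> (scale c a) = c * \<phi> a" by (intro \<phi>I) (simp add: scale_right_diff_distrib)
  next
    fix a assume "a \<in> R"
    then show "\<phi> a = 0 \<longleftrightarrow> a \<in> ?K" using \<phi>[of a] \<phi>I[of a 0] by auto
  qed
qed

text \<open>The sum is direct, since the ideal has no nonzero element of degree
  \<open>d - 2\<close>.\<close>

lemma dim_sum_FF:
  assumes "subspace A" "A \<subseteq> P (d - 2)"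
  shows "dim {p + x | p x. p \<in> A \<and> x \<in> FF \<inter> P (2 * d - 2)} = dim A + dim (FF \<inter> P (2 * d - 2))"
    "finite_dim {p + x | p x. p \<in> A \<and> x \<in> FF \<inter> P (2 * d - 2)}"
proof -
  let ?N = "FF \<inter> P (2 * d - 2)" and ?V = "{p + x | p x. p \<in> A \<and> x \<in> FF \<inter> P (2 * d - 2)}"
  have N: "subspace ?N" using subspace_FF subspace_P by (rule subspace_inter)
  have V: "subspace ?V" using subspace_sums[OF assms(1) N] .
  obtain B where B: "finite B" "B \<subseteq> A" "\<not> dependent B" "span B = A" "card B = dim A"
    using finite_dim_basis[OF finite_dim_mono[OF assms(2) dim_P(1)] assms(1)] by blast
  have "basis_mod ?V ?N B (\<lambda>b. b)"
  proof (rule basis_modI)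
    show "b \<in> ?V" if "b \<in> B" for b
      using that B(2) subspace_0[OF N] by force
    show "\<exists>c. v - (\<Sum>b\<in>B. scale (c b) b) \<in> ?N" if v: "v \<in> ?V" for v
    proof -
      obtain p x where px: "v = p + x" "p \<in> A" "x \<in> ?N" using v by blast
      then obtain c where "p = (\<Sum>b\<in>B. scale (c b) b)"
        using B(4) unfolding span_finite[OF B(1)] by blast
      then have "v - (\<Sum>b\<in>B. scale (c b) b) \<in> ?N" using px by simp
      then show ?thesis by (rule exI[of _ c])
    qed
    show "c b = 0" if "(\<Sum>b\<in>B. scale (c b) b) \<in> ?N" "b \<in> B" for c b
    proof -
      have "(\<Sum>b\<in>B. scale (c b) b) \<in> P (d - 2)"
        using B(2) assms(2) by (intro P_sum P_scale) auto
      then have "(\<Sum>b\<in>B. scale (c b) b) = 0" using FF_P_zero that(1) by auto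
      then show ?thesis using B(1,3) that(2) dependent_finite by blast
    qed
  qed (use B in auto)
  moreover have NV: "?N \<subseteq> ?V" using subspace_0[OF assms(1)] by force
  moreover have fN: "finite_dim ?N" using finite_dim_mono[OF Int_lower2 dim_P(1)] .
  ultimately have "dim ?V = dim ?N + card B" "finite_dim ?V"
    using dim_basis_mod[OF N V NV _ fN] by blast+
  then show "dim ?V = dim A + dim ?N" "finite_dim ?V"
    by (simp_all only: B(5) add.commute)
qed

text \<open>\<open>P (2 * d - 2)\<close> maps onto \<open>R / (f, g)\<close>, hence onto
  \<open>R / I\<close>. Moving the representatives into it by \<open>reduce_mod_FF\<close> changes
  them only by elements of \<open>I\<close>.\<close>

lemma dim_restrict_codim:
  assumes "subspace I" "FF \<subseteq> I" "I \<subseteq> R" "basis_mod R I J e"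
  shows "dim (P (2 * d - 2)) = dim (I \<inter> P (2 * d - 2)) + card J"
proof -
  let ?E = "P (2 * d - 2)"
  have fin: "finite J" using assms(4) by (simp add: basis_mod_def)
  have "\<exists>a. e j - a \<in> FF \<and> a \<in> ?E" if j: "j \<in> J" for j
  proof -
    have "e j \<in> R" using assms(4) j by (auto simp: basis_mod_def)
    then obtain x where x: "x \<in> FF" "e j - x \<in> ?E" by (rule reduce_mod_FF)
    then have "e j - (e j - x) \<in> FF" by simp
    then show ?thesis using x(2) by blast
  qed
  then obtain e' where e': "\<And>j. j \<in> J \<Longrightarrow> e j - e' j \<in> FF" "\<And>j. j \<in> J \<Longrightarrow> e' j \<in> ?E"
    by metis
  have diff: "(\<Sum>j\<in>J. scale (c j) (e j)) - (\<Sum>j\<in>J. scale (c j) (e' j)) \<in> I" for c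
  proof -
    have "(\<Sum>j\<in>J. scale (c j) (e j - e' j)) \<in> FF"
      using e'(1) by (intro subspace_sum[OF subspace_FF] FF_scale)
    then show ?thesis using assms(2) by (auto simp: scale_right_diff_distrib sum_subtractf)
  qed
  have "basis_mod ?E (I \<inter> ?E) J e'"
  proof (rule basis_modI)
    show "\<exists>c. v - (\<Sum>j\<in>J. scale (c j) (e' j)) \<in> I \<inter> ?E" if v: "v \<in> ?E" for v
    proof -
      have "v \<in> R" using v P_subset_R by blast
      with assms(4) obtain c where c: "v - (\<Sum>j\<in>J. scale (c j) (e j)) \<in> I"
        by (rule basis_mod_expand)
      have "v - (\<Sum>j\<in>J. scale (c j) (e' j)) =
          (v - (\<Sum>j\<in>J. scale (c j) (e j))) + ((\<Sum>j\<in>J. scale (c j) (e j)) - (\<Sum>j\<in>J. scale (c j) (e' j)))"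
        by simp
      also have "\<dots> \<in> I" using c diff by (intro subspace_add[OF assms(1)])
      finally have "v - (\<Sum>j\<in>J. scale (c j) (e' j)) \<in> I" .
      moreover have "v - (\<Sum>j\<in>J. scale (c j) (e' j)) \<in> ?E"
        using v e'(2) by (intro P_diff P_sum P_scale)
      ultimately show ?thesis by (intro exI[of _ c]) blast
    qed
    show "c j = 0" if "(\<Sum>j\<in>J. scale (c j) (e' j)) \<in> I \<inter> ?E" "j \<in> J" for c j
    proof -
      have "((\<Sum>j\<in>J. scale (c j) (e j)) - (\<Sum>j\<in>J. scale (c j) (e' j))) + (\<Sum>j\<in>J. scale (c j) (e' j)) \<in> I"
        using that(1) diff by (intro subspace_add[OF assms(1)]) auto
      then have "(\<Sum>j\<in>J. scale (c j) (e j)) \<in> I" by simp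
      then show ?thesis using that(2) by (rule basis_mod_zero[OF assms(4)])
    qed
  qed (use fin e' in auto)
  then show ?thesis
    using dim_basis_mod(2)[OF subspace_inter[OF assms(1) subspace_P] subspace_P Int_lower2 _
        finite_dim_mono[OF Int_lower2 dim_P(1)]] by blast
qed

text \<open>With \<open>E = P (2 * d - 2)\<close>, \<open>N\<close> its part in the ideal and
  \<open>Q = P (d - 1)\<close>, the pairing of \<open>I \<inter> E\<close> with \<open>Q\<close> has
  the annihilators \<open>(I \<inter> P (d - 2)) + N\<close> and \<open>I' \<inter> Q\<close>. The
  length of \<open>Z\<close> makes \<open>dim (I \<inter> E) = dim Q + dim N\<close>, so
  \<open>dim_pairing\<close> leaves just the claimed equality.\<close>

theorem dim_residual:
  assumes I: "subspace I" "FF \<subseteq> I" "I \<subseteq> R" "\<And>a b. a \<in> R \<Longrightarrow> b \<in> I \<Longrightarrow> a * b \<in> I"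
      "basis_mod R I J e" "2 * int (card J) = (d - 1) * d"
    and I': "subspace I'" "FF \<subseteq> I'" "I' \<subseteq> R"
      "basis_mod R I' J' e'" "2 * int (card J') = d * (d + 1)"
    and colon: "\<And>a. a \<in> R \<Longrightarrow> (\<And>b. b \<in> I \<Longrightarrow> a * b \<in> FF) \<Longrightarrow> a \<in> I'"
  shows "dim (I \<inter> P (d - 2)) = dim (I' \<inter> P (d - 1))"
proof -
  obtain \<phi> where \<phi>: "\<And>a b. a \<in> R \<Longrightarrow> b \<in> R \<Longrightarrow> \<phi> (a + b) = \<phi> a + \<phi> b"
    "\<And>c a. a \<in> R \<Longrightarrow> \<phi> (scale c a) = c * \<phi> a"
    "\<And>a. a \<in> R \<Longrightarrow> \<phi> a = (0 :: complex) \<longleftrightarrow> a \<in> L (2 * d - 3)"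
    using residue_functional by blast
  define \<beta> where "\<beta> a b = \<phi> (a * b)" for a b
  define E where "E = P (2 * d - 2)"
  define N where "N = FF \<inter> E"
  have E: "subspace E" "finite_dim E" "E \<subseteq> R"
    unfolding E_def using subspace_P dim_P(1) P_subset_R by auto
  have fin: "finite_dim V" if "V \<subseteq> E" for V using finite_dim_mono[OF that E(2)] .
  have sub: "subspace (A \<inter> E)" if "subspace A" for A using subspace_inter[OF that E(1)] .
  have bl: "bilinear_on V W \<beta>" if "V \<subseteq> R" "W \<subseteq> R" for V W
    unfolding bilinear_on_def \<beta>_def
  proof (intro conjI ballI allI)
    show "\<phi> ((x + y) * z) = \<phi> (x * z) + \<phi> (y * z)" if "x \<in> V" "y \<in> V" "z \<in> W" for x y z
      using \<phi>(1)[of "x * z" "y * z"] R_mult that \<open>V \<subseteq> R\<close> \<open>W \<subseteq> R\<close> by (simp add: distrib_right subset_iff)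
    show "\<phi> (x * (y + z)) = \<phi> (x * y) + \<phi> (x * z)" if "x \<in> V" "y \<in> W" "z \<in> W" for x y z
      using \<phi>(1)[of "x * y" "x * z"] R_mult that \<open>V \<subseteq> R\<close> \<open>W \<subseteq> R\<close> by (simp add: distrib_left subset_iff)
    show "\<phi> (scale c x * y) = c * \<phi> (x * y)" "\<phi> (x * scale c y) = c * \<phi> (x * y)"
      if "x \<in> V" "y \<in> W" for c x y
      using \<phi>(2)[of "x * y" c] R_mult that \<open>V \<subseteq> R\<close> \<open>W \<subseteq> R\<close>
      by (simp_all add: scale_mult_left scale_mult_right subset_iff)
  qed
  have \<beta>_FF: "\<beta> a x = 0" if "a \<in> R" "x \<in> FF" for a x
    using \<phi>(3) FF_mult[OF that] FF_subset_L FF_subset_R unfolding \<beta>_def by blast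
  \<comment> \<open>Testing against \<open>A \<inter> E\<close> suffices: modulo \<open>FF\<close>,
    on which \<open>\<beta> a\<close> vanishes, every element of \<open>A\<close> has a
    representative there.\<close>
  have \<beta>_E: "\<forall>b\<in>A. \<beta> a b = 0" if a: "a \<in> R" and A: "subspace A" "FF \<subseteq> A" "A \<subseteq> R"
    and z: "\<forall>b\<in>A \<inter> E. \<beta> a b = 0" for a A
  proof
    fix b assume b: "b \<in> A"
    then have bR: "b \<in> R" using A(3) by blast
    obtain x where x: "x \<in> FF" "b - x \<in> E" using reduce_mod_FF[OF bR] unfolding E_def .
    have "b - x \<in> A" using b x(1) A subspace_diff by blast
    then have "\<beta> a (b - x) = 0" using z x(2) by blast
    moreover have "\<beta> a x = 0" using \<beta>_FF a x(1) by blast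
    moreover have "\<beta> a ((b - x) + x) = \<beta> a (b - x) + \<beta> a x"
      unfolding \<beta>_def distrib_left using a bR x(1) FF_subset_R
      by (intro \<phi>(1) R_mult R_diff) auto
    ultimately show "\<beta> a b = 0" by simp
  qed
  have \<beta>_0: "\<beta> 0 b = 0" for b
    using \<phi>(2)[OF R_0, of 0] unfolding \<beta>_def by simp
  have nondeg: "a \<in> FF" if "a \<in> R" "\<forall>b\<in>R. \<beta> a b = 0" for a
    using that \<phi>(3) R_mult unfolding \<beta>_def by (intro ideal_in_L) auto
  have \<beta>_comm: "\<beta> a b = \<beta> b a" for a b unfolding \<beta>_def by (simp add: mult.commute)
  have N: "subspace N" "N \<subseteq> E" "N \<subseteq> FF" unfolding N_def using sub subspace_FF by auto
  \<comment> \<open>\<open>N\<close> is the radical of the pairing on \<open>E\<close>, and it is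
    contained in every \<open>A\<close> that contains \<open>FF\<close>.\<close>
  have kernel_E: "{w \<in> A \<inter> E. \<forall>v\<in>E. \<beta> v w = 0} = N" if A: "FF \<subseteq> A" for A
  proof (intro equalityI subsetI)
    fix w assume "w \<in> {w \<in> A \<inter> E. \<forall>v\<in>E. \<beta> v w = 0}"
    then have w: "w \<in> E" "w \<in> R" "\<forall>v\<in>R \<inter> E. \<beta> w v = 0" using E(3) \<beta>_comm by auto
    have "\<forall>v\<in>R. \<beta> w v = 0"
      by (rule \<beta>_E[OF w(2) subspace_R FF_subset_R subset_refl w(3)])
    then show "w \<in> N" using nondeg[OF w(2)] w(1) unfolding N_def by blast
  next
    fix w assume "w \<in> N"
    then show "w \<in> {w \<in> A \<inter> E. \<forall>v\<in>E. \<beta> v w = 0}"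
      using \<beta>_FF A E(3) unfolding N_def by blast
  qed

  have dE: "int (dim E) = (2 * d - 1) * d"
    using dim_P(2)[of "2 * d - 2"] d_pos unfolding E_def by (simp add: algebra_simps)
  have dN: "int (dim N) = (d - 1) * d"
    using dim_FF_P dim_P(2)[of "d - 2"] d_pos unfolding N_def E_def by (simp add: algebra_simps)
  have dIE: "dim E = dim (I \<inter> E) + card J" and dI'E: "dim E = dim (I' \<inter> E) + card J'"
    using dim_restrict_codim I I' unfolding E_def by blast+

  \<comment> \<open>\<open>?M\<close> is the annihilator of \<open>I \<inter> E\<close>. One
    inclusion comes from the colon property, equality from counting dimensions with the two
    lengths.\<close>
  let ?M = "{a \<in> E. \<forall>b\<in>I \<inter> E. \<beta> a b = 0}"
  have "?M \<subseteq> I' \<inter> E"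
  proof
    fix a assume "a \<in> ?M"
    then have a: "a \<in> E" "a \<in> R" "\<forall>b\<in>I \<inter> E. \<beta> a b = 0" using E(3) by auto
    have z: "\<forall>b\<in>I. \<beta> a b = 0" using \<beta>_E[OF a(2) I(1,2,3) a(3)] .
    have "a * b \<in> FF" if b: "b \<in> I" for b
    proof (rule nondeg)
      \<comment> \<open>The factor \<open>c\<close> is moved across the pairing, and
        \<open>c * b\<close> stays in \<open>I\<close>.\<close>
      show "\<forall>c\<in>R. \<beta> (a * b) c = 0"
        using z I(4) b unfolding \<beta>_def by (metis mult.assoc mult.commute)
    qed (use b a I(3) R_mult in blast)
    then show "a \<in> I' \<inter> E" using colon a by blast
  qed
  moreover have "subspace ?M"
  proof (rule subspaceI)
    have b: "bilinear_on E (I \<inter> E) \<beta>" using bl E(3) by blast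
    show "0 \<in> ?M" using \<beta>_0 \<beta>_comm subspace_0[OF E(1)] by simp
    show "x + y \<in> ?M" if "x \<in> ?M" "y \<in> ?M" for x y
      using that b subspace_add[OF E(1)] unfolding bilinear_on_def by auto
    show "scale c x \<in> ?M" if "x \<in> ?M" for c x
      using that b subspace_scale[OF E(1)] unfolding bilinear_on_def by auto
  qed
  moreover have "dim ?M = dim (I' \<inter> E)"
  proof -
    have "dim E + dim N = dim (I \<inter> E) + dim ?M"
      using dim_pairing[OF E(1,2) sub[OF I(1)] fin[OF Int_lower2] bl[OF E(3) order_trans[OF Int_lower2 E(3)]]]
      unfolding kernel_E[OF I(2)] .
    then have "int (dim E) + int (dim N) = int (dim (I \<inter> E)) + int (dim ?M)" by linarith
    moreover have "int (dim E) = int (dim (I \<inter> E)) + int (card J)"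
      "int (dim E) = int (dim (I' \<inter> E)) + int (card J')" using dIE dI'E by linarith+
    ultimately show ?thesis using dE dN I(6) I'(5) by (simp add: algebra_simps)
  qed
  ultimately have M: "?M = I' \<inter> E"
    using dim_subspace_le(2)[OF _ sub[OF I'(1)] _ fin] by blast

  define Q where "Q = P (d - 1)"
  have Q: "subspace Q" "Q \<subseteq> E" "Q \<subseteq> R"
    unfolding Q_def E_def using subspace_P P_mono[of "d - 1" "2 * d - 2"] d_pos P_subset_R by auto
  \<comment> \<open>The degrees \<open>d - 1\<close> and \<open>d - 2\<close> add up to
    \<open>2 * d - 3\<close>, so \<open>\<phi>\<close> kills the products of \<open>Q\<close> and
    \<open>P (d - 2)\<close>. A dimension count shows that the annihilator \<open>?W\<close> of
    \<open>Q\<close> is not larger than \<open>V\<close>.\<close>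
  define V where "V = {p + x | p x. p \<in> P (d - 2) \<and> x \<in> N}"
  have V: "dim V = dim (P (d - 2)) + dim N" "finite_dim V"
    using dim_sum_FF[OF subspace_P subset_refl] unfolding V_def N_def E_def by auto
  have PE: "P (d - 2) \<subseteq> E" unfolding E_def using P_mono d_pos by auto
  have VE: "V \<subseteq> E" unfolding V_def using PE N(2) subspace_add[OF E(1)] by blast
  have V_sub: "subspace V" unfolding V_def using subspace_sums[OF subspace_P N(1)] .
  let ?W = "{w \<in> E. \<forall>v\<in>Q. \<beta> v w = 0}"
  have "V \<subseteq> ?W"
  proof
    fix w assume w: "w \<in> V"
    then obtain p x where px: "w = p + x" "p \<in> P (d - 2)" "x \<in> FF"
      using N(3) unfolding V_def by blast
    have "\<beta> v w = 0" if v: "v \<in> Q" for v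
    proof -
      have "v * p \<in> P (2 * d - 3)" using P_mult_eq[of v "d - 1" p "d - 2"] v px(2) unfolding Q_def by simp
      moreover have "v * x \<in> FF" using FF_mult v Q(3) px(3) by blast
      ultimately have "v * w \<in> L (2 * d - 3)" unfolding px(1) distrib_left by (rule LI)
      moreover have "v * w \<in> R" using v w Q(3) VE E(3) R_mult by blast
      ultimately show ?thesis using \<phi>(3)[of "v * w"] unfolding \<beta>_def by simp
    qed
    then show "w \<in> ?W" using w VE by blast
  qed
  moreover have "subspace ?W"
  proof (rule subspaceI)
    have b: "bilinear_on Q E \<beta>" using bl E(3) Q(3) by blast
    show "0 \<in> ?W" using \<beta>_0 \<beta>_comm subspace_0[OF E(1)] by simp
    show "x + y \<in> ?W" if "x \<in> ?W" "y \<in> ?W" for x y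
      using that b subspace_add[OF E(1)] unfolding bilinear_on_def by auto
    show "scale c x \<in> ?W" if "x \<in> ?W" for c x
      using that b subspace_scale[OF E(1)] unfolding bilinear_on_def by auto
  qed
  moreover have "dim V = dim ?W"
  proof -
    have "{v \<in> Q. \<forall>w\<in>E. \<beta> v w = 0} = {0}"
    proof (intro equalityI subsetI)
      fix v assume v: "v \<in> {v \<in> Q. \<forall>w\<in>E. \<beta> v w = 0}"
      then have "v \<in> N" using kernel_E[OF FF_subset_R] Q(2,3) \<beta>_comm by auto
      then have "v \<in> FF" using N(3) by blast
      then show "v \<in> {0}" using FF_P_zero[of v "d - 1"] v unfolding Q_def by simp
    next
      fix v :: 'b assume "v \<in> {0}"
      then show "v \<in> {v \<in> Q. \<forall>w\<in>E. \<beta> v w = 0}"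
        using subspace_0[OF Q(1)] \<beta>_FF[OF _ FF_0] \<beta>_comm E(3) by auto
    qed
    then have "dim Q + dim ?W = dim E"
      using dim_pairing[OF Q(1) fin[OF Q(2)] E(1,2) bl[OF Q(3) E(3)]] dim_zero by simp
    then have "int (dim Q) + int (dim ?W) = int (dim E)" by linarith
    moreover have "2 * int (dim Q) = d * (d + 1)" "2 * int (dim (P (d - 2))) = (d - 1) * d"
      using dim_P(2)[of "d - 1"] dim_P(2)[of "d - 2"] d_pos unfolding Q_def by auto
    ultimately show ?thesis using dE dN V(1) by (simp add: algebra_simps)
  qed
  ultimately have W: "V = ?W"
    using dim_subspace_le(2)[OF V_sub _ _ fin, of ?W] by blast

  have "dim Q + dim {w \<in> I \<inter> E. \<forall>v\<in>Q. \<beta> v w = 0} = dim (I \<inter> E) + dim {v \<in> Q. \<forall>w\<in>I \<inter> E. \<beta> v w = 0}"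
    using Q E(3) by (intro dim_pairing sub I(1) fin bl) auto
  moreover have "{v \<in> Q. \<forall>w\<in>I \<inter> E. \<beta> v w = 0} = I' \<inter> Q" using M Q(2) by blast
  \<comment> \<open>As \<open>N\<close> is contained in \<open>I\<close>, intersecting
    \<open>P (d - 2) + N\<close> with \<open>I\<close> only affects the first summand.\<close>
  moreover have "{w \<in> I \<inter> E. \<forall>v\<in>Q. \<beta> v w = 0} = {p + x | p x. p \<in> I \<inter> P (d - 2) \<and> x \<in> N}"
  proof -
    have "{w \<in> I \<inter> E. \<forall>v\<in>Q. \<beta> v w = 0} = I \<inter> V" using W by blast
    also have "\<dots> = {p + x | p x. p \<in> I \<inter> P (d - 2) \<and> x \<in> N}"
    proof (intro equalityI subsetI)
      fix w assume "w \<in> I \<inter> V"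
      then obtain p x where px: "w = p + x" "p \<in> P (d - 2)" "x \<in> N" "w \<in> I" unfolding V_def by blast
      then have "w - x \<in> I" using N(3) I(1,2) subspace_diff by blast
      then have "p \<in> I" using px(1) by simp
      then show "w \<in> {p + x | p x. p \<in> I \<inter> P (d - 2) \<and> x \<in> N}" using px by blast
    next
      fix w assume "w \<in> {p + x | p x. p \<in> I \<inter> P (d - 2) \<and> x \<in> N}"
      then obtain p x where px: "w = p + x" "p \<in> P (d - 2)" "x \<in> N" "p \<in> I" by blast
      then have "w \<in> I" using N(3) I(1,2) subspace_add by blast
      then show "w \<in> I \<inter> V" using px unfolding V_def by blast
    qed
    finally show ?thesis .
  qed
  ultimately have "dim Q + (dim (I \<inter> P (d - 2)) + dim N) = dim (I \<inter> E) + dim (I' \<inter> Q)"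
    using dim_sum_FF(1)[OF subspace_inter[OF I(1) subspace_P] Int_lower2]
    unfolding N_def E_def by simp
  then have "int (dim Q) + int (dim (I \<inter> P (d - 2))) + int (dim N) = int (dim (I \<inter> E)) + int (dim (I' \<inter> Q))"
    by linarith
  moreover have "int (dim E) = int (dim (I \<inter> E)) + int (card J)" using dIE by linarith
  moreover have "2 * int (dim Q) = d * (d + 1)"
    using dim_P(2)[of "d - 1"] d_pos unfolding Q_def by auto
  ultimately have "int (dim (I \<inter> P (d - 2))) = int (dim (I' \<inter> Q))"
    using dE dN I(6) by (simp add: algebra_simps)
  then show ?thesis unfolding Q_def by simp
qed

end

section \<open>Forms and substitution\<close>

lemma cpoly_sum_monomials:
  "F = (\<Sum>m\<in>Poly_Mapping.keys F. Poly_Mapping.single m (Poly_Mapping.lookup F m))"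
proof (rule poly_mapping_eqI)
  fix k
  show "Poly_Mapping.lookup F k =
      Poly_Mapping.lookup (\<Sum>m\<in>Poly_Mapping.keys F. Poly_Mapping.single m (Poly_Mapping.lookup F m)) k"
    by (cases "k \<in> Poly_Mapping.keys F")
      (auto simp: lookup_sum lookup_single when_def in_keys_iff sum.delta' cong: if_cong)
qed

lemma cpoly_induct [case_names zero single add]:
  assumes "Q 0" "\<And>m c. m \<in> Poly_Mapping.keys F \<Longrightarrow> Q (Poly_Mapping.single m c)"
    and "\<And>G H. Q G \<Longrightarrow> Q H \<Longrightarrow> Q (G + H)"
  shows "Q (F :: cpoly)"
proof -
  have "Q (\<Sum>m\<in>A. Poly_Mapping.single m (Poly_Mapping.lookup F m))"
    if "finite A" "A \<subseteq> Poly_Mapping.keys F" for A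
    using that by (induction A rule: finite_induct) (auto intro: assms)
  then show ?thesis using cpoly_sum_monomials[of F] by (metis finite_keys subset_refl)
qed

definition mdeg :: "(3 \<Rightarrow>\<^sub>0 nat) \<Rightarrow> nat" where
  "mdeg m = (\<Sum>i\<in>UNIV. Poly_Mapping.lookup m i)"

lemma mdeg_add [simp]: "mdeg (m + m') = mdeg m + mdeg m'"
  by (simp add: mdeg_def lookup_add sum.distrib)

lemma mdeg_0 [simp]: "mdeg 0 = 0"
  by (simp add: mdeg_def)

lemma mdeg_single [simp]: "mdeg (Poly_Mapping.single i n) = n"
  by (simp add: mdeg_def lookup_single when_def)

lemma form_iff: "form d F \<longleftrightarrow> (\<forall>m\<in>Poly_Mapping.keys F. mdeg m = d)"
  by (simp add: form_def mdeg_def)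

lemma form_0 [simp]: "form d 0"
  by (simp add: form_iff)

lemma form_single: "mdeg m = d \<Longrightarrow> form d (Poly_Mapping.single m c)"
  by (simp add: form_iff)

lemma form_add: "form d F \<Longrightarrow> form d G \<Longrightarrow> form d (F + G)"
  using keys_add[of F G] unfolding form_iff by blast

lemma form_mult: "form d F \<Longrightarrow> form e G \<Longrightarrow> form (d + e) (F * G)"
  using keys_mult[of F G] unfolding form_iff by fastforce

lemma form_const [simp]: "form 0 (const_poly c)"
  unfolding const_poly_def by (rule form_single) simp

lemma form_1 [simp]: "form 0 1"
  using form_const[of 1] by (simp add: const_poly_def)

lemma form_scale: "form d F \<Longrightarrow> form d (const_poly c * F)"
  using form_mult[OF form_const] by fastforce

lemma form_uminus: "form d F \<Longrightarrow> form d (- F)"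
  by (simp add: form_iff)

lemma form_diff: "form d F \<Longrightarrow> form d G \<Longrightarrow> form d (F - G)"
  using form_add[OF _ form_uminus] by fastforce

lemma form_sum: "(\<And>i. i \<in> I \<Longrightarrow> form d (F i)) \<Longrightarrow> form d (sum F I)"
  by (induction I rule: infinite_finite_induct) (auto intro: form_add)

lemma form_power: "form d F \<Longrightarrow> form (n * d) (F ^ n)"
  by (induction n) (auto intro: form_mult)

lemma form_induct [consumes 1, case_names zero single add]:
  assumes "form d F" "Q 0" "\<And>m c. mdeg m = d \<Longrightarrow> Q (Poly_Mapping.single m c)"
    and "\<And>G H. Q G \<Longrightarrow> Q H \<Longrightarrow> Q (G + H)"
  shows "Q F"
  using assms(1) by (intro cpoly_induct[of Q F] assms) (auto simp: form_iff)

lemma const_poly_simps [simp]: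
  "const_poly 0 = 0" "const_poly 1 = 1"
  "const_poly (a + b) = const_poly a + const_poly b"
  "const_poly (a * b) = const_poly a * const_poly b"
  "const_poly (- a) = - const_poly a"
  by (simp_all add: const_poly_def single_add mult_single single_uminus)

lemma prod_UNIV_3: "prod f (UNIV :: 3 set) = f 1 * f 2 * f 3"
  unfolding UNIV_3 by (simp add: ac_simps)

text \<open>A single homomorphism covers three uses: constants as values give evaluation at a point,
  other choices give the restriction to the line \<open>l = 0\<close> and to the lines through
  \<open>[1:0:0]\<close>.\<close>

definition poly_subst :: "(3 \<Rightarrow> complex poly) \<Rightarrow> cpoly \<Rightarrow> complex poly" where
  "poly_subst t F = (\<Sum>m\<in>Poly_Mapping.keys F.
     smult (Poly_Mapping.lookup F m) (\<Prod>i\<in>UNIV. t i ^ Poly_Mapping.lookup m i))"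

lemma poly_subst_superset:
  assumes "finite S" "Poly_Mapping.keys F \<subseteq> S"
  shows "poly_subst t F = (\<Sum>m\<in>S. smult (Poly_Mapping.lookup F m) (\<Prod>i\<in>UNIV. t i ^ Poly_Mapping.lookup m i))"
  unfolding poly_subst_def using assms by (intro sum.mono_neutral_left) (auto simp: in_keys_iff)

lemma poly_subst_0 [simp]: "poly_subst t 0 = 0"
  by (simp add: poly_subst_def)

lemma poly_subst_single:
  "poly_subst t (Poly_Mapping.single m c) = smult c (\<Prod>i\<in>UNIV. t i ^ Poly_Mapping.lookup m i)"
  by (subst poly_subst_superset[of "{m}"]) auto

lemma poly_subst_add [simp]: "poly_subst t (F + G) = poly_subst t F + poly_subst t G"
proof -
  let ?S = "Poly_Mapping.keys F \<union> Poly_Mapping.keys G"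
  have "Poly_Mapping.keys (F + G) \<subseteq> ?S" by (rule keys_add)
  then show ?thesis
    using poly_subst_superset[of ?S "F + G" t] poly_subst_superset[of ?S F t] poly_subst_superset[of ?S G t]
    by (simp add: lookup_add smult_add_left sum.distrib)
qed

lemma poly_subst_mult [simp]: "poly_subst t (F * G) = poly_subst t F * poly_subst t G"
proof (induction F rule: cpoly_induct)
  case (single m c)
  show ?case
  proof (induction G rule: cpoly_induct)
    case (single m' c')
    then show ?case
      by (simp add: mult_single poly_subst_single lookup_add power_add prod.distrib mult.commute)
  qed (simp_all add: distrib_left)
qed (simp_all add: distrib_right)

lemma poly_subst_const [simp]: "poly_subst t (const_poly c) = [:c:]"
  by (simp add: const_poly_def poly_subst_single)

lemma poly_subst_1 [simp]: "poly_subst t 1 = 1"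
  using poly_subst_const[of t 1] by (simp add: one_pCons)

lemma poly_subst_uminus [simp]: "poly_subst t (- F) = - poly_subst t F"
  using poly_subst_add[of t F "- F"] by (metis add.right_inverse neg_eq_iff_add_eq_0 poly_subst_0 minus_unique)

lemma poly_subst_diff [simp]: "poly_subst t (F - G) = poly_subst t F - poly_subst t G"
  using poly_subst_add[of t F "- G"] by simp

lemma poly_subst_power [simp]: "poly_subst t (F ^ n) = poly_subst t F ^ n"
  by (induction n) auto

lemma poly_subst_sum: "poly_subst t (sum F I) = (\<Sum>i\<in>I. poly_subst t (F i))"
  by (induction I rule: infinite_finite_induct) auto

lemma poly_poly_subst: "poly (poly_subst t F) s = eval_poly F (\<chi> i. poly (t i) s)"
  by (simp add: poly_subst_def eval_poly_def poly_sum poly_prod)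

lemma eval_poly_eq: "eval_poly F v = poly (poly_subst (\<lambda>i. [:v $ i:]) F) 0"
  by (simp add: poly_poly_subst vec_lambda_eta)

lemma eval_poly_simps [simp]:
  "eval_poly 0 v = 0" "eval_poly 1 v = 1" "eval_poly (const_poly c) v = c"
  "eval_poly (F + G) v = eval_poly F v + eval_poly G v"
  "eval_poly (F - G) v = eval_poly F v - eval_poly G v"
  "eval_poly (- F) v = - eval_poly F v"
  "eval_poly (F * G) v = eval_poly F v * eval_poly G v"
  "eval_poly (F ^ n) v = eval_poly F v ^ n"
  by (simp_all add: eval_poly_eq)

lemma eval_poly_single:
  "eval_poly (Poly_Mapping.single m c) v = c * (\<Prod>i\<in>UNIV. (v $ i) ^ Poly_Mapping.lookup m i)"
  by (simp add: eval_poly_eq poly_subst_single poly_prod)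

lemma eval_poly_scale:
  assumes "form d F"
  shows "eval_poly F (c *s v) = c ^ d * eval_poly F v"
  using assms
  by (induction F rule: form_induct)
    (simp_all add: eval_poly_single power_mult_distrib prod.distrib distrib_left mdeg_def
      flip: power_sum)

definition X :: "3 \<Rightarrow> cpoly" where
  "X i = Poly_Mapping.single (Poly_Mapping.single i 1) 1"

lemma form_X [simp]: "form 1 (X i)"
  unfolding X_def by (rule form_single) simp

lemma X_power: "X i ^ n = Poly_Mapping.single (Poly_Mapping.single i n) 1"
  by (induction n) (simp_all add: X_def mult_single flip: single_add)

lemma poly_subst_X [simp]: "poly_subst t (X i) = t i"
proof -
  have "(\<Prod>j\<in>UNIV. t j ^ Poly_Mapping.lookup (Poly_Mapping.single i 1) j) = (\<Prod>j\<in>UNIV. if j = i then t i else 1)"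
    by (intro prod.cong) (auto simp: lookup_single when_def)
  then show ?thesis by (simp add: X_def poly_subst_single)
qed

lemma eval_poly_X [simp]: "eval_poly (X i) v = v $ i"
  by (simp add: eval_poly_eq)

lemma monomial_eq:
  "Poly_Mapping.single m c = const_poly c * (X 1 ^ Poly_Mapping.lookup m 1 *
     X 2 ^ Poly_Mapping.lookup m 2 * X 3 ^ Poly_Mapping.lookup m 3)"
proof -
  have "m = Poly_Mapping.single 1 (Poly_Mapping.lookup m 1) + Poly_Mapping.single 2 (Poly_Mapping.lookup m 2) +
      Poly_Mapping.single 3 (Poly_Mapping.lookup m 3)"
  proof (rule poly_mapping_eqI)
    fix i :: 3
    show "Poly_Mapping.lookup m i = Poly_Mapping.lookup (Poly_Mapping.single 1 (Poly_Mapping.lookup m 1) +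
        Poly_Mapping.single 2 (Poly_Mapping.lookup m 2) + Poly_Mapping.single 3 (Poly_Mapping.lookup m 3)) i"
      using exhaust_3[of i] by (auto simp: lookup_add lookup_single when_def)
  qed
  then show ?thesis by (simp add: X_power const_poly_def mult_single)
qed

lemma mdeg_3: "mdeg m = Poly_Mapping.lookup m 1 + Poly_Mapping.lookup m 2 + Poly_Mapping.lookup m 3"
  by (simp add: mdeg_def sum_3)

lemma form_monomial: "form (a + b + c) (X 1 ^ a * X 2 ^ b * X 3 ^ c)"
proof -
  have "form n (X i ^ n)" for i n using form_power[OF form_X, of n i] by simp
  then show ?thesis by (intro form_mult)
qed

lemma form_monomial_induct [consumes 1, case_names zero monomial scale add]:
  assumes "form d F" "Q 0" "\<And>a b c. a + b + c = d \<Longrightarrow> Q (X 1 ^ a * X 2 ^ b * X 3 ^ c)"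
    and "\<And>c G. Q G \<Longrightarrow> Q (const_poly c * G)" and "\<And>G H. Q G \<Longrightarrow> Q H \<Longrightarrow> Q (G + H)"
  shows "Q F"
  using assms(1)
proof (induction F rule: form_induct)
  case (single m c)
  then show ?case unfolding monomial_eq[of m c] by (intro assms(3,4)) (simp add: mdeg_3)
qed (use assms in auto)

text \<open>Kronecker substitution: it sends distinct monomials of bounded degree to distinct powers.\<close>

lemma eval_poly_Kronecker:
  assumes "form d F" "F \<noteq> 0"
  obtains s where "s \<noteq> 0" "eval_poly F (\<chi> i. if i = 1 then s else if i = 2 then s ^ (d + 1) else s ^ ((d + 1) * (d + 1))) \<noteq> 0"
proof -
  define t :: "3 \<Rightarrow> complex poly" where
    "t = (\<lambda>i. if i = 1 then monom 1 1 else if i = 2 then monom 1 (d + 1) else monom 1 ((d + 1) * (d + 1)))"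
  \<comment> \<open>The exponents are at most \<open>d\<close>, hence the digits of
    \<open>w m\<close> in base \<open>d + 1\<close>.\<close>
  define w where "w m = Poly_Mapping.lookup m 1 + (d + 1) * (Poly_Mapping.lookup m 2 + (d + 1) * Poly_Mapping.lookup m 3)"
    for m :: "3 \<Rightarrow>\<^sub>0 nat"
  have t_prod: "(\<Prod>i\<in>UNIV. t i ^ Poly_Mapping.lookup m i) = monom 1 (w m)" for m
  proof -
    have t: "t 1 = monom 1 1" "t 2 = monom 1 (d + 1)" "t 3 = monom 1 ((d + 1) * (d + 1))"
      by (simp_all add: t_def)
    show ?thesis
      unfolding prod_UNIV_3 t monom_power mult_monom w_def
      by (simp only: power_one mult_1, rule arg_cong[of _ _ "monom 1"]) (simp add: algebra_simps)
  qed
  have lt: "Poly_Mapping.lookup m i < d + 1" if "m \<in> Poly_Mapping.keys F" for m i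
  proof -
    have "Poly_Mapping.lookup m i \<le> mdeg m" unfolding mdeg_def by (rule member_le_sum) auto
    then show ?thesis using assms(1) that unfolding form_iff by auto
  qed
  have inj: "m = m'" if m: "m \<in> Poly_Mapping.keys F" "m' \<in> Poly_Mapping.keys F" and eq: "w m = w m'" for m m'
  proof -
    have base: "a = a' \<and> q = q'" if "a < n" "a' < n" "a + n * q = a' + n * q'" for a a' q q' n :: nat
    proof -
      have "(a + n * q) mod n = a" "(a + n * q) div n = q" "(a' + n * q') mod n = a'" "(a' + n * q') div n = q'"
        using that(1,2) by simp_all
      then show ?thesis using that(3) by simp
    qed
    have 1: "Poly_Mapping.lookup m 1 = Poly_Mapping.lookup m' 1 \<and>
        Poly_Mapping.lookup m 2 + (d + 1) * Poly_Mapping.lookup m 3 =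
        Poly_Mapping.lookup m' 2 + (d + 1) * Poly_Mapping.lookup m' 3"
      using eq lt m unfolding w_def by (intro base[of _ "d + 1"]) auto
    then have 2: "Poly_Mapping.lookup m 2 = Poly_Mapping.lookup m' 2 \<and> Poly_Mapping.lookup m 3 = Poly_Mapping.lookup m' 3"
      using lt m by (intro base[of _ "d + 1"]) auto
    show ?thesis
    proof (rule poly_mapping_eqI)
      show "Poly_Mapping.lookup m i = Poly_Mapping.lookup m' i" for i
        using exhaust_3[of i] 1 2 by auto
    qed
  qed
  obtain m where m: "m \<in> Poly_Mapping.keys F" using assms(2) by (metis keys_eq_empty ex_in_conv)
  have "coeff (poly_subst t F) (w m) = (\<Sum>m'\<in>Poly_Mapping.keys F. if m' = m then Poly_Mapping.lookup F m' else 0)"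
    unfolding poly_subst_def t_prod coeff_sum
    by (intro sum.cong) (use inj m in auto)
  also have "\<dots> = Poly_Mapping.lookup F m" using m by simp
  finally have "poly_subst t F \<noteq> 0" using m by (auto simp: in_keys_iff)
  \<comment> \<open>The extra factor excludes the root \<open>s = 0\<close>.\<close>
  then have "monom 1 1 * poly_subst t F \<noteq> 0" by simp
  then obtain s where s: "poly (monom 1 1 * poly_subst t F) s \<noteq> 0"
    using poly_all_0_iff_0 by blast
  then have "s \<noteq> 0" "poly (poly_subst t F) s \<noteq> 0" by (auto simp: poly_monom)
  moreover have "(\<chi> i. poly (t i) s) = (\<chi> i. if i = 1 then s else if i = 2 then s ^ (d + 1) else s ^ ((d + 1) * (d + 1)))"
    by (simp add: t_def vec_eq_iff poly_monom)
  ultimately show ?thesis using that[of s] by (simp add: poly_poly_subst)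
qed

section \<open>Restriction to a line\<close>

lemma Fract_add_same: "b \<noteq> 0 \<Longrightarrow> Fract a b + Fract c b = Fract (a + c) (b :: 'a :: idom)"
  by (simp add: eq_fract algebra_simps)

lemma scale_fract_Fract: "scale_fract c (Fract a b) = Fract (const_poly c * a) b"
  by (simp add: scale_fract_def)

interpretation fract_ls: linear_space scale_fract ..

locale affine_chart =
  fixes \<alpha> \<beta> :: complex
begin

text \<open>The line avoids \<open>[0:0:1]\<close>, so the first two coordinates parametrize it and
  \<open>X 3\<close> can be eliminated on it.\<close>

definition l :: cpoly where "l = X 3 - const_poly \<alpha> * X 1 - const_poly \<beta> * X 2"

text \<open>The parameter \<open>t\<close> stands for the point
  \<open>[t:1:\<alpha> * t + \<beta>]\<close>. The one missing point \<open>[1:0:\<alpha>]\<close>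
  shows up only in the coefficient of top degree.\<close>

definition res :: "cpoly \<Rightarrow> complex poly" where
  "res = poly_subst (\<lambda>i. if i = 1 then [:0, 1:] else if i = 2 then 1 else [:\<beta>, \<alpha>:])"

definition homogenize :: "nat \<Rightarrow> complex poly \<Rightarrow> cpoly" where
  "homogenize k u = (\<Sum>i\<le>k. const_poly (coeff u i) * (X 1 ^ i * X 2 ^ (k - i)))"

lemma form_l: "form 1 l"
  unfolding l_def by (intro form_diff form_scale form_X)

lemma form_l_power: "form k (l ^ k)"
  using form_power[OF form_l, of k] by simp

lemma eval_l: "eval_poly l v = v $ 3 - \<alpha> * v $ 1 - \<beta> * v $ 2"
  by (simp add: l_def)

lemma l_nz [simp]: "l \<noteq> 0"
proof
  assume "l = 0"
  then have "eval_poly l (axis 3 1) = 0" by simp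
  then show False by (simp add: eval_l axis_def)
qed

lemma res_simps [simp]:
  "res 0 = 0" "res 1 = 1" "res (const_poly c) = [:c:]" "res (F + G) = res F + res G"
  "res (F - G) = res F - res G" "res (F * G) = res F * res G" "res (F ^ n) = res F ^ n"
  "res (X 1) = [:0, 1:]" "res (X 2) = 1" "res (X 3) = [:\<beta>, \<alpha>:]" "res l = 0"
  by (simp_all add: res_def l_def)

lemma res_sum: "res (sum F I) = (\<Sum>i\<in>I. res (F i))"
  by (simp add: res_def poly_subst_sum)

lemma form_homogenize: "form k (homogenize k u)"
proof -
  have "form k (X 1 ^ i * X 2 ^ (k - i))" if "i \<le> k" for i
    using form_monomial[of i "k - i" 0] that by simp
  then show ?thesis unfolding homogenize_def by (intro form_sum form_scale) auto
qed

lemma res_homogenize: "degree u \<le> k \<Longrightarrow> res (homogenize k u) = u"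
proof -
  assume "degree u \<le> k"
  have "res (homogenize k u) = (\<Sum>i\<le>k. monom (coeff u i) i)"
    unfolding homogenize_def by (simp add: res_sum monom_altdef)
  then show ?thesis using \<open>degree u \<le> k\<close> by (simp add: poly_as_sum_of_monoms')
qed

lemma homogenize_add: "homogenize k (u + v) = homogenize k u + homogenize k v"
  by (simp add: homogenize_def distrib_right sum.distrib)

lemma homogenize_smult: "homogenize k (smult c u) = const_poly c * homogenize k u"
  by (simp add: homogenize_def sum_distrib_left mult.assoc)

lemma homogenize_monom: "a \<le> k \<Longrightarrow> homogenize k (monom 1 a) = X 1 ^ a * X 2 ^ (k - a)"
proof -
  assume "a \<le> k"
  have "homogenize k (monom 1 a) = (\<Sum>i\<le>k. if i = a then X 1 ^ i * X 2 ^ (k - i) else 0)"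
    unfolding homogenize_def by (intro sum.cong) auto
  then show ?thesis using \<open>a \<le> k\<close> by simp
qed

text \<open>Induction on the exponent of \<open>X 3\<close>, replacing one factor by
  \<open>l + \<alpha> * X 1 + \<beta> * X 2\<close>. For \<open>k = 0\<close> the truncated
  \<open>k - 1\<close> is again 0, so the vanishing of \<open>F'\<close> has to be recorded
  separately.\<close>

lemma restriction_split_monomial:
  "a + b + c = k \<Longrightarrow> \<exists>F'. X 1 ^ a * X 2 ^ b * X 3 ^ c = homogenize k (res (X 1 ^ a * X 2 ^ b * X 3 ^ c)) + l * F' \<and>
     form (k - 1) F' \<and> (k = 0 \<longrightarrow> F' = 0)"
proof (induction c arbitrary: a b)
  case 0
  have "res (X 1 ^ a * X 2 ^ b * X 3 ^ 0) = monom 1 a" by (simp add: monom_altdef)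
  moreover have "X 1 ^ a * X 2 ^ b * X 3 ^ 0 = homogenize k (monom 1 a)"
    using 0 by (subst homogenize_monom) auto
  ultimately have "X 1 ^ a * X 2 ^ b * X 3 ^ 0 = homogenize k (res (X 1 ^ a * X 2 ^ b * X 3 ^ 0)) + l * 0"
    by (simp only: mult_zero_right add_0_right)
  then show ?case using form_0 by blast
next
  case (Suc c)
  let ?M = "X 1 ^ a * X 2 ^ b * X 3 ^ c"
  let ?A = "X 1 ^ Suc a * X 2 ^ b * X 3 ^ c" and ?B = "X 1 ^ a * X 2 ^ Suc b * X 3 ^ c"
  obtain A where A: "?A = homogenize k (res ?A) + l * A" "form (k - 1) A"
    using Suc.IH[of "Suc a" b] Suc.prems by auto
  obtain B where B: "?B = homogenize k (res ?B) + l * B" "form (k - 1) B"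
    using Suc.IH[of a "Suc b"] Suc.prems by auto
  have M: "form (k - 1) ?M" using form_monomial[of a b c] Suc.prems by auto
  have eq: "X 1 ^ a * X 2 ^ b * X 3 ^ Suc c = l * ?M + (const_poly \<alpha> * ?A + const_poly \<beta> * ?B)"
    by (simp add: l_def algebra_simps)
  have "res (X 1 ^ a * X 2 ^ b * X 3 ^ Suc c) = smult \<alpha> (res ?A) + smult \<beta> (res ?B)"
    unfolding eq by (simp only: res_simps) simp
  then have "homogenize k (res (X 1 ^ a * X 2 ^ b * X 3 ^ Suc c)) =
      const_poly \<alpha> * homogenize k (res ?A) + const_poly \<beta> * homogenize k (res ?B)"
    by (simp only: homogenize_add homogenize_smult)
  moreover have "const_poly \<alpha> * ?A + const_poly \<beta> * ?B =
      const_poly \<alpha> * homogenize k (res ?A) + const_poly \<beta> * homogenize k (res ?B) +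
      l * (const_poly \<alpha> * A + const_poly \<beta> * B)"
    by (subst A(1), subst B(1)) (simp add: algebra_simps)
  ultimately have "X 1 ^ a * X 2 ^ b * X 3 ^ Suc c = homogenize k (res (X 1 ^ a * X 2 ^ b * X 3 ^ Suc c)) +
      l * (?M + (const_poly \<alpha> * A + const_poly \<beta> * B))"
    unfolding eq by (simp only: distrib_left add.assoc add.commute add.left_commute)
  moreover have "form (k - 1) (?M + (const_poly \<alpha> * A + const_poly \<beta> * B))"
    using M A(2) B(2) by (intro form_add form_scale)
  ultimately show ?case using Suc.prems by blast
qed

lemma restriction_split:
  assumes "form k F"
  shows "\<exists>F'. F = homogenize k (res F) + l * F' \<and> form (k - 1) F' \<and> (k = 0 \<longrightarrow> F' = 0)"
  using assms
proof (induction F rule: form_monomial_induct)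
  case zero
  then show ?case by (intro exI[of _ 0]) (simp add: homogenize_def)
next
  case (scale c G)
  then obtain G' where G': "G = homogenize k (res G) + l * G'" "form (k - 1) G'" "k = 0 \<longrightarrow> G' = 0" by blast
  have "const_poly c * G = const_poly c * (homogenize k (res G) + l * G')" using G'(1) by simp
  also have "\<dots> = homogenize k (res (const_poly c * G)) + l * (const_poly c * G')"
    using homogenize_smult[of k c "res G"] by (simp add: distrib_left mult.left_commute)
  finally show ?case using form_scale[OF G'(2), of c] G'(3) mult_zero_right by metis
next
  case (add G H)
  then obtain G' H' where GH: "G = homogenize k (res G) + l * G'" "form (k - 1) G'" "k = 0 \<longrightarrow> G' = 0"
    "H = homogenize k (res H) + l * H'" "form (k - 1) H'" "k = 0 \<longrightarrow> H' = 0" by blast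
  have "G + H = (homogenize k (res G) + l * G') + (homogenize k (res H) + l * H')" using GH(1,4) by simp
  also have "\<dots> = homogenize k (res (G + H)) + l * (G' + H')"
    by (simp add: homogenize_add distrib_left)
  finally show ?case using form_add[OF GH(2,5)] GH(3,6) add_0_right by metis
qed (use restriction_split_monomial in blast)

lemma res_eq_0:
  assumes "form k F" "res F = 0"
  obtains F' where "F = l * F'" "form (k - 1) F'" "k = 0 \<Longrightarrow> F' = 0"
  using restriction_split[OF assms(1)] assms(2) by (auto simp: homogenize_def)

lemma degree_res: "form k F \<Longrightarrow> degree (res F) \<le> k"
proof (induction F rule: form_monomial_induct)
  case (monomial a b c)
  have "degree (res (X 1 ^ a * X 2 ^ b * X 3 ^ c)) \<le> degree ([:0, 1:] ^ a :: complex poly) + degree ([:\<beta>, \<alpha>:] ^ c)"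
    by (simp add: degree_mult_le)
  also have "\<dots> \<le> a + 1 * c"
    using degree_power_le[of "[:\<beta>, \<alpha>:]" c] by (intro add_mono) (auto simp: degree_linear_power intro: order_trans)
  finally show ?case using monomial by simp
next
  case (add G H)
  then show ?case by (simp add: degree_add_le)
qed auto

definition frac :: "nat \<Rightarrow> cpoly \<Rightarrow> cpoly fract" where
  "frac k H = Fract H (l ^ k)"

lemma frac_mult: "frac j A * frac k B = frac (j + k) (A * B)"
  by (simp add: frac_def power_add)

lemma frac_add: "frac k A + frac k B = frac k (A + B)"
  unfolding frac_def by (rule Fract_add_same) simp

lemma frac_scale: "scale_fract c (frac k A) = frac k (const_poly c * A)"
  by (simp add: frac_def scale_fract_Fract)

lemma frac_inject [simp]: "frac k A = frac k B \<longleftrightarrow> A = B"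
  by (simp add: frac_def eq_fract)

lemma frac_0 [simp]: "frac k 0 = 0"
  by (simp add: frac_def eq_fract Zero_fract_def)

lemma frac_eq_0 [simp]: "frac k A = 0 \<longleftrightarrow> A = 0"
  using frac_inject[of k A 0] by simp

lemma frac_l_mult: "frac (j + k) (l ^ j * A) = frac k A"
  by (simp add: frac_def power_add eq_fract)

lemma frac_Suc: "frac (Suc k) (l * A) = frac k A"
  using frac_l_mult[of 1 k A] by simp

definition P :: "int \<Rightarrow> cpoly fract set" where
  "P k = (if k < 0 then {0} else {frac (nat k) H | H. form (nat k) H})"

text \<open>For a fixed denominator the numerator is unique. For negative \<open>k\<close> the
  denominator is 1 and the only element 0 gets the value 0.\<close>

definition lead :: "int \<Rightarrow> cpoly fract \<Rightarrow> complex poly" where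
  "lead k a = res (THE H. a = frac (nat k) H)"

lemma P_nat: "P (int k) = {frac k H | H. form k H}"
  by (simp add: P_def)

lemma lead_frac: "lead (int k) (frac k H) = res H"
  unfolding lead_def by (rule arg_cong[of _ _ res]) (auto intro: the_equality)

lemma lead_0: "lead k 0 = 0"
  using lead_frac[of "nat k" 0] unfolding lead_def by simp

lemma P_cases:
  assumes "a \<in> P k"
  obtains "k < 0" "a = 0" | n H where "k = int n" "form n H" "a = frac n H"
proof (cases "k < 0")
  case True
  then show ?thesis using assms that(1) by (simp add: P_def)
next
  case False
  then obtain H where "form (nat k) H" "a = frac (nat k) H" using assms by (auto simp: P_def)
  then show ?thesis using False by (intro that(2)[of "nat k" H]) auto
qed

text \<open>The inclusion of \<open>P (k - 1)\<close> in \<open>P k\<close> multiplies numerator and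
  denominator by \<open>l\<close>, and the forms killed by \<open>res\<close> are the multiples of
  \<open>l\<close>; this identifies the kernel of \<open>lead k\<close>. Surjectivity is provided by
  \<open>homogenize\<close>.\<close>

lemma lead_filtration: "lead_filtration scale_fract P lead"
proof
  show "scale_fract c a * b = scale_fract c (a * b)" for a b c
    by (simp add: scale_fract_def mult.assoc)
  show sub: "fract_vs.subspace (P k)" for k
  proof (cases "k < 0")
    case False
    show ?thesis
    proof (rule fract_vs.subspaceI)
      show "0 \<in> P k" using False by (auto simp: P_def intro: exI[of _ 0])
      show "x + y \<in> P k" if "x \<in> P k" "y \<in> P k" for x y
        using that False by (auto simp: P_def frac_add intro: form_add)
      show "scale_fract c x \<in> P k" if "x \<in> P k" for c x
        using that False by (auto simp: P_def frac_scale intro: form_scale)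
    qed
  qed (simp add: P_def)
  show "P k = {0}" if "k < 0" for k using that by (simp add: P_def)
  show "a * b \<in> P (j + k)" if "a \<in> P j" "b \<in> P k" for a b j k
    using that fract_vs.subspace_0[OF sub]
    by (elim P_cases) (auto simp: frac_mult P_nat simp flip: of_nat_add intro: form_mult)
  show "P (k - 1) \<subseteq> P k" for k
  proof
    fix a assume "a \<in> P (k - 1)"
    then show "a \<in> P k"
    proof (cases rule: P_cases)
      case (2 n H)
      then have "k = int (Suc n)" "a = frac (Suc n) (l * H)" "form (Suc n) (l * H)"
        using form_mult[OF form_l, of n H] by (auto simp: frac_Suc)
      then show ?thesis by (auto simp only: P_nat)
    qed (use fract_vs.subspace_0[OF sub] in auto)
  qed
  show "lead (j + k) (a * b) = lead j a * lead k b" if "a \<in> P j" "b \<in> P k" for a b j k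
    using that by (elim P_cases) (auto simp: lead_0 frac_mult lead_frac simp flip: of_nat_add)
  show "lead k (a + b) = lead k a + lead k b" if "a \<in> P k" "b \<in> P k" for a b k
    using that by (elim P_cases) (auto simp: frac_add lead_frac lead_0)
  show "lead k (scale_fract c a) = smult c (lead k a)" if "a \<in> P k" for a k c
    using that by (elim P_cases) (auto simp: frac_scale lead_frac lead_0)
  show "lead k a = 0 \<longleftrightarrow> a \<in> P (k - 1)" if "a \<in> P k" for a k
    using that
  proof (cases rule: P_cases)
    case 1
    then show ?thesis by (simp add: lead_0 P_def)
  next
    case (2 n H)
    show ?thesis
    proof
      assume "lead k a = 0"
      then have "res H = 0" using 2 by (simp add: lead_frac)
      then obtain H' where H': "H = l * H'" "form (n - 1) H'" "n = 0 \<Longrightarrow> H' = 0"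
        using res_eq_0 2 by blast
      show "a \<in> P (k - 1)"
      proof (cases n)
        case 0
        then show ?thesis using 2 H' fract_vs.subspace_0[OF sub] by (simp add: lead_0)
      next
        case (Suc n')
        then have "a = frac n' H'" "k - 1 = int n'" "form n' H'" using 2 H' by (auto simp: frac_Suc)
        then show ?thesis by (auto simp only: P_nat)
      qed
    next
      assume "a \<in> P (k - 1)"
      then show "lead k a = 0"
      proof (cases rule: P_cases)
        case 1
        then show ?thesis using 2 by (simp add: lead_frac lead_0)
      next
        case (2 n' H')
        then have "k = int (Suc n')" "a = frac (Suc n') (l * H')" by (auto simp: frac_Suc)
        then show ?thesis by (simp only: lead_frac res_simps mult_zero_left)
      qed
    qed
  qed
  show "int (degree (lead k a)) \<le> k" if "a \<in> P k" "lead k a \<noteq> 0" for a k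
    using that by (elim P_cases) (auto simp: lead_0 lead_frac degree_res)
  show "\<exists>a\<in>P k. lead k a = u" if "u \<noteq> 0 \<Longrightarrow> int (degree u) \<le> k" for u k
  proof (cases "k < 0")
    case True
    then have "u = 0" using that by fastforce
    then show ?thesis using True by (intro bexI[of _ 0]) (auto simp: lead_0 P_def)
  next
    case False
    then obtain n where n: "k = int n" by (metis nonneg_int_cases linorder_not_less)
    then have "degree u \<le> n" using that by (cases "u = 0") auto
    then show ?thesis unfolding n
      by (intro bexI[of _ "frac n (homogenize n u)"]) (auto simp: lead_frac res_homogenize P_nat form_homogenize)
  qed
qed

end

section \<open>Points and local rings\<close>

lemma quotient_basis_basis_mod:
  assumes "quotient_basis V U B" "fract_vs.subspace U"
  shows "fract_ls.basis_mod V U B (\<lambda>b. b)"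
proof (rule fract_ls.basis_modI)
  have qb: "finite B" "B \<subseteq> V" "fract_vs.span (U \<union> B) = V"
    "\<And>c. (\<Sum>b\<in>B. scale_fract (c b) b) \<in> U \<Longrightarrow> \<forall>b\<in>B. c b = 0"
    using assms(1) unfolding quotient_basis_def by blast+
  show "finite B" by (rule qb(1))
  show "b \<in> V" if "b \<in> B" for b using qb(2) that by blast
  show "c b = 0" if "(\<Sum>b\<in>B. scale_fract (c b) b) \<in> U" "b \<in> B" for c b using qb(4) that by blast
  fix v assume "v \<in> V"
  then have "v \<in> {x + y | x y. x \<in> fract_vs.span U \<and> y \<in> fract_vs.span B}"
    using qb(3) unfolding fract_vs.span_Un by simp
  then obtain x y where xy: "v = x + y" "x \<in> U" "y \<in> fract_vs.span B"
    using assms(2) by (auto simp: fract_vs.span_eq_iff[THEN iffD2])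
  then obtain c where "y = (\<Sum>b\<in>B. scale_fract (c b) b)"
    unfolding fract_vs.span_finite[OF qb(1)] by blast
  then have "v - (\<Sum>b\<in>B. scale_fract (c b) b) \<in> U" using xy by simp
  then show "\<exists>c. v - (\<Sum>b\<in>B. scale_fract (c b) b) \<in> U" by (rule exI[of _ c])
qed

lemma quotient_basis_subset:
  assumes "quotient_basis V U B"
  shows "U \<subseteq> V" "fract_vs.subspace V"
  using assms fract_vs.span_superset[of "U \<union> B"] fract_vs.subspace_span[of "U \<union> B"]
  unfolding quotient_basis_def by auto

text \<open>The definite description is meaningful because any two bases of the quotient bound each
  other by \<open>independent_mod_card\<close>.\<close>

lemma quotient_dim_eq:
  assumes "quotient_basis V U B" "fract_vs.subspace U"
  shows "quotient_dim V U = card B"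
proof -
  have le: "card B1 \<le> card B2" if "quotient_basis V U B1" "quotient_basis V U B2" for B1 B2
  proof (rule fract_ls.independent_mod_card[OF assms(2) quotient_basis_subset(2,1)[OF assms(1)]
        quotient_basis_basis_mod[OF that(2) assms(2)], of B1 "\<lambda>b. b"])
    show "c b = 0" if "(\<Sum>b\<in>B1. scale_fract (c b) b) \<in> U" "b \<in> B1" for c b
      using that \<open>quotient_basis V U B1\<close> unfolding quotient_basis_def by blast
  qed (use that in \<open>auto simp: quotient_basis_def\<close>)
  show ?thesis unfolding quotient_dim_def
    by (rule the_equality) (use assms(1) le in \<open>auto intro: le_antisym\<close>)
qed

text \<open>A vector is fixed for each point. Another choice would rescale the values of forms,
  which affects neither their vanishing nor quotients of values in equal degree.\<close>

definition rep :: "plane \<Rightarrow> complex ^ 3" where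
  "rep p = (SOME v. v \<noteq> 0 \<and> Rep_plane p = vec.span {v})"

lemma rep: "rep p \<noteq> 0" "Rep_plane p = vec.span {rep p}"
proof -
  have "\<exists>v. v \<noteq> 0 \<and> Rep_plane p = vec.span {v}" using Rep_plane[of p] by blast
  from someI_ex[OF this] show "rep p \<noteq> 0" "Rep_plane p = vec.span {rep p}" unfolding rep_def by blast+
qed

lemma ex_point:
  assumes "v \<noteq> 0"
  obtains p c where "c \<noteq> 0" "rep p = c *s v"
proof -
  define p where "p = Abs_plane (vec.span {v})"
  have "Rep_plane p = vec.span {v}" unfolding p_def using assms by (intro Abs_plane_inverse) blast
  then have "rep p \<in> vec.span {v}" using rep(2)[of p] vec.span_base[of "rep p" "{rep p}"] by auto
  then obtain c where "rep p = c *s v" by (auto simp: vec.span_singleton)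
  moreover have "c \<noteq> 0" using calculation rep(1)[of p] by auto
  ultimately show ?thesis using that by blast
qed

lemma rep_proportional: "rep p = c *s rep q \<Longrightarrow> p = q"
proof -
  assume eq: "rep p = c *s rep q"
  have c: "c \<noteq> 0" using eq rep(1)[of p] by auto
  have "vec.span {rep p} = vec.span {rep q}"
  proof
    have "rep p \<in> vec.span {rep q}" unfolding eq vec.span_singleton by blast
    then show "vec.span {rep p} \<subseteq> vec.span {rep q}"
      by (intro vec.span_minimal) auto
    have "rep q = inverse c *s rep p" using c unfolding eq by (simp add: vector_smult_assoc)
    then have "rep q \<in> vec.span {rep p}" unfolding vec.span_singleton by blast
    then show "vec.span {rep q} \<subseteq> vec.span {rep p}"
      by (intro vec.span_minimal) auto
  qed
  then show "p = q" using rep(2) Rep_plane_inject by metis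
qed

abbreviation value_at :: "cpoly \<Rightarrow> plane \<Rightarrow> complex" where
  "value_at F p \<equiv> eval_poly F (rep p)"

lemma nonvanishing_at_iff: "form b B \<Longrightarrow> nonvanishing_at B p \<longleftrightarrow> value_at B p \<noteq> 0"
proof -
  assume B: "form b B"
  show ?thesis
  proof
    assume "nonvanishing_at B p"
    then show "value_at B p \<noteq> 0"
      using rep[of p] vec.span_base[of "rep p" "{rep p}"] unfolding nonvanishing_at_def by auto
  next
    assume nz: "value_at B p \<noteq> 0"
    show "nonvanishing_at B p" unfolding nonvanishing_at_def
    proof (intro ballI impI)
      fix v assume "v \<in> Rep_plane p" "v \<noteq> 0"
      then obtain c where "v = c *s rep p" "c \<noteq> 0" unfolding rep(2) vec.span_singleton by auto
      then show "eval_poly B v \<noteq> 0" using nz eval_poly_scale[OF B] by simp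
    qed
  qed
qed

lemma stalk_iff:
  "s \<in> stalk d p \<longleftrightarrow> (\<exists>A B a b. s = Fract A B \<and> form a A \<and> form b B \<and> int a - int b = d \<and> value_at B p \<noteq> 0)"
  unfolding stalk_def mem_Collect_eq by (intro iff_exI) (use nonvanishing_at_iff in blast)

lemma at_nonzero: "value_at B p \<noteq> 0 \<Longrightarrow> B \<noteq> 0"
  by auto

text \<open>The residue map of the local ring, kept as a relation because a germ has many
  representations as a fraction. Having some value is the same as lying in the local ring, and a
  nonzero value marks a unit.\<close>

definition has_value :: "plane \<Rightarrow> cpoly fract \<Rightarrow> complex \<Rightarrow> bool" where
  "has_value p s c \<longleftrightarrow> (\<exists>A B b. s = Fract A B \<and> form b A \<and> form b B \<and> value_at B p \<noteq> 0 \<and> c = value_at A p / value_at B p)"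

lemma has_valueI: "form b A \<Longrightarrow> form b B \<Longrightarrow> value_at B p \<noteq> 0 \<Longrightarrow> has_value p (Fract A B) (value_at A p / value_at B p)"
  unfolding has_value_def by blast

lemma local_ring_iff: "s \<in> local_ring p \<longleftrightarrow> (\<exists>c. has_value p s c)"
  unfolding stalk_iff has_value_def by fastforce

lemma has_value_local: "has_value p s c \<Longrightarrow> s \<in> local_ring p"
  using local_ring_iff by blast

lemma has_value_unique:
  assumes "has_value p s c" "has_value p s c'"
  shows "c = c'"
proof -
  obtain A B b where 1: "s = Fract A B" "value_at B p \<noteq> 0" "c = value_at A p / value_at B p"
    using assms(1) unfolding has_value_def by blast
  obtain A' B' b' where 2: "s = Fract A' B'" "value_at B' p \<noteq> 0" "c' = value_at A' p / value_at B' p"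
    using assms(2) unfolding has_value_def by blast
  have "A * B' = A' * B" using 1 2 at_nonzero by (simp add: eq_fract)
  then have "value_at A p * value_at B' p = value_at A' p * value_at B p" by (metis eval_poly_simps(7))
  then show ?thesis unfolding 1(3) 2(3) using 1(2) 2(2) by (simp add: frac_eq_eq)
qed

lemma has_value_add:
  assumes "has_value p s c" "has_value p s' c'"
  shows "has_value p (s + s') (c + c')"
proof -
  obtain A B b where 1: "s = Fract A B" "form b A" "form b B" "value_at B p \<noteq> 0" "c = value_at A p / value_at B p"
    using assms(1) unfolding has_value_def by blast
  obtain A' B' b' where 2: "s' = Fract A' B'" "form b' A'" "form b' B'" "value_at B' p \<noteq> 0" "c' = value_at A' p / value_at B' p"
    using assms(2) unfolding has_value_def by blast
  have "s + s' = Fract (A * B' + A' * B) (B * B')" using 1 2 at_nonzero by simp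
  moreover have "form (b + b') (A * B' + A' * B)"
    using form_add[OF form_mult[OF 1(2) 2(3)]] form_mult[OF 2(2) 1(3)] by (simp add: add.commute)
  moreover have "value_at (B * B') p \<noteq> 0" using 1(4) 2(4) by simp
  ultimately have "has_value p (s + s') (value_at (A * B' + A' * B) p / value_at (B * B') p)"
    using has_valueI[OF _ form_mult[OF 1(3) 2(3)]] by metis
  moreover have "value_at (A * B' + A' * B) p / value_at (B * B') p = c + c'"
    unfolding 1(5) 2(5) using 1(4) 2(4) by (simp add: add_frac_eq)
  ultimately show ?thesis by simp
qed

lemma has_value_mult:
  assumes "has_value p s c" "has_value p s' c'"
  shows "has_value p (s * s') (c * c')"
proof -
  obtain A B b where 1: "s = Fract A B" "form b A" "form b B" "value_at B p \<noteq> 0" "c = value_at A p / value_at B p"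
    using assms(1) unfolding has_value_def by blast
  obtain A' B' b' where 2: "s' = Fract A' B'" "form b' A'" "form b' B'" "value_at B' p \<noteq> 0" "c' = value_at A' p / value_at B' p"
    using assms(2) unfolding has_value_def by blast
  have "has_value p (Fract (A * A') (B * B')) (value_at (A * A') p / value_at (B * B') p)"
    using 1(4) 2(4) by (intro has_valueI[OF form_mult[OF 1(2) 2(2)] form_mult[OF 1(3) 2(3)]]) simp
  then show ?thesis using 1 2 by simp
qed

lemma has_value_const: "has_value p (Fract (const_poly c) 1) c"
  using has_valueI[of 0 "const_poly c" 1 p] by simp

lemma has_value_0: "has_value p 0 0" and has_value_1: "has_value p 1 1"
  using has_value_const[of p 0] has_value_const[of p 1] by (simp_all add: Zero_fract_def One_fract_def)

lemma has_value_power: "has_value p s c \<Longrightarrow> has_value p (s ^ n) (c ^ n)"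
  by (induction n) (auto intro: has_value_1 has_value_mult)

lemma has_value_inverse:
  assumes "has_value p s c" "c \<noteq> 0"
  obtains s' where "s' \<in> local_ring p" "s * s' = 1"
proof -
  obtain A B b where 1: "s = Fract A B" "form b A" "form b B" "value_at B p \<noteq> 0" "c = value_at A p / value_at B p"
    using assms(1) unfolding has_value_def by blast
  have A: "value_at A p \<noteq> 0" using 1 assms(2) by auto
  have "Fract B A \<in> local_ring p" using has_valueI[OF 1(3,2) A] by (rule has_value_local)
  moreover have "s * Fract B A = 1" using 1 at_nonzero[OF A] at_nonzero[OF 1(4)]
    by (simp add: One_fract_def eq_fract)
  ultimately show ?thesis by (rule that)
qed

lemma local_ring_add: "a \<in> local_ring p \<Longrightarrow> b \<in> local_ring p \<Longrightarrow> a + b \<in> local_ring p"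
  and local_ring_mult: "a \<in> local_ring p \<Longrightarrow> b \<in> local_ring p \<Longrightarrow> a * b \<in> local_ring p"
  unfolding local_ring_iff using has_value_add has_value_mult by blast+

lemma local_ring_const: "Fract (const_poly c) 1 \<in> local_ring p"
  using has_value_const has_value_local by blast

lemma local_ring_1: "1 \<in> local_ring p" and local_ring_0: "0 \<in> local_ring p"
  using has_value_1 has_value_0 has_value_local by blast+

lemma local_ideal_mult: "local_ideal p J \<Longrightarrow> c \<in> local_ring p \<Longrightarrow> a \<in> J \<Longrightarrow> c * a \<in> J"
  unfolding local_ideal_def by blast

lemma local_ideal_subspace: "local_ideal p J \<Longrightarrow> fract_vs.subspace J"
  unfolding local_ideal_def using local_ring_const
  by (intro fract_vs.subspaceI) (auto simp: scale_fract_def)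

lemma local_ideal_unit:
  assumes "local_ideal p J" "has_value p u c" "c \<noteq> 0" "u * a \<in> J"
  shows "a \<in> J"
proof -
  obtain u' where u': "u' \<in> local_ring p" "u * u' = 1" using has_value_inverse assms(2,3) by blast
  have "u' * (u * a) \<in> J" using local_ideal_mult[OF assms(1) u'(1) assms(4)] .
  moreover have "u' * (u * a) = (u * u') * a" by (simp only: mult.commute mult.left_commute)
  ultimately show ?thesis using u'(2) by simp
qed

section \<open>The affine coordinate ring\<close>

context affine_chart
begin

sublocale lf: lead_filtration scale_fract P lead
  by (rule lead_filtration)

lemma R_iff: "a \<in> lf.R \<longleftrightarrow> (\<exists>k H. form k H \<and> a = frac k H)"
proof
  assume "a \<in> lf.R"
  then obtain k where "a \<in> P k" unfolding lf.R_def by blast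
  then show "\<exists>k H. form k H \<and> a = frac k H"
    by (cases rule: P_cases) (auto intro: exI[of _ 0])
next
  assume "\<exists>k H. form k H \<and> a = frac k H"
  then obtain k H where "form k H" "a = frac k H" by blast
  then have "a \<in> P (int k)" unfolding P_nat by blast
  then show "a \<in> lf.R" using lf.P_subset_R by blast
qed

definition chart :: "plane set" where
  "chart = {p. value_at l p \<noteq> 0}"

lemma has_value_frac:
  assumes "p \<in> chart" "form k H"
  shows "has_value p (frac k H) (value_at H p / value_at l p ^ k)"
  using has_valueI[OF assms(2) form_l_power[of k], of p] assms(1) by (simp add: frac_def chart_def)

lemma R_subset_local_ring: "p \<in> chart \<Longrightarrow> lf.R \<subseteq> local_ring p"
  using has_value_frac has_value_local unfolding R_iff subset_iff by blast

lemma one_in_R: "1 \<in> lf.R"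
  unfolding R_iff by (intro exI[of _ 0] exI[of _ 1]) (simp add: frac_def One_fract_def)

lemma R_power: "t \<in> lf.R \<Longrightarrow> t ^ n \<in> lf.R"
  by (induction n) (auto intro: one_in_R lf.R_mult)

text \<open>Some nonzero polynomial in \<open>t\<close> lies in \<open>W p\<close>, since the quotient is finite-dimensional;
  its lowest term gives the power of \<open>t\<close>.\<close>

lemma algebraic_mod_ideal:
  assumes "zero_dim_subscheme W" "p \<in> chart" "t \<in> lf.R"
  obtains j w where "w \<in> lf.R" "t ^ j * (1 + t * w) \<in> W p"
proof -
  have W: "local_ideal p (W p)" using assms(1) unfolding zero_dim_subscheme_def by blast
  obtain B where B: "quotient_basis (local_ring p) (W p) B"
    using assms(1) unfolding zero_dim_subscheme_def by blast
  have sub: "fract_vs.subspace (W p)" using local_ideal_subspace[OF W] .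
  \<comment> \<open>The \<open>card B + 1\<close> powers up to \<open>t ^ ?N\<close> cannot be
    independent modulo \<open>W p\<close>.\<close>
  let ?N = "card B"
  have "\<exists>c. (\<Sum>i\<le>?N. scale_fract (c i) (t ^ i)) \<in> W p \<and> (\<exists>i\<le>?N. c i \<noteq> 0)"
  proof (rule ccontr)
    assume neg: "\<not> ?thesis"
    have "card {..?N} \<le> card B"
    proof (rule fract_ls.independent_mod_card[OF sub quotient_basis_subset(2,1)[OF B]
          quotient_basis_basis_mod[OF B sub], of "{..?N}" "\<lambda>i. t ^ i"])
      show "t ^ i \<in> local_ring p" for i using R_power[OF assms(3)] R_subset_local_ring[OF assms(2)] by blast
      show "c i = 0" if "(\<Sum>i\<le>?N. scale_fract (c i) (t ^ i)) \<in> W p" "i \<in> {..?N}" for c i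
        using neg that by auto
    qed simp
    then show False by simp
  qed
  then obtain c where c: "(\<Sum>i\<le>?N. scale_fract (c i) (t ^ i)) \<in> W p" "\<exists>i\<le>?N. c i \<noteq> 0" by blast
  define j where "j = (LEAST i. c i \<noteq> 0)"
  have j: "c j \<noteq> 0" "\<And>i. i < j \<Longrightarrow> c i = 0"
    unfolding j_def using c(2) LeastI_ex[of "\<lambda>i. c i \<noteq> 0"] not_less_Least[of _ "\<lambda>i. c i \<noteq> 0"] by blast+
  have jN: "j \<le> ?N" using c(2) j(2) by (metis linorder_not_le order_less_le_trans)
  \<comment> \<open>What remains of the terms above \<open>t ^ j\<close> after division by the
    lowest coefficient and by \<open>t ^ (j + 1)\<close>.\<close>
  define w where "w = (\<Sum>i\<in>{j<..?N}. scale_fract (c i / c j) (t ^ (i - j - 1)))"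
  have "w \<in> lf.R" unfolding w_def
    using R_power[OF assms(3)] by (intro fract_vs.subspace_sum[OF lf.subspace_R] lf.R_scale)
  have "(\<Sum>i\<le>?N. scale_fract (c i) (t ^ i)) = (\<Sum>i\<in>{j..?N}. scale_fract (c i) (t ^ i))"
    by (intro sum.mono_neutral_right) (auto simp: j(2) not_le)
  also have "\<dots> = scale_fract (c j) (t ^ j) + (\<Sum>i\<in>{j<..?N}. scale_fract (c i) (t ^ i))"
  proof -
    have "{j..?N} = insert j {j<..?N}" using jN by auto
    then show ?thesis by simp
  qed
  also have "(\<Sum>i\<in>{j<..?N}. scale_fract (c i) (t ^ i)) = scale_fract (c j) (t ^ j * (t * w))"
  proof -
    have "t ^ j * (t * w) = (\<Sum>i\<in>{j<..?N}. scale_fract (c i / c j) (t ^ i))"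
      unfolding w_def sum_distrib_left
    proof (intro sum.cong refl)
      fix i assume "i \<in> {j<..?N}"
      then have "i = j + Suc (i - j - 1)" by auto
      then have "t ^ i = t ^ j * (t * t ^ (i - j - 1))" by (metis power_add power_Suc)
      then show "t ^ j * (t * scale_fract (c i / c j) (t ^ (i - j - 1))) = scale_fract (c i / c j) (t ^ i)"
        by (simp only: lf.scale_mult_right)
    qed
    then have "scale_fract (c j) (t ^ j * (t * w)) = (\<Sum>i\<in>{j<..?N}. scale_fract (c j) (scale_fract (c i / c j) (t ^ i)))"
      by (simp only: fract_vs.scale_sum_right)
    then show ?thesis using j(1) by (simp add: fract_vs.scale_scale)
  qed
  also have "scale_fract (c j) (t ^ j) + scale_fract (c j) (t ^ j * (t * w)) = scale_fract (c j) (t ^ j * (1 + t * w))"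
    by (simp only: distrib_left mult_1_right fract_vs.scale_right_distrib)
  finally have "scale_fract (c j) (t ^ j * (1 + t * w)) \<in> W p" using c(1) by simp
  then have "scale_fract (inverse (c j)) (scale_fract (c j) (t ^ j * (1 + t * w))) \<in> W p"
    by (rule fract_vs.subspace_scale[OF sub])
  then have "t ^ j * (1 + t * w) \<in> W p" using j(1) by (simp add: fract_vs.scale_scale)
  with \<open>w \<in> lf.R\<close> show ?thesis by (rule that)
qed

text \<open>If \<open>t\<close> vanishes at \<open>p\<close>, then \<open>1 + t * w\<close> has
  value 1 there and can be cancelled.\<close>

lemma power_in_ideal:
  assumes "zero_dim_subscheme W" "p \<in> chart" "t \<in> lf.R" "has_value p t 0"
  obtains j where "t ^ j \<in> W p"
proof -
  have W: "local_ideal p (W p)" using assms(1) unfolding zero_dim_subscheme_def by blast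
  obtain j w where w: "w \<in> lf.R" "t ^ j * (1 + t * w) \<in> W p"
    using algebraic_mod_ideal[OF assms(1-3)] by blast
  obtain c where "has_value p w c" using w(1) R_subset_local_ring[OF assms(2)] local_ring_iff by blast
  then have "has_value p (1 + t * w) (1 + 0 * c)"
    using assms(4) by (intro has_value_add has_value_mult has_value_1)
  then have "t ^ j \<in> W p" using local_ideal_unit[OF W, of "1 + t * w" 1] w(2) by (simp add: mult.commute)
  then show ?thesis by (rule that)
qed

text \<open>If \<open>t\<close> does not vanish at \<open>p\<close>, it is the power of
  \<open>t\<close> that can be cancelled, and \<open>- w\<close> is an inverse modulo
  \<open>W p\<close>. The point is that it lies in \<open>R\<close>, not merely in the local
  ring.\<close>

lemma inverse_mod_ideal:
  assumes "zero_dim_subscheme W" "p \<in> chart" "t \<in> lf.R" "has_value p t c" "c \<noteq> 0"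
  obtains w where "w \<in> lf.R" "t * w - 1 \<in> W p"
proof -
  have W: "local_ideal p (W p)" using assms(1) unfolding zero_dim_subscheme_def by blast
  obtain j w where w: "w \<in> lf.R" "t ^ j * (1 + t * w) \<in> W p"
    using algebraic_mod_ideal[OF assms(1-3)] by blast
  have "has_value p (t ^ j) (c ^ j)" using assms(4) by (rule has_value_power)
  then have "1 + t * w \<in> W p" using local_ideal_unit[OF W] w(2) assms(5) by force
  then have "- (1 + t * w) \<in> W p" using fract_vs.subspace_neg[OF local_ideal_subspace[OF W]] by blast
  moreover have "- (1 + t * w) = t * (- w) - 1" by simp
  moreover have "- w \<in> lf.R" using fract_vs.subspace_neg[OF lf.subspace_R w(1)] .
  ultimately show ?thesis using that by metis
qed

section \<open>Gluing local quotients on the chart\<close>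

lemma separate_points:
  assumes "p \<in> chart" "q \<in> chart" "p \<noteq> q"
  obtains t c where "t \<in> lf.R" "has_value q t 0" "has_value p t c" "c \<noteq> 0"
proof -
  have "\<exists>i j. rep q $ j * rep p $ i \<noteq> rep q $ i * rep p $ j"
  proof (rule ccontr)
    assume neg: "\<not> ?thesis"
    obtain j where j: "rep q $ j \<noteq> 0" using rep(1)[of q] by (auto simp: vec_eq_iff)
    have "rep p $ i = (rep p $ j / rep q $ j) * rep q $ i" for i
      using neg j by (simp add: field_simps)
    then have "rep p = (rep p $ j / rep q $ j) *s rep q"
      unfolding vec_eq_iff vector_smult_component by (rule allI)
    then show False using rep_proportional assms(3) by blast
  qed
  then obtain i j where ij: "rep q $ j * rep p $ i \<noteq> rep q $ i * rep p $ j" by blast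
  \<comment> \<open>Distinct points have a nonzero minor of size two; as a linear form in the
    coordinates of \<open>p\<close>, this minor vanishes at \<open>q\<close>.\<close>
  define H where "H = const_poly (rep q $ j) * X i - const_poly (rep q $ i) * X j"
  have H: "form 1 H" unfolding H_def by (intro form_diff form_scale form_X)
  show ?thesis
  proof (rule that)
    show "frac 1 H \<in> lf.R" using H unfolding R_iff by blast
    show "has_value q (frac 1 H) 0"
      using has_value_frac[OF assms(2) H] by (simp add: H_def mult.commute)
    show "has_value p (frac 1 H) (value_at H p / value_at l p ^ 1)"
      using has_value_frac[OF assms(1) H] .
    show "value_at H p / value_at l p ^ 1 \<noteq> 0"
      using ij assms(1) by (simp add: H_def chart_def)
  qed
qed

text \<open>A product of functions that separate \<open>p\<close> from each \<open>q\<close> in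
  \<open>S\<close>, raised to powers that put them into \<open>W q\<close>.\<close>

lemma unit_vanishing_elsewhere:
  assumes "zero_dim_subscheme W" "p \<in> chart" "finite S" "S \<subseteq> chart" "p \<notin> S"
  obtains u c where "u \<in> lf.R" "\<forall>q\<in>S. u \<in> W q" "has_value p u c" "c \<noteq> 0"
proof -
  have "\<exists>u c. u \<in> lf.R \<and> (\<forall>q\<in>S. u \<in> W q) \<and> has_value p u c \<and> c \<noteq> 0"
    using assms(3-5)
  proof (induction S rule: finite_induct)
    case empty
    then show ?case using one_in_R has_value_1[of p] by (intro exI[of _ 1]) auto
  next
    case (insert q S)
    then obtain u c where u: "u \<in> lf.R" "\<forall>q\<in>S. u \<in> W q" "has_value p u c" "c \<noteq> 0" by auto
    have q: "q \<in> chart" "p \<noteq> q" using insert by auto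
    obtain t b where t: "t \<in> lf.R" "has_value q t 0" "has_value p t b" "b \<noteq> 0"
      using separate_points[OF assms(2) q] by blast
    obtain n where n: "t ^ n \<in> W q" using power_in_ideal[OF assms(1) q(1) t(1,2)] by blast
    have W: "local_ideal q' (W q')" for q' using assms(1) unfolding zero_dim_subscheme_def by blast
    have tn: "t ^ n \<in> lf.R" using R_power[OF t(1)] .
    have "u * t ^ n \<in> W q'" if "q' \<in> insert q S" for q'
    proof (cases "q' = q")
      case True
      then show ?thesis using local_ideal_mult[OF W _ n] u(1) R_subset_local_ring[OF q(1)] by blast
    next
      case False
      then have "q' \<in> S" using that by blast
      then have "t ^ n * u \<in> W q'"
        using local_ideal_mult[OF W, of "t ^ n" q' u] u(2) tn R_subset_local_ring[of q'] insert.prems(1) by blast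
      then show ?thesis by (simp only: mult.commute)
    qed
    moreover have "has_value p (u * t ^ n) (c * b ^ n)"
      using u(3) t(3) by (intro has_value_mult has_value_power)
    moreover have "u * t ^ n \<in> lf.R" using lf.R_mult u(1) tn by blast
    ultimately show ?case using u(4) t(4) by (intro exI[of _ "u * t ^ n"] exI[of _ "c * b ^ n"]) auto
  qed
  then show ?thesis using that by blast
qed

text \<open>The denominator of a germ is invertible modulo \<open>W p\<close> by an element of
  \<open>R\<close>, so \<open>R\<close> maps onto each local quotient.\<close>

lemma approximate_local:
  assumes "zero_dim_subscheme W" "p \<in> chart" "b \<in> local_ring p"
  obtains a where "a \<in> lf.R" "a - b \<in> W p"
proof -
  have W: "local_ideal p (W p)" using assms(1) unfolding zero_dim_subscheme_def by blast
  obtain A B n where AB: "b = Fract A B" "form n A" "form n B" "value_at B p \<noteq> 0"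
    using assms(3) unfolding local_ring_iff has_value_def by blast
  have R: "frac n A \<in> lf.R" "frac n B \<in> lf.R" using AB unfolding R_iff by blast+
  have "has_value p (frac n B) (value_at B p / value_at l p ^ n)"
    using has_value_frac[OF assms(2) AB(3)] .
  moreover have "value_at B p / value_at l p ^ n \<noteq> 0" using AB(4) assms(2) by (simp add: chart_def)
  ultimately obtain w where w: "w \<in> lf.R" "frac n B * w - 1 \<in> W p"
    using inverse_mod_ideal[OF assms(1,2) R(2)] by blast
  have "frac n A = b * frac n B"
    using AB(1) at_nonzero[OF AB(4)] by (simp add: frac_def eq_fract)
  then have "frac n A * w - b = b * (frac n B * w - 1)" by (simp add: algebra_simps)
  moreover have "b * (frac n B * w - 1) \<in> W p" using local_ideal_mult[OF W assms(3) w(2)] .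
  ultimately have "frac n A * w - b \<in> W p" by simp
  then show ?thesis using that lf.R_mult[OF R(1) w(1)] by blast
qed

definition affine_ideal :: "ideal_stalks \<Rightarrow> cpoly fract set" where
  "affine_ideal W = {a \<in> lf.R. \<forall>p\<in>chart. a \<in> W p}"

lemma affine_ideal_subset_R: "affine_ideal W \<subseteq> lf.R"
  unfolding affine_ideal_def by blast

lemma subspace_affine_ideal:
  assumes "zero_dim_subscheme W"
  shows "fract_vs.subspace (affine_ideal W)"
proof -
  have "fract_vs.subspace (W p)" for p
    using assms local_ideal_subspace unfolding zero_dim_subscheme_def by blast
  then show ?thesis
    using lf.subspace_R unfolding affine_ideal_def fract_vs.subspace_def by blast
qed

lemma affine_ideal_mult:
  assumes "zero_dim_subscheme W" "a \<in> lf.R" "b \<in> affine_ideal W"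
  shows "a * b \<in> affine_ideal W"
  using assms local_ideal_mult lf.R_mult R_subset_local_ring
  unfolding affine_ideal_def zero_dim_subscheme_def by blast

text \<open>Chinese remainder theorem: the affine coordinate ring surjects onto the product of the
  local quotients.\<close>

lemma basis_mod_affine_ideal:
  assumes W: "zero_dim_subscheme W" and supp: "support W \<subseteq> chart"
  obtains J :: "(plane \<times> cpoly fract) set" and e
  where "fract_ls.basis_mod lf.R (affine_ideal W) J e" "card J = scheme_length W"
proof -
  have ideal: "local_ideal p (W p)" and fin: "finite (support W)" for p
    using W unfolding zero_dim_subscheme_def by blast+
  have sub: "fract_vs.subspace (W p)" for p using local_ideal_subspace[OF ideal] .
  have "\<exists>B. quotient_basis (local_ring p) (W p) B" for p
    using W unfolding zero_dim_subscheme_def by blast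
  then obtain B where B: "\<And>p. quotient_basis (local_ring p) (W p) (B p)" by metis
  have bm: "fract_ls.basis_mod (local_ring p) (W p) (B p) (\<lambda>b. b)" for p
    using quotient_basis_basis_mod[OF B sub] .
  have finB: "finite (B p)" "B p \<subseteq> local_ring p" for p using B unfolding quotient_basis_def by blast+
  define J where "J = Sigma (support W) B"
  have card_J: "card J = scheme_length W"
    unfolding J_def scheme_length_def using fin finB quotient_dim_eq[OF B sub] by simp
  \<comment> \<open>A function congruent to \<open>b\<close> at \<open>p\<close> and to 0 at the
    other points of the support: \<open>u\<close> kills the other points, \<open>w\<close> inverts
    \<open>u\<close> at \<open>p\<close>, and \<open>a\<close> approximates \<open>b\<close>
    there.\<close>
  have "\<exists>a\<in>lf.R. a - b \<in> W p \<and> (\<forall>q\<in>support W - {p}. a \<in> W q)" if p: "p \<in> support W" "b \<in> B p" for p b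
  proof -
    have pc: "p \<in> chart" using p supp by blast
    obtain u c where u: "u \<in> lf.R" "\<forall>q\<in>support W - {p}. u \<in> W q" "has_value p u c" "c \<noteq> 0"
      using unit_vanishing_elsewhere[OF W pc, of "support W - {p}"] fin supp by auto
    obtain w where w: "w \<in> lf.R" "u * w - 1 \<in> W p" using inverse_mod_ideal[OF W pc u(1,3,4)] by blast
    obtain a where a: "a \<in> lf.R" "a - b \<in> W p"
      using approximate_local[OF W pc] p(2) finB(2) by blast
    have aw: "a * w \<in> lf.R" using lf.R_mult a(1) w(1) by blast
    have "u * w * a - b = a * (u * w - 1) + (a - b)" by (simp add: algebra_simps)
    also have "\<dots> \<in> W p"
      using local_ideal_mult[OF ideal _ w(2)] a R_subset_local_ring[OF pc]
      by (intro fract_vs.subspace_add[OF sub]) auto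
    finally have "u * w * a - b \<in> W p" .
    moreover have "u * w * a \<in> W q" if "q \<in> support W - {p}" for q
    proof -
      have "a * w \<in> local_ring q" using aw R_subset_local_ring[of q] that supp by blast
      then have "(a * w) * u \<in> W q" using local_ideal_mult[OF ideal] u(2) that by blast
      then show ?thesis by (simp add: ac_simps)
    qed
    moreover have "u * w * a \<in> lf.R" using lf.R_mult u(1) w(1) a(1) by blast
    ultimately show ?thesis by blast
  qed
  then obtain e where e: "\<And>p b. p \<in> support W \<Longrightarrow> b \<in> B p \<Longrightarrow>
      e p b \<in> lf.R \<and> e p b - b \<in> W p \<and> (\<forall>q\<in>support W - {p}. e p b \<in> W q)"
    by metis
  \<comment> \<open>Modulo \<open>W p\<close> only the block of indices belonging to
    \<open>p\<close> survives.\<close>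
  have local_sum: "(\<Sum>x\<in>J. scale_fract (c x) (e (fst x) (snd x))) - (\<Sum>b\<in>B p. scale_fract (c (p, b)) b) \<in> W p"
    if p: "p \<in> support W" for p c
  proof -
    have "(\<Sum>x\<in>J. scale_fract (c x) (e (fst x) (snd x))) =
        (\<Sum>q\<in>support W. \<Sum>b\<in>B q. scale_fract (c (q, b)) (e q b))"
      unfolding J_def by (simp add: sum.Sigma fin finB case_prod_unfold)
    also have "\<dots> = (\<Sum>b\<in>B p. scale_fract (c (p, b)) (e p b)) +
        (\<Sum>q\<in>support W - {p}. \<Sum>b\<in>B q. scale_fract (c (q, b)) (e q b))"
      using fin p by (rule sum.remove)
    finally have "(\<Sum>x\<in>J. scale_fract (c x) (e (fst x) (snd x))) - (\<Sum>b\<in>B p. scale_fract (c (p, b)) b) =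
        (\<Sum>b\<in>B p. scale_fract (c (p, b)) (e p b - b)) +
        (\<Sum>q\<in>support W - {p}. \<Sum>b\<in>B q. scale_fract (c (q, b)) (e q b))"
      by (simp add: fract_vs.scale_right_diff_distrib sum_subtractf)
    also have "\<dots> \<in> W p"
      using e p by (intro fract_vs.subspace_add[OF sub] fract_vs.subspace_sum[OF sub] fract_vs.subspace_scale[OF sub]) auto
    finally show ?thesis .
  qed
  have eR: "e (fst x) (snd x) \<in> lf.R" if "x \<in> J" for x
    using that e unfolding J_def by auto
  have "fract_ls.basis_mod lf.R (affine_ideal W) J (\<lambda>x. e (fst x) (snd x))"
  proof (rule fract_ls.basis_modI)
    show "finite J" unfolding J_def using fin finB by auto
    show "e (fst x) (snd x) \<in> lf.R" if "x \<in> J" for x using eR[OF that] .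
  next
    fix v assume v: "v \<in> lf.R"
    have "\<forall>p\<in>support W. \<exists>c. v - (\<Sum>b\<in>B p. scale_fract (c b) b) \<in> W p"
    proof
      fix p assume p: "p \<in> support W"
      have "v \<in> local_ring p" using v R_subset_local_ring[of p] supp p by blast
      from bm this show "\<exists>c. v - (\<Sum>b\<in>B p. scale_fract (c b) b) \<in> W p"
        by (rule fract_ls.basis_mod_expand) (rule exI)
    qed
    then obtain c where "\<forall>p\<in>support W. v - (\<Sum>b\<in>B p. scale_fract (c p b) b) \<in> W p"
      by (rule bchoice[THEN exE])
    then have c: "v - (\<Sum>b\<in>B p. scale_fract (c p b) b) \<in> W p" if "p \<in> support W" for p
      using that by (rule bspec)
    let ?s = "\<Sum>x\<in>J. scale_fract (c (fst x) (snd x)) (e (fst x) (snd x))"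
    have sR: "v - ?s \<in> lf.R"
      using v eR by (intro lf.R_diff fract_vs.subspace_sum[OF lf.subspace_R] lf.R_scale) auto
    have "v - ?s \<in> W p" if p: "p \<in> chart" for p
    proof (cases "p \<in> support W")
      case True
      have "(v - (\<Sum>b\<in>B p. scale_fract (c p b) b)) - (?s - (\<Sum>b\<in>B p. scale_fract (c p b) b)) \<in> W p"
        using local_sum[OF True, of "\<lambda>x. c (fst x) (snd x)"]
        by (intro fract_vs.subspace_diff[OF sub c[OF True]]) (simp only: fst_conv snd_conv)
      then show ?thesis by simp
    next
      case False
      then show ?thesis using sR R_subset_local_ring[OF p] unfolding support_def by blast
    qed
    then have "v - ?s \<in> affine_ideal W" using sR unfolding affine_ideal_def by blast
    then show "\<exists>c. v - (\<Sum>x\<in>J. scale_fract (c x) (e (fst x) (snd x))) \<in> affine_ideal W"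
      by (rule exI[of _ "\<lambda>x. c (fst x) (snd x)"])
  next
    fix c x assume s: "(\<Sum>x\<in>J. scale_fract (c x) (e (fst x) (snd x))) \<in> affine_ideal W" and x: "x \<in> J"
    then have p: "fst x \<in> support W" "snd x \<in> B (fst x)" unfolding J_def by auto
    let ?s = "\<Sum>x\<in>J. scale_fract (c x) (e (fst x) (snd x))"
    have "?s \<in> W (fst x)" using s p(1) supp unfolding affine_ideal_def by blast
    then have "?s - (?s - (\<Sum>b\<in>B (fst x). scale_fract (c (fst x, b)) b)) \<in> W (fst x)"
      by (rule fract_vs.subspace_diff[OF sub _ local_sum[OF p(1)]])
    then have "(\<Sum>b\<in>B (fst x). scale_fract (c (fst x, b)) b) \<in> W (fst x)" by simp
    from fract_ls.basis_mod_zero[OF bm this p(2)] show "c x = 0" by simp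
  qed
  then show ?thesis using that card_J by blast
qed

text \<open>Up to a factor that is a unit at \<open>p\<close>, each germ \<open>z\<close> in
  \<open>Z p\<close> comes from the affine ideal: clear its denominator and multiply by a function
  lying in the ideals at the other points of the support. So a colon condition tested on the affine
  ideal holds on the whole stalk.\<close>

lemma colon_local:
  assumes Z: "zero_dim_subscheme Z" and supp: "support Z \<subseteq> chart" and p: "p \<in> chart"
    and Q: "local_ideal p Q" and a: "a \<in> lf.R" "\<And>b. b \<in> affine_ideal Z \<Longrightarrow> a * b \<in> Q" and z: "z \<in> Z p"
  shows "a * z \<in> Q"
proof -
  have ideal: "local_ideal p (Z p)" and fin: "finite (support Z)" for p
    using Z unfolding zero_dim_subscheme_def by blast+
  have zO: "z \<in> local_ring p" using z ideal unfolding local_ideal_def by blast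
  then obtain A B n where AB: "z = Fract A B" "form n A" "form n B" "value_at B p \<noteq> 0"
    unfolding local_ring_iff has_value_def by blast
  obtain u c where u: "u \<in> lf.R" "\<forall>q\<in>support Z - {p}. u \<in> Z q" "has_value p u c" "c \<noteq> 0"
    using unit_vanishing_elsewhere[OF Z p, of "support Z - {p}"] fin supp by auto
  have R: "frac n A \<in> lf.R" "frac n B \<in> lf.R" using AB unfolding R_iff by blast+
  have eq: "frac n A = frac n B * z"
    using AB(1) at_nonzero[OF AB(4)] by (simp add: frac_def eq_fract)
  have Ap: "frac n A \<in> Z p"
    unfolding eq using local_ideal_mult[OF ideal _ z] R(2) R_subset_local_ring[OF p] by blast
  have uA: "u * frac n A \<in> lf.R" using lf.R_mult u(1) R(1) by blast
  have "u * frac n A \<in> Z q" if q: "q \<in> chart" for q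
  proof -
    consider "q = p" | "q \<in> support Z - {p}" | "q \<notin> support Z" by blast
    then show ?thesis
    proof cases
      case 1
      then show ?thesis using local_ideal_mult[OF ideal _ Ap] u(1) R_subset_local_ring[OF p] by blast
    next
      case 2
      then have "frac n A * u \<in> Z q"
        using local_ideal_mult[OF ideal, of "frac n A" q u] u(2) R(1) R_subset_local_ring[OF q] by blast
      then show ?thesis by (simp only: mult.commute)
    next
      case 3
      then show ?thesis using uA R_subset_local_ring[OF q] unfolding support_def by blast
    qed
  qed
  then have "a * (u * frac n A) \<in> Q" using a(2) uA unfolding affine_ideal_def by blast
  moreover have "a * (u * frac n A) = (u * frac n B) * (a * z)" unfolding eq by (simp only: ac_simps)
  moreover have "has_value p (u * frac n B) (c * (value_at B p / value_at l p ^ n))"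
    using has_value_mult[OF u(3) has_value_frac[OF p AB(3)]] .
  moreover have "c * (value_at B p / value_at l p ^ n) \<noteq> 0" using u(4) AB(4) p by (simp add: chart_def)
  ultimately show ?thesis using local_ideal_unit[OF Q] by metis
qed

end


section \<open>Global sections and liaison\<close>

definition low_degree :: "nat \<Rightarrow> cpoly \<Rightarrow> bool" where
  "low_degree b F \<longleftrightarrow> (\<forall>m\<in>Poly_Mapping.keys F. Poly_Mapping.lookup m 1 < b)"

lemma low_degree_add: "low_degree b F \<Longrightarrow> low_degree b G \<Longrightarrow> low_degree b (F + G)"
  using keys_add[of F G] unfolding low_degree_def by blast

text \<open>At \<open>[1:0:0]\<close> a form of degree \<open>b\<close> takes its coefficient of the
  power \<open>X 1 ^ b\<close> as value, so not vanishing there makes it monic in \<open>X 1\<close>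
  up to a constant.\<close>

lemma monic_split:
  assumes "form b B" "eval_poly B (axis 1 1) \<noteq> 0"
  obtains \<kappa> B' where "\<kappa> \<noteq> 0" "B = Poly_Mapping.single (Poly_Mapping.single 1 b) \<kappa> + B'"
    "form b B'" "low_degree b B'"
proof -
  let ?m = "Poly_Mapping.single 1 b :: 3 \<Rightarrow>\<^sub>0 nat"
  define \<kappa> where "\<kappa> = Poly_Mapping.lookup B ?m"
  define B' where "B' = B - Poly_Mapping.single ?m \<kappa>"
  have B': "form b B'" unfolding B'_def using assms(1) by (intro form_diff form_single) auto
  have low: "low_degree b B'"
    unfolding low_degree_def
  proof
    fix m assume m: "m \<in> Poly_Mapping.keys B'"
    have "m \<noteq> ?m" using m by (auto simp: in_keys_iff B'_def \<kappa>_def lookup_minus)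
    have deg: "Poly_Mapping.lookup m 1 + Poly_Mapping.lookup m 2 + Poly_Mapping.lookup m 3 = b"
      using B' m mdeg_3[of m] unfolding form_iff by auto
    show "Poly_Mapping.lookup m 1 < b"
    proof (rule ccontr)
      assume "\<not> ?thesis"
      then have 1: "Poly_Mapping.lookup m 1 = b" "Poly_Mapping.lookup m 2 = 0" "Poly_Mapping.lookup m 3 = 0"
        using deg by auto
      have "m = ?m"
      proof (rule poly_mapping_eqI)
        show "Poly_Mapping.lookup m i = Poly_Mapping.lookup ?m i" for i
          using exhaust_3[of i] 1 by (auto simp: lookup_single)
      qed
      then show False using \<open>m \<noteq> ?m\<close> by blast
    qed
  qed
  have "eval_poly B' (axis 1 1) = 0"
    unfolding eval_poly_def
  proof (rule sum.neutral, rule ballI)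
    fix m assume m: "m \<in> Poly_Mapping.keys B'"
    have "Poly_Mapping.lookup m 1 < b" using low m unfolding low_degree_def by blast
    then have "Poly_Mapping.lookup m 2 > 0 \<or> Poly_Mapping.lookup m 3 > 0"
      using B' m mdeg_3[of m] unfolding form_iff by auto
    then show "Poly_Mapping.lookup B' m * (\<Prod>i\<in>UNIV. (axis 1 1 :: complex ^ 3) $ i ^ Poly_Mapping.lookup m i) = 0"
      by (auto simp: prod_UNIV_3 axis_def)
  qed
  then have "eval_poly B (axis 1 1) = eval_poly (Poly_Mapping.single ?m \<kappa>) (axis 1 1)"
    unfolding B'_def by simp
  then have "\<kappa> \<noteq> 0" using assms(2) by (auto simp: eval_poly_single)
  moreover have "B = Poly_Mapping.single ?m \<kappa> + B'" unfolding B'_def by simp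
  ultimately show ?thesis using that B' low by blast
qed

text \<open>Long division in \<open>X 1\<close>, carried out one monomial at a time in order to keep
  all pieces homogeneous; the induction is on a bound for the exponent of
  \<open>X 1\<close>.\<close>

lemma division_monic:
  assumes B: "form b B" "eval_poly B (axis 1 1) \<noteq> 0" and A: "form a A"
  obtains Q R where "A = Q * B + R" "form (a - b) Q" "low_degree b R" "form a R"
proof -
  obtain \<kappa> B' where B': "\<kappa> \<noteq> 0" "B = Poly_Mapping.single (Poly_Mapping.single 1 b) \<kappa> + B'"
      "form b B'" "low_degree b B'"
    using monic_split[OF B] by blast
  define Good where "Good F \<longleftrightarrow> (\<exists>Q R. F = Q * B + R \<and> form (a - b) Q \<and> low_degree b R \<and> form a R)" for F
  have Good_add: "Good (F + G)" if FG: "Good F" "Good G" for F G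
  proof -
    obtain Q R Q' R' where *: "F = Q * B + R" "form (a - b) Q" "low_degree b R" "form a R"
      "G = Q' * B + R'" "form (a - b) Q'" "low_degree b R'" "form a R'"
      using FG unfolding Good_def by blast
    have "F + G = (Q + Q') * B + (R + R')" using * by (simp add: algebra_simps)
    then show ?thesis using * form_add low_degree_add unfolding Good_def by blast
  qed
  have "form a F \<Longrightarrow> low_degree n F \<Longrightarrow> Good F" for n F
  proof (induction n arbitrary: F)
    case 0
    then have "Poly_Mapping.keys F = {}" unfolding low_degree_def by auto
    then have "F = 0 * B + 0" by (simp add: keys_eq_empty)
    then show ?case unfolding Good_def low_degree_def by (metis form_0 keys_zero empty_iff)
  next
    case (Suc n)
    show ?case
    proof (induction F rule: cpoly_induct)
      case zero
      show ?case unfolding Good_def low_degree_def by (intro exI[of _ 0]) simp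
    next
      case (single m c)
      have m: "mdeg m = a" "Poly_Mapping.lookup m 1 \<le> n"
        using single Suc.prems unfolding form_iff low_degree_def by auto
      show ?case
      proof (cases "Poly_Mapping.lookup m 1 < b")
        case True
        then have "low_degree b (Poly_Mapping.single m c)" unfolding low_degree_def by simp
        moreover have "form a (Poly_Mapping.single m c)" using m form_single by blast
        ultimately show ?thesis unfolding Good_def by (metis form_0 add_0 mult_zero_left)
      next
        case False
        define m' where "m' = m - Poly_Mapping.single 1 b"
        have mm': "m = m' + Poly_Mapping.single 1 b"
        proof (rule poly_mapping_eqI)
          show "Poly_Mapping.lookup m i = Poly_Mapping.lookup (m' + Poly_Mapping.single 1 b) i" for i
            using False by (auto simp: m'_def lookup_add lookup_minus lookup_single when_def)
        qed
        define M where "M = Poly_Mapping.single m' (c / \<kappa>)"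
        have deg: "a = mdeg m' + b" using m(1) unfolding mm' by simp
        have M: "form (a - b) M" unfolding M_def by (rule form_single) (use deg in simp)
        have eq: "Poly_Mapping.single m c = M * B + - (M * B')"
          using B'(1) unfolding B'(2) M_def mm' distrib_left mult_single by simp
        have fM: "form a (- (M * B'))"
          using form_mult[OF M B'(3)] deg by (intro form_uminus) simp
        have "low_degree n (- (M * B'))"
          unfolding low_degree_def
        proof
          fix k assume "k \<in> Poly_Mapping.keys (- (M * B'))"
          then have "k \<in> Poly_Mapping.keys (M * B')" by simp
          then obtain k1 k2 where k: "k = k1 + k2" "k1 \<in> Poly_Mapping.keys M" "k2 \<in> Poly_Mapping.keys B'"
            using keys_mult[of M B'] by blast
          have "k1 = m'" using k(2) unfolding M_def by (auto split: if_splits)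
          moreover have "Poly_Mapping.lookup k2 1 < b" using k(3) B'(4) unfolding low_degree_def by blast
          moreover have "Poly_Mapping.lookup m' 1 + b \<le> n" using m(2) unfolding mm' by (simp add: lookup_add)
          ultimately show "Poly_Mapping.lookup k 1 < n" unfolding k(1) by (simp add: lookup_add)
        qed
        then have "Good (- (M * B'))" using Suc.IH fM by blast
        moreover have "Good (M * B)" using M unfolding Good_def low_degree_def
          by (intro exI[of _ M] exI[of _ 0]) simp
        ultimately show ?thesis unfolding eq by (intro Good_add)
      qed
    next
      case (add G H)
      then show ?case by (rule Good_add)
    qed
  qed
  moreover have "low_degree (a + 1) A"
    unfolding low_degree_def
  proof
    fix m assume "m \<in> Poly_Mapping.keys A"
    then have "mdeg m = a" using A unfolding form_iff by blast
    then show "Poly_Mapping.lookup m 1 < a + 1" using mdeg_3[of m] by simp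
  qed
  ultimately have "Good A" using A by blast
  then show ?thesis using that unfolding Good_def by blast
qed

text \<open>After removing the common divisor, a root of what is left of \<open>B\<close> would by
  the local equation also be a root of what is left of \<open>A\<close>.\<close>

lemma dvd_from_local:
  fixes A B :: "complex poly"
  assumes "B \<noteq> 0" "\<And>x. poly B x = 0 \<Longrightarrow> \<exists>A' B'. A * B' = A' * B \<and> poly B' x \<noteq> 0"
  shows "B dvd A"
proof -
  define g where "g = gcd B A"
  have g: "g \<noteq> 0" using assms(1) unfolding g_def by simp
  obtain b a where ab: "B = b * g" "A = a * g" "coprime b a"
    using gcd_coprime_exists[of B A] g unfolding g_def by blast
  have "degree b = 0"
  proof (rule ccontr)
    assume "degree b \<noteq> 0"
    then obtain x where x: "poly b x = 0"
      using fundamental_theorem_of_algebra[of b] by (auto simp: constant_degree)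
    then obtain A' B' where *: "A * B' = A' * B" "poly B' x \<noteq> 0" using assms(2)[of x] ab(1) by auto
    have "(a * B') * g = (A' * b) * g" using *(1) unfolding ab(1,2) by (simp add: ac_simps)
    then have "a * B' = A' * b" using g by simp
    then have "poly a x * poly B' x = 0" using x by (metis poly_mult mult_zero_right)
    then have "poly a x = 0" using *(2) by simp
    then have "[:- x, 1:] dvd a" "[:- x, 1:] dvd b" using x by (simp_all add: poly_eq_0_iff_dvd)
    then have "is_unit [:- x, 1:]" using ab(3) coprime_common_divisor by blast
    then show False by (simp add: is_unit_iff_degree)
  qed
  then have "is_unit b" using assms(1) ab(1) by (simp add: is_unit_iff_degree)
  then show ?thesis unfolding ab(1,2) by (metis dvd_refl mult_unit_dvd_iff' dvd_triv_right)
qed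

text \<open>Restricting to the lines through \<open>[1:0:0]\<close> reduces the claim to one variable: there a
  fraction without poles is a polynomial, so the remainder of the division vanishes on all these lines.\<close>

lemma regular_section_is_form:
  assumes "\<And>p. s \<in> stalk (int k) p"
  obtains H where "form k H" "s = Fract H 1"
proof -
  \<comment> \<open>The representation of \<open>s\<close> at \<open>[1:0:0]\<close> is singled out
    because its denominator is monic in \<open>X 1\<close> up to a constant.\<close>
  have "(axis 1 1 :: complex ^ 3) \<noteq> 0" by (simp add: axis_eq_0_iff)
  then obtain p c where p: "c \<noteq> 0" "rep p = c *s axis 1 1" by (rule ex_point)
  obtain A B a b where AB: "s = Fract A B" "form a A" "form b B" "int a - int b = int k" "value_at B p \<noteq> 0"
    using assms[of p] unfolding stalk_iff by blast
  have B: "eval_poly B (axis 1 1) \<noteq> 0" using AB(5) eval_poly_scale[OF AB(3)] unfolding p(2) by auto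
  obtain Q R where QR: "A = Q * B + R" "form (a - b) Q" "low_degree b R" "form a R"
    by (rule division_monic[OF AB(3) B AB(2)])
  have "R = 0"
  proof (rule ccontr)
    assume "R \<noteq> 0"
    \<comment> \<open>This picks a line through \<open>[1:0:0]\<close> on which the remainder does
      not vanish. Since \<open>x\<close> is nonzero so is \<open>y\<close>, and
      \<open>(t, y, z)\<close> is a point of the plane for every \<open>t\<close>.\<close>
    with QR(4) obtain x where x: "x \<noteq> 0"
      "eval_poly R (\<chi> i. if i = 1 then x else if i = 2 then x ^ (a + 1) else x ^ ((a + 1) * (a + 1))) \<noteq> 0"
      by (rule eval_poly_Kronecker)
    define y where "y = x ^ (a + 1)"
    define z where "z = x ^ ((a + 1) * (a + 1))"
    have yz: "y \<noteq> 0" "z \<noteq> 0" using x(1) unfolding y_def z_def by auto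
    define u where "u = poly_subst (\<lambda>i. if i = 1 then [:0, 1:] else if i = 2 then [:y:] else [:z:])"
    have poly_u: "poly (u F) t = eval_poly F (\<chi> i. if i = 1 then t else if i = 2 then y else z)" for F t
      unfolding u_def poly_poly_subst by (intro arg_cong[of _ _ "eval_poly F"]) (simp add: vec_eq_iff)
    have u_mult: "u (F * G) = u F * u G" and u_add: "u (F + G) = u F + u G" for F G
      unfolding u_def by simp_all
    have u_single: "u (Poly_Mapping.single m e) = monom (e * y ^ Poly_Mapping.lookup m 2 * z ^ Poly_Mapping.lookup m 3) (Poly_Mapping.lookup m 1)" for m e
      unfolding u_def poly_subst_single prod_UNIV_3
      by (simp add: monom_altdef poly_const_pow ac_simps)
    have coeff_low: "coeff (u F) i = 0" if "low_degree b F" "i \<ge> b" for F i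
    proof -
      have "u F = (\<Sum>m\<in>Poly_Mapping.keys F. u (Poly_Mapping.single m (Poly_Mapping.lookup F m)))"
        unfolding u_def by (subst (1) cpoly_sum_monomials) (rule poly_subst_sum)
      also have "coeff \<dots> i = 0"
        unfolding coeff_sum u_single using that by (intro sum.neutral) (auto simp: low_degree_def)
      finally show ?thesis .
    qed
    obtain \<kappa> B' where B': "\<kappa> \<noteq> 0" "B = Poly_Mapping.single (Poly_Mapping.single 1 b) \<kappa> + B'"
        "low_degree b B'"
      using monic_split[OF AB(3) B] by blast
    have "coeff (u B) b = \<kappa>"
      unfolding B'(2) u_add coeff_add coeff_low[OF B'(3) order_refl] u_single
      by (simp add: lookup_single)
    then have uB: "u B \<noteq> 0" "b \<le> degree (u B)" using B'(1) by (auto intro: le_degree)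
    have "u B dvd u A"
    proof (rule dvd_from_local[OF uB(1)])
      fix t assume "poly (u B) t = 0"
      let ?v = "(\<chi> i. if i = 1 then t else if i = 2 then y else z) :: complex ^ 3"
      have "?v $ 2 \<noteq> 0" using yz by simp
      then have "?v \<noteq> 0" by (metis zero_index)
      then obtain q e where q: "e \<noteq> 0" "rep q = e *s ?v" by (rule ex_point)
      obtain A' B' a' b' where *: "s = Fract A' B'" "form b' B'" "value_at B' q \<noteq> 0"
        using assms[of q] unfolding stalk_iff by blast
      have "A * B' = A' * B" using AB(1) * at_nonzero[OF AB(5)] at_nonzero[OF *(3)] by (simp add: eq_fract)
      then have "u A * u B' = u A' * u B" using u_mult by metis
      moreover have "poly (u B') t \<noteq> 0"
        using *(3) eval_poly_scale[OF *(2), of e ?v] unfolding q(2) poly_u by auto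
      ultimately show "\<exists>A' B'. u A * B' = A' * u B \<and> poly B' t \<noteq> 0" by blast
    qed
    \<comment> \<open>The degree of \<open>u B\<close> is at least \<open>b\<close>, while the
      remainder has degree below \<open>b\<close> in \<open>X 1\<close>; so it would vanish on this
      line.\<close>
    then have "u B dvd u R" unfolding QR(1) u_add u_mult by (simp add: dvd_add_right_iff)
    moreover have "poly (u R) x \<noteq> 0" using x(2) unfolding poly_u y_def z_def .
    ultimately have "degree (u B) \<le> degree (u R)" by (intro dvd_imp_degree_le) auto
    then have "coeff (u R) (degree (u R)) = 0" using coeff_low[OF QR(3)] uB(2) by simp
    then show False using \<open>poly (u R) x \<noteq> 0\<close> by simp
  qed
  then have "s = Fract Q 1" using AB(1) QR(1) at_nonzero[OF AB(5)] by (simp add: eq_fract)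
  moreover have "a - b = k" using AB(4) by simp
  ultimately show ?thesis using that QR(2) by blast
qed

section \<open>Sections and curves in terms of the chart\<close>

context affine_chart
begin

lemma twisted_stalk_subset:
  assumes "local_ideal p (W p)"
  shows "twisted_stalk W n p \<subseteq> stalk n p"
proof
  fix x assume "x \<in> twisted_stalk W n p"
  then obtain a s where x: "x = a * s" "a \<in> local_ring p" "s \<in> stalk n p"
    using assms unfolding twisted_stalk_def local_ideal_def by blast
  obtain A B b where 1: "a = Fract A B" "form b A" "form b B" "value_at B p \<noteq> 0"
    using x(2) unfolding local_ring_iff has_value_def by blast
  obtain C D c d where 2: "s = Fract C D" "form c C" "form d D" "int c - int d = n" "value_at D p \<noteq> 0"
    using x(3) unfolding stalk_iff by blast
  have "x = Fract (A * C) (B * D)" "form (b + c) (A * C)" "form (b + d) (B * D)"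
    "int (b + c) - int (b + d) = n" "value_at (B * D) p \<noteq> 0"
    using x(1) 1 2 form_mult by auto
  then show "x \<in> stalk n p" unfolding stalk_iff by blast
qed

lemma stalk_shift:
  assumes "p \<in> chart" "s \<in> stalk (int n) p"
  shows "Fract 1 (l ^ n) * s \<in> local_ring p"
proof -
  obtain A B a b where *: "s = Fract A B" "form a A" "form b B" "int a - int b = int n" "value_at B p \<noteq> 0"
    using assms(2) unfolding stalk_iff by blast
  have "a = n + b" using *(4) by simp
  then have "form a (l ^ n * B)" using form_mult[OF form_l_power *(3)] by simp
  moreover have "value_at (l ^ n * B) p \<noteq> 0" using assms(1) *(5) by (simp add: chart_def)
  moreover have "Fract 1 (l ^ n) * s = Fract A (l ^ n * B)" using *(1) by simp
  ultimately show ?thesis using has_value_local[OF has_valueI[OF *(2)]] by metis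
qed

lemma l_power_in_stalk: "Fract (l ^ n) 1 \<in> stalk (int n) p"
  unfolding stalk_iff by (intro exI[of _ "l ^ n"] exI[of _ 1] exI[of _ n] exI[of _ 0]) (simp add: form_l_power)

lemma Fract_l_power: "Fract 1 (l ^ n) * Fract (l ^ n) 1 = 1" "Fract (l ^ n) 1 * Fract 1 (l ^ n) = 1"
  by (simp_all add: One_fract_def eq_fract)

lemma frac_eq: "frac n H = Fract 1 (l ^ n) * Fract H 1"
  by (simp add: frac_def)

text \<open>A section is a form \<open>H\<close> of degree \<open>n\<close>, and on the chart
  \<open>l ^ n\<close> trivializes the line bundle, so the conditions there concern
  \<open>H / l ^ n\<close>. Off the chart the ideal is the whole local ring and imposes
  nothing.\<close>

lemma global_sections_eq:
  assumes W: "zero_dim_subscheme W" and supp: "support W \<subseteq> chart"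
  shows "global_sections W (int n) = (*) (Fract (l ^ n) 1) ` (affine_ideal W \<inter> P (int n))"
proof (intro equalityI subsetI)
  have ideal: "local_ideal p (W p)" for p using W unfolding zero_dim_subscheme_def by blast
  {
    fix s assume s: "s \<in> global_sections W (int n)"
    have "s \<in> stalk (int n) q" for q
      using subsetD[OF twisted_stalk_subset[of q W, OF ideal]] s by (simp add: global_sections_def)
    then obtain H where H: "form n H" "s = Fract H 1" using regular_section_is_form by blast
    have "frac n H \<in> W p" if p: "p \<in> chart" for p
    proof -
      obtain a t where at: "s = a * t" "a \<in> W p" "t \<in> stalk (int n) p"
        using s unfolding global_sections_def twisted_stalk_def by blast
      have "(Fract 1 (l ^ n) * t) * a \<in> W p"
        using local_ideal_mult[OF ideal stalk_shift[OF p at(3)] at(2)] .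
      then show ?thesis using at(1) H(2) unfolding frac_eq by (simp only: ac_simps)
    qed
    then have "frac n H \<in> affine_ideal W \<inter> P (int n)"
      using H(1) unfolding affine_ideal_def R_iff P_nat by blast
    moreover have "s = Fract (l ^ n) 1 * frac n H" unfolding H(2) frac_eq mult.assoc[symmetric] Fract_l_power by simp
    ultimately show "s \<in> (*) (Fract (l ^ n) 1) ` (affine_ideal W \<inter> P (int n))" by blast
  next
    fix s assume "s \<in> (*) (Fract (l ^ n) 1) ` (affine_ideal W \<inter> P (int n))"
    then obtain H where H: "form n H" "frac n H \<in> affine_ideal W" "s = Fract (l ^ n) 1 * frac n H"
      unfolding P_nat by blast
    have sH: "s = Fract H 1" unfolding H(3) frac_eq mult.assoc[symmetric] Fract_l_power by simp
    have "s \<in> twisted_stalk W (int n) p" for p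
    proof (cases "p \<in> chart")
      case True
      then have "frac n H \<in> W p" using H(2) unfolding affine_ideal_def by blast
      moreover have "s = frac n H * Fract (l ^ n) 1" unfolding H(3) by (rule mult.commute)
      ultimately show ?thesis using l_power_in_stalk[of n p] unfolding twisted_stalk_def by blast
    next
      case False
      then have "1 \<in> W p" using supp local_ring_1[of p] unfolding support_def by blast
      moreover have "s \<in> stalk (int n) p"
        unfolding stalk_iff sH using H(1) by (intro exI[of _ H] exI[of _ 1] exI[of _ n] exI[of _ 0]) simp
      ultimately show ?thesis unfolding twisted_stalk_def by (metis (mono_tags, lifting) mem_Collect_eq mult_1)
    qed
    then show "s \<in> global_sections W (int n)" unfolding global_sections_def by blast
  }
qed

lemma h0_eq:
  assumes "zero_dim_subscheme W" "support W \<subseteq> chart"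
  shows "h0 W (int n) = fract_vs.dim (affine_ideal W \<inter> P (int n))"
  unfolding h0_def global_sections_eq[OF assms]
proof (rule fract_ls.dim_injective_image)
  show "fract_vs.subspace (affine_ideal W \<inter> P (int n))"
    using subspace_affine_ideal[OF assms(1)] lf.subspace_P by (rule fract_vs.subspace_inter)
  show "fract_ls.finite_dim (affine_ideal W \<inter> P (int n))"
    using fract_ls.finite_dim_mono[OF Int_lower2 lf.dim_P(1)] .
  show "Fract (l ^ n) 1 * (x + y) = Fract (l ^ n) 1 * x + Fract (l ^ n) 1 * y" for x y
    by (rule distrib_left)
  show "Fract (l ^ n) 1 * scale_fract c x = scale_fract c (Fract (l ^ n) 1 * x)" for c x
    by (rule lf.scale_mult_right)
  show "x = 0" if "Fract (l ^ n) 1 * x = 0" for x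
  proof -
    have "Fract 1 (l ^ n) * (Fract (l ^ n) 1 * x) = 0" unfolding that by simp
    then show ?thesis unfolding mult.assoc[symmetric] Fract_l_power by simp
  qed
qed

text \<open>On the chart the twist is trivialized by \<open>l ^ d\<close>, which turns the ideal of
  the curve into a principal one, generated by \<open>F / l ^ d\<close>.\<close>

lemma curve_ideal_eq:
  assumes "p \<in> chart"
  shows "curve_ideal d F p = {frac d F * a | a. a \<in> local_ring p}"
proof (intro equalityI subsetI)
  fix x assume "x \<in> curve_ideal d F p"
  then obtain s where s: "x = Fract F 1 * s" "s \<in> stalk (- int d) p" unfolding curve_ideal_def by blast
  obtain A B a b where *: "s = Fract A B" "form a A" "form b B" "int a - int b = - int d" "value_at B p \<noteq> 0"
    using s(2) unfolding stalk_iff by blast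
  have "b = d + a" using *(4) by simp
  then have "form b (l ^ d * A)" using form_mult[OF form_l_power *(2)] by simp
  then have "Fract (l ^ d * A) B \<in> local_ring p"
    using has_value_local[OF has_valueI[OF _ *(3,5)]] by blast
  moreover have "x = frac d F * Fract (l ^ d * A) B"
    using s(1) *(1) at_nonzero[OF *(5)] by (simp add: frac_def eq_fract)
  ultimately show "x \<in> {frac d F * a | a. a \<in> local_ring p}" by blast
next
  fix x assume "x \<in> {frac d F * a | a. a \<in> local_ring p}"
  then obtain a where a: "x = frac d F * a" "a \<in> local_ring p" by blast
  obtain A B b where *: "a = Fract A B" "form b A" "form b B" "value_at B p \<noteq> 0"
    using a(2) unfolding local_ring_iff has_value_def by blast
  have "x = Fract F 1 * Fract A (l ^ d * B)" using a(1) *(1) by (simp add: frac_def)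
  moreover have "Fract A (l ^ d * B) \<in> stalk (- int d) p"
    unfolding stalk_iff using * assms form_mult[OF form_l_power *(3), of d]
    by (intro exI[of _ A] exI[of _ "l ^ d * B"] exI[of _ b] exI[of _ "d + b"]) (simp add: chart_def)
  ultimately show "x \<in> curve_ideal d F p" unfolding curve_ideal_def by blast
qed

lemma intersection_curves_eq:
  assumes "p \<in> chart"
  shows "intersection_ideal (curve_ideal d F) (curve_ideal d G) p =
    {a * frac d F + b * frac d G | a b. a \<in> local_ring p \<and> b \<in> local_ring p}"
  unfolding intersection_ideal_def curve_ideal_eq[OF assms] by (auto simp: mult.commute)

lemma poly_res: "poly (res F) s = eval_poly F (\<chi> i. if i = 1 then s else if i = 2 then 1 else \<alpha> * s + \<beta>)"
  unfolding res_def poly_poly_subst by (intro arg_cong[of _ _ "eval_poly F"]) (simp add: vec_eq_iff)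

text \<open>The top coefficient is the value at the point \<open>[1:0:\<alpha>]\<close> of the line,
  the one with infinite parameter.\<close>

lemma coeff_res:
  assumes "form d F"
  shows "coeff (res F) d = eval_poly F (\<chi> i. if i = 1 then 1 else if i = 2 then 0 else \<alpha>)"
  using assms
proof (induction F rule: form_monomial_induct)
  case (monomial a b c)
  have deg: "degree ([:0, 1:] ^ a * [:\<beta>, \<alpha>:] ^ c) \<le> a + c"
    using degree_res[OF form_monomial[of a 0 c]] by simp
  have "coeff ([:0, 1:] ^ a * [:\<beta>, \<alpha>:] ^ c) (a + c) = \<alpha> ^ c"
  proof (induction c)
    case 0
    then show ?case using coeff_monom[of "1 :: complex" a a] by (simp add: monom_altdef)
  next
    case (Suc c)
    have "degree ([:0, 1:] ^ a * [:\<beta>, \<alpha>:] ^ c) \<le> a + c"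
      using degree_res[OF form_monomial[of a 0 c]] by simp
    then have z: "coeff ([:0, 1:] ^ a * [:\<beta>, \<alpha>:] ^ c) (Suc (a + c)) = 0" by (simp add: coeff_eq_0)
    have "[:0, 1:] ^ a * [:\<beta>, \<alpha>:] ^ Suc c =
        smult \<beta> ([:0, 1:] ^ a * [:\<beta>, \<alpha>:] ^ c) + pCons 0 (smult \<alpha> ([:0, 1:] ^ a * [:\<beta>, \<alpha>:] ^ c))"
    proof -
      have "[:\<beta>, \<alpha>:] ^ Suc c = smult \<beta> ([:\<beta>, \<alpha>:] ^ c) + pCons 0 (smult \<alpha> ([:\<beta>, \<alpha>:] ^ c))"
        by simp
      then show ?thesis by (simp only: distrib_left mult_smult_right mult_pCons_right smult_0_left add_0)
    qed
    then show ?case using z Suc.IH by (simp only: coeff_add coeff_smult add_Suc_right coeff_pCons_Suc power_Suc) simp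
  qed
  then show ?case using monomial deg by (cases b) (auto simp: coeff_eq_0)
qed simp_all

lemma has_value_curve:
  assumes "form d F" "value_at F p = 0" "s \<in> stalk (- int d) p"
  shows "has_value p (Fract F 1 * s) 0"
proof -
  obtain A B a b where *: "s = Fract A B" "form a A" "form b B" "int a - int b = - int d" "value_at B p \<noteq> 0"
    using assms(3) unfolding stalk_iff by blast
  have "b = d + a" using *(4) by simp
  then have "form b (F * A)" using form_mult[OF assms(1) *(2)] by simp
  from has_valueI[OF this *(3,5)] show ?thesis using *(1) assms(2) by simp
qed

text \<open>Outside both supports, 1 lies in \<open>Z p\<close> and in its colon ideal, hence in the
  ideal generated by the two curves. At a common zero every element of that ideal has value
  0.\<close>

lemma no_common_zero:
  assumes F: "form d F" and G: "form d G"
    and Z: "local_ideal p (Z p)" "p \<notin> support Z"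
    and Z': "p \<notin> support (colon_ideal (intersection_ideal (curve_ideal d F) (curve_ideal d G)) Z)"
  shows "value_at F p \<noteq> 0 \<or> value_at G p \<noteq> 0"
proof (rule ccontr)
  assume neg: "\<not> ?thesis"
  have "1 \<in> Z p" using Z(2) local_ring_1 unfolding support_def by blast
  moreover have "1 \<in> colon_ideal (intersection_ideal (curve_ideal d F) (curve_ideal d G)) Z p"
    using Z' local_ring_1 unfolding support_def by blast
  ultimately have "1 * 1 \<in> intersection_ideal (curve_ideal d F) (curve_ideal d G) p"
    unfolding colon_ideal_def by blast
  then obtain s t where st: "1 * 1 = Fract F 1 * s + Fract G 1 * t" "s \<in> stalk (- int d) p" "t \<in> stalk (- int d) p"
    unfolding intersection_ideal_def curve_ideal_def by blast
  have "has_value p (Fract F 1 * s + Fract G 1 * t) (0 + 0)"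
    using neg has_value_curve F G st by (intro has_value_add) auto
  then have "has_value p 1 0" unfolding st(1)[symmetric] by simp
  then show False using has_value_unique has_value_1 by fastforce
qed

lemma point_at_infinity:
  assumes "v \<noteq> 0" "eval_poly l v = 0"
  obtains p where "p \<notin> chart" "\<forall>d F. form d F \<longrightarrow> (value_at F p = 0 \<longleftrightarrow> eval_poly F v = 0)"
proof -
  obtain p c where p: "c \<noteq> 0" "rep p = c *s v" using assms(1) by (rule ex_point)
  have v: "value_at F p = 0 \<longleftrightarrow> eval_poly F v = 0" if "form d F" for d F
    unfolding p(2) eval_poly_scale[OF that] using p(1) by simp
  moreover have "p \<notin> chart" using v[OF form_l] assms(2) unfolding chart_def by simp
  ultimately show ?thesis using that by blast
qed

lemma coprime_no_common_root:
  fixes a b :: "complex poly"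
  assumes "a \<noteq> 0" "\<And>x. poly a x = 0 \<Longrightarrow> poly b x \<noteq> 0"
  shows "coprime a b"
proof (rule coprimeI)
  fix c assume c: "c dvd a" "c dvd b"
  have "c \<noteq> 0" using c(1) assms(1) by auto
  moreover have "degree c = 0"
  proof (rule ccontr)
    assume "degree c \<noteq> 0"
    then obtain x where "poly c x = 0"
      using fundamental_theorem_of_algebra[of c] by (auto simp: constant_degree)
    then have "poly a x = 0" "poly b x = 0" using c by (auto elim!: dvdE)
    then show False using assms(2) by blast
  qed
  ultimately show "is_unit c" by (simp add: is_unit_iff_degree)
qed

text \<open>\<open>F_inf\<close> supplies the full degree of the leading polynomial of
  \<open>f\<close>. Coprimality follows since a common root of the restrictions would be a common
  zero on the line, where neither support has a point.\<close>

lemma h0_residual: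
  fixes F G :: cpoly and r :: nat
  defines "XY \<equiv> intersection_ideal (curve_ideal (r + 1) F) (curve_ideal (r + 1) G)"
  assumes r: "r \<ge> 1" and F: "form (r + 1) F" and G: "form (r + 1) G"
    and Z: "zero_dim_subscheme Z" "2 * scheme_length Z = r * (r + 1)" "support Z \<subseteq> chart"
    and Z': "zero_dim_subscheme Z'" "2 * scheme_length Z' = (r + 1) * (r + 2)" "support Z' \<subseteq> chart"
    and XY: "\<And>p. XY p \<subseteq> Z p" and colon: "Z' = colon_ideal XY Z"
    and F_inf: "eval_poly F (\<chi> i. if i = 1 then 1 else if i = 2 then 0 else \<alpha>) \<noteq> 0"
  shows "h0 Z (int r - 1) = h0 Z' (int r)"
proof -
  let ?d = "r + 1"
  let ?f = "frac ?d F" and ?g = "frac ?d G"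
  have idealZ: "local_ideal p (Z p)" for p using Z(1) unfolding zero_dim_subscheme_def by blast
  have infinity: "value_at F p \<noteq> 0 \<or> value_at G p \<noteq> 0" if "p \<notin> chart" for p
  proof (rule no_common_zero[OF F G idealZ])
    show "p \<notin> support Z" using that Z(3) by blast
    show "p \<notin> support (colon_ideal (intersection_ideal (curve_ideal ?d F) (curve_ideal ?d G)) Z)"
      using that Z'(3) unfolding colon XY_def by blast
  qed
  have coeff_F: "coeff (res F) ?d \<noteq> 0" using coeff_res[OF F] F_inf by simp
  have coprime: "coprime (res F) (res G)"
  proof (rule coprime_no_common_root)
    show "res F \<noteq> 0" using coeff_F by auto
    show "poly (res G) s \<noteq> 0" if s: "poly (res F) s = 0" for s
    proof
      assume s': "poly (res G) s = 0"
      let ?v = "(\<chi> i. if i = 1 then s else if i = 2 then 1 else \<alpha> * s + \<beta>) :: complex ^ 3"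
      have "?v $ 2 \<noteq> 0" by simp
      then have "?v \<noteq> 0" by (metis zero_index)
      moreover have "eval_poly l ?v = 0" by (simp add: eval_l)
      ultimately obtain p where p: "p \<notin> chart"
          "\<forall>d F. form d F \<longrightarrow> (value_at F p = 0 \<longleftrightarrow> eval_poly F ?v = 0)"
        by (rule point_at_infinity)
      show False using infinity[OF p(1)] p(2) F G s s' unfolding poly_res by blast
    qed
  qed
  interpret ci: complete_intersection scale_fract P lead "int ?d" ?f ?g
  proof
    show "?f \<in> P (int ?d)" "?g \<in> P (int ?d)" using F G unfolding P_nat by blast+
    have "degree (res F) = ?d" using degree_res[OF F] le_degree[OF coeff_F] by simp
    then show "int (degree (lead (int ?d) ?f)) = int ?d" unfolding lead_frac by simp
    show "coprime (lead (int ?d) ?f) (lead (int ?d) ?g)" unfolding lead_frac by (rule coprime)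
  qed simp
  have XY_eq: "XY p = {a * ?f + b * ?g | a b. a \<in> local_ring p \<and> b \<in> local_ring p}" if "p \<in> chart" for p
    unfolding XY_def by (rule intersection_curves_eq[OF that])
  have FF_XY: "x \<in> XY p" if "x \<in> ci.FF" "p \<in> chart" for x p
    using that R_subset_local_ring[of p] unfolding ci.FF_def XY_eq[OF that(2)] by blast
  have XY_ideal: "local_ideal p (XY p)" if p: "p \<in> chart" for p
    unfolding local_ideal_def
  proof (intro conjI ballI)
    show "XY p \<subseteq> local_ring p" using XY[of p] idealZ[of p] unfolding local_ideal_def by blast
    show "0 \<in> XY p" unfolding XY_eq[OF p] using local_ring_0[of p] by force
    show "x + y \<in> XY p" if "x \<in> XY p" "y \<in> XY p" for x y
    proof -
      obtain a b a' b' where *: "x = a * ?f + b * ?g" "y = a' * ?f + b' * ?g"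
        "a \<in> local_ring p" "b \<in> local_ring p" "a' \<in> local_ring p" "b' \<in> local_ring p"
        using \<open>x \<in> XY p\<close> \<open>y \<in> XY p\<close> unfolding XY_eq[OF p] by blast
      have "x + y = (a + a') * ?f + (b + b') * ?g" unfolding *(1,2) by (simp add: algebra_simps)
      then show ?thesis unfolding XY_eq[OF p] using * local_ring_add by blast
    qed
    show "c * x \<in> XY p" if "c \<in> local_ring p" "x \<in> XY p" for c x
    proof -
      obtain a b where *: "x = a * ?f + b * ?g" "a \<in> local_ring p" "b \<in> local_ring p"
        using \<open>x \<in> XY p\<close> unfolding XY_eq[OF p] by blast
      have "c * x = (c * a) * ?f + (c * b) * ?g" unfolding *(1) by (simp add: algebra_simps)
      then show ?thesis unfolding XY_eq[OF p] using * that(1) local_ring_mult by blast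
    qed
  qed
  have FF_Z: "ci.FF \<subseteq> affine_ideal Z"
    using FF_XY XY ci.FF_subset_R unfolding affine_ideal_def by blast
  have FF_Z': "ci.FF \<subseteq> affine_ideal Z'"
  proof
    fix x assume x: "x \<in> ci.FF"
    have "x \<in> Z' p" if p: "p \<in> chart" for p
    proof -
      have xXY: "x \<in> XY p" using FF_XY[OF x p] .
      have "x * b \<in> XY p" if "b \<in> Z p" for b
      proof -
        have "b \<in> local_ring p" using that idealZ[of p] unfolding local_ideal_def by blast
        then have "b * x \<in> XY p" using local_ideal_mult[OF XY_ideal[OF p] _ xXY] by blast
        then show ?thesis by (simp only: mult.commute)
      qed
      moreover have "x \<in> local_ring p" using xXY XY_ideal[OF p] unfolding local_ideal_def by blast
      ultimately show ?thesis unfolding colon colon_ideal_def by blast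
    qed
    then show "x \<in> affine_ideal Z'" using x ci.FF_subset_R unfolding affine_ideal_def by blast
  qed
  \<comment> \<open>The assumption speaks of the affine ideal only, while membership in the residual
    stalk ranges over all of \<open>Z p\<close>; \<open>colon_local\<close> closes this gap.\<close>
  have colon_le: "a \<in> affine_ideal Z'"
    if a: "a \<in> lf.R" "\<And>b. b \<in> affine_ideal Z \<Longrightarrow> a * b \<in> ci.FF" for a
  proof -
    have "a \<in> Z' p" if p: "p \<in> chart" for p
    proof -
      have "a * z \<in> XY p" if "z \<in> Z p" for z
        using a(2) FF_XY p by (intro colon_local[OF Z(1,3) p XY_ideal[OF p] a(1) _ that]) blast
      moreover have "a \<in> local_ring p" using a(1) R_subset_local_ring[OF p] by blast
      ultimately show ?thesis unfolding colon colon_ideal_def by blast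
    qed
    then show ?thesis using a(1) unfolding affine_ideal_def by blast
  qed
  obtain J :: "(plane \<times> cpoly fract) set" and e
    where J: "fract_ls.basis_mod lf.R (affine_ideal Z) J e" "card J = scheme_length Z"
    using basis_mod_affine_ideal[OF Z(1,3)] by blast
  obtain J' :: "(plane \<times> cpoly fract) set" and e'
    where J': "fract_ls.basis_mod lf.R (affine_ideal Z') J' e'" "card J' = scheme_length Z'"
    using basis_mod_affine_ideal[OF Z'(1,3)] by blast
  have "fract_vs.dim (affine_ideal Z \<inter> P (int ?d - 2)) = fract_vs.dim (affine_ideal Z' \<inter> P (int ?d - 1))"
  proof (rule ci.dim_residual[OF subspace_affine_ideal[OF Z(1)] FF_Z affine_ideal_subset_R _ J(1) _
        subspace_affine_ideal[OF Z'(1)] FF_Z' affine_ideal_subset_R J'(1) _ colon_le])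
    show "2 * int (card J) = (int ?d - 1) * int ?d"
      using Z(2) unfolding J(2) by (metis add_diff_cancel_right' of_nat_1 of_nat_add of_nat_mult of_nat_numeral)
    show "2 * int (card J') = int ?d * (int ?d + 1)"
    proof -
      have "int (2 * card J') = int ((r + 1) * (r + 2))" using Z'(2) unfolding J'(2) by presburger
      then show ?thesis by (simp add: algebra_simps)
    qed
  qed (use affine_ideal_mult[OF Z(1)] in auto)
  moreover have "int ?d - 2 = int (r - 1)" "int ?d - 1 = int r" "int r - 1 = int (r - 1)" using r by auto
  ultimately show ?thesis using h0_eq[OF Z(1,3), of "r - 1"] h0_eq[OF Z'(1,3), of r] by metis
qed

end

text \<open>In the family of lines with \<open>\<alpha> = t ^ 2\<close> and
  \<open>\<beta> = t\<close>, passing through a given point is a nontrivial polynomial condition on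
  \<open>t\<close>, so a common non-root of finitely many such polynomials exists.\<close>

lemma ex_chart:
  assumes "finite S"
  obtains \<alpha> \<beta> where "S \<subseteq> affine_chart.chart \<alpha> \<beta>"
proof -
  define h where "h p = [:rep p $ 3, - rep p $ 2, - rep p $ 1:]" for p
  have "h p \<noteq> 0" for p
  proof
    assume "h p = 0"
    then have "rep p $ i = 0" for i using exhaust_3[of i] by (auto simp: h_def)
    then show False using rep(1)[of p] by (simp add: vec_eq_iff)
  qed
  then have "(\<Prod>p\<in>S. h p) \<noteq> 0" using assms by simp
  then obtain t where t: "poly (\<Prod>p\<in>S. h p) t \<noteq> 0" using poly_all_0_iff_0 by blast
  have "value_at (affine_chart.l (t\<^sup>2) t) p \<noteq> 0" if "p \<in> S" for p
  proof -
    have "poly (h p) t \<noteq> 0" using t that assms by (auto simp: poly_prod)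
    then show ?thesis by (simp add: affine_chart.eval_l h_def algebra_simps power2_eq_square)
  qed
  then show ?thesis using that[of "t\<^sup>2" t] unfolding affine_chart.chart_def by blast
qed

text \<open>Lets the two curves exchange roles, so that whichever is nonzero at
  \<open>[1:0:\<alpha>]\<close> can be taken as \<open>f\<close>.\<close>

lemma intersection_ideal_commute: "intersection_ideal I J = intersection_ideal J I"
  unfolding intersection_ideal_def by (intro ext) (auto, (metis add.commute)+)

theorem theoremA:
  fixes r n m :: nat and Z Z' :: ideal_stalks
  assumes "r \<ge> 1"
    and "n = r * (r + 1) div 2"
    and "m = (r + 1) * (r + 2) div 2"
    and "Z \<in> Hilb n"
    and "Z' \<in> Hilb m"
    and "residual_by_curves (r + 1) Z Z'"
  shows "Z \<in> D n (int r - 1) \<longleftrightarrow> Z' \<in> D m (int r)"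
proof -
  obtain F G where FG: "form (r + 1) F" "form (r + 1) G"
    and XY: "\<And>p. intersection_ideal (curve_ideal (r + 1) F) (curve_ideal (r + 1) G) p \<subseteq> Z p"
    and colon: "Z' = colon_ideal (intersection_ideal (curve_ideal (r + 1) F) (curve_ideal (r + 1) G)) Z"
    using assms(6) unfolding residual_by_curves_def plane_curve_def Let_def by blast
  have Z: "zero_dim_subscheme Z" "scheme_length Z = n" and Z': "zero_dim_subscheme Z'" "scheme_length Z' = m"
    using assms(4,5) unfolding Hilb_def by auto
  have len: "2 * scheme_length Z = r * (r + 1)" "2 * scheme_length Z' = (r + 1) * (r + 2)"
    unfolding Z(2) Z'(2) assms(2,3) by simp_all
  have "finite (support Z \<union> support Z')" using Z(1) Z'(1) unfolding zero_dim_subscheme_def by blast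
  then obtain \<alpha> \<beta> where chart: "support Z \<union> support Z' \<subseteq> affine_chart.chart \<alpha> \<beta>" by (rule ex_chart)
  interpret affine_chart \<alpha> \<beta> .
  have supp: "support Z \<subseteq> chart" "support Z' \<subseteq> chart" using chart by auto
  \<comment> \<open>The point of the line with infinite parameter. It lies outside the chart, so one
    of the two curves misses it.\<close>
  let ?v = "(\<chi> i. if i = 1 then 1 else if i = 2 then 0 else \<alpha>) :: complex ^ 3"
  have "?v $ 1 \<noteq> 0" by simp
  then have "?v \<noteq> 0" by (metis zero_index)
  moreover have "eval_poly l ?v = 0" by (simp add: eval_l)
  ultimately obtain p where p: "p \<notin> chart" "\<forall>d F. form d F \<longrightarrow> (value_at F p = 0 \<longleftrightarrow> eval_poly F ?v = 0)"
    by (rule point_at_infinity)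
  have "local_ideal p (Z p)" using Z(1) unfolding zero_dim_subscheme_def by blast
  moreover have "p \<notin> support Z" "p \<notin> support Z'" using p(1) supp by auto
  ultimately have "value_at F p \<noteq> 0 \<or> value_at G p \<noteq> 0"
    using no_common_zero[OF FG, of p Z] unfolding colon by blast
  then have "eval_poly F ?v \<noteq> 0 \<or> eval_poly G ?v \<noteq> 0" using p(2) FG by blast
  then have "h0 Z (int r - 1) = h0 Z' (int r)"
  proof
    assume "eval_poly F ?v \<noteq> 0"
    then show ?thesis
      by (rule h0_residual[OF assms(1) FG Z(1) len(1) supp(1) Z'(1) len(2) supp(2) XY colon])
  next
    assume "eval_poly G ?v \<noteq> 0"
    then show ?thesis
      by (rule h0_residual[OF assms(1) FG(2,1) Z(1) len(1) supp(1) Z'(1) len(2) supp(2)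
            XY[unfolded intersection_ideal_commute[of "curve_ideal (r + 1) F"]]
            colon[unfolded intersection_ideal_commute[of "curve_ideal (r + 1) F"]]])
  qed
  then show ?thesis using assms(4,5) unfolding D_def by simp
qed

end
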